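(* Let $P=3X^4-8X^3+10X^2-16X+7\in\mathbb R[X]$ and let $$m_0=\frac23+\frac13\sqrt{-1-\frac{2^{2/3}}{\sqrt[3]{32+3\sqrt{114}}}+\sqrt[3]{2(32+3\sqrt{114})}}+\frac12\sqrt{-\frac89+\frac{2^{8/3}}{9\sqrt[3]{32+3\sqrt{114}}}-\frac49\sqrt[3]{2(32+3\sqrt{114})}+\frac{88}{9\sqrt{-1-\frac{2^{2/3}}{\sqrt[3]{32+3\sqrt{114}}}+\sqrt[3]{2(32+3\sqrt{114})}}}}=2.039423\cdots$$ be its largest real root. Fix $m_0<m<\infty$ and let $$\mathscr L_m=\Delta+2(m-1)\frac{x}{|x|^2}\cdot\nabla+\frac{(m-1)^2}{|x|^2},\qquad \mathfrak L_m=\partial_z^2+\frac{m-1}{z}\partial_z+\frac{(m-1)(m-3)}{4z^2}.$$ For all $0<\beta<1/2$ and $0<\gamma<1$, there exist $\Lambda_\gamma<\infty$ and a universal constant $C_{m,\beta,\gamma}<\infty$ such that for all $0<a<b<\infty$ satisfying $$\log\left(\frac ba\right)\ge\Lambda_\gamma,$$ setting $\Omega=B_b\setminus\overline B_a(0)\subset\mathbb R^2$, for every function $u\in W^{2,2}(\Omega)$ such that $\mathscr L_m^*\mathscr L_mu=0$, we have $$\int_\Omega\frac1{|x|^2}\left|\nabla u+(m-1)\frac{x}{|x|^2}u\right|^2\left(\left(\frac{|x|}b\right)^{2\gamma}+\left(\frac a{|x|}\right)^{2\gamma}\right)dx$$ $$\le C_{m,\beta,\gamma}\left(\int_\Omega\frac{u^2}{|x|^4}\left(\left(\frac{|x|}b\right)^{4\beta}+\left(\frac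 a{|x|}\right)^{4\beta}\right)dx+\int_\Omega\left(\mathscr L_mu\right)^2dx+\int_\Omega\left|\mathfrak L_mu\right|^2|dz|^2\right).$$
   Context: $B_r$ is the open disc of radius $r$ centred at $0$ in $\mathbb R^2\simeq\mathbb C$; $\partial_z=\frac12(\partial_{x_1}-i\partial_{x_2})$; $|dz|^2=dx$ is Lebesgue measure; $u$ is real-valued. $\mathscr L_m^*$ is the formal $L^2$-adjoint, $\mathscr L_m^*=\Delta-2(m-1)\frac{x}{|x|^2}\cdot\nabla+\frac{(m-1)^2}{|x|^2}$, so that $$\mathscr L_m^*\mathscr L_m=\Delta^2+\frac{2(m^2-1)}{|x|^2}\Delta-4(m^2-1)\left(\frac{x}{|x|^2}\right)^t\cdot\nabla^2(\,\cdot\,)\cdot\left(\frac{x}{|x|^2}\right)+\frac{(m^2-1)^2}{|x|^4}.$$ *)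

theory Defs
  imports "HOL-Analysis.Analysis" "HOL-Computational_Algebra.Polynomial"
begin

section \<open>Weak derivatives and Sobolev spaces\<close>

text \<open>Iterated partial derivatives; a list of basis vectors plays the role of a multi-index.\<close>

fun partial :: "'a list \<Rightarrow> ('a::euclidean_space \<Rightarrow> 'b::real_normed_vector) \<Rightarrow> 'a \<Rightarrow> 'b" where
  "partial [] f = f"
| "partial (e # es) f = (\<lambda>x. frechet_derivative (partial es f) (at x) e)"

definition smooth :: "('a::euclidean_space \<Rightarrow> 'b::real_normed_vector) \<Rightarrow> bool" where
  "smooth f \<longleftrightarrow> (\<forall>es. set es \<subseteq> Basis \<longrightarrow> partial es f differentiable_on UNIV)"

definition test_functions :: "'a::euclidean_space set \<Rightarrow> ('a \<Rightarrow> real) set" where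
  "test_functions \<Omega> =
     {\<phi>. smooth \<phi> \<and> compact (closure {x. \<phi> x \<noteq> 0}) \<and> closure {x. \<phi> x \<noteq> 0} \<subseteq> \<Omega>}"

definition locally_integrable ::
  "'a::euclidean_space set \<Rightarrow> ('a \<Rightarrow> 'b::{banach, second_countable_topology}) \<Rightarrow> bool" where
  "locally_integrable \<Omega> f \<longleftrightarrow> (\<forall>K. compact K \<and> K \<subseteq> \<Omega> \<longrightarrow> set_integrable lebesgue K f)"

definition has_weak_deriv ::
  "'a::euclidean_space set \<Rightarrow> 'a list \<Rightarrow> ('a \<Rightarrow> 'b::{banach, second_countable_topology})
     \<Rightarrow> ('a \<Rightarrow> 'b) \<Rightarrow> bool" where
  "has_weak_deriv \<Omega> es f g \<longleftrightarrow>
     locally_integrable \<Omega> f \<and> locally_integrable \<Omega> g \<and>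
     (\<forall>\<phi>\<in>test_functions \<Omega>.
        (LINT x:\<Omega>|lebesgue. partial es \<phi> x *\<^sub>R f x) =
        (-1) ^ length es *\<^sub>R (LINT x:\<Omega>|lebesgue. \<phi> x *\<^sub>R g x))"

definition square_integrable ::
  "'a::euclidean_space set \<Rightarrow> ('a \<Rightarrow> 'b::{banach, second_countable_topology}) \<Rightarrow> bool" where
  "square_integrable \<Omega> f \<longleftrightarrow>
     set_borel_measurable lebesgue \<Omega> f \<and> set_integrable lebesgue \<Omega> (\<lambda>x. (norm (f x))\<^sup>2)"

text \<open>\<open>sobolev2 k \<Omega>\<close> is \<open>W\<^sup>k\<^sup>,\<^sup>2(\<Omega>)\<close>, as a set of functions (not of a.e. classes).\<close>

definition sobolev2 ::
  "nat \<Rightarrow> 'a::euclidean_space set \<Rightarrow> ('a \<Rightarrow> 'b::{banach, second_countable_topology}) set" where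
  "sobolev2 k \<Omega> =
     {f. \<forall>es. set es \<subseteq> Basis \<and> length es \<le> k \<longrightarrow>
           (\<exists>g. has_weak_deriv \<Omega> es f g \<and> square_integrable \<Omega> g)}"

text \<open>A representative of the weak derivative. It is determined only up to null sets of \<open>\<Omega>\<close>
  (and is arbitrary outside \<open>\<Omega>\<close>), so it should only be used under integrals over \<open>\<Omega>\<close>.\<close>

definition weak_deriv ::
  "'a::euclidean_space set \<Rightarrow> 'a list \<Rightarrow> ('a \<Rightarrow> 'b::{banach, second_countable_topology})
     \<Rightarrow> 'a \<Rightarrow> 'b" where
  "weak_deriv \<Omega> es f = (SOME g. has_weak_deriv \<Omega> es f g)"

definition weak_grad :: "'a::euclidean_space set \<Rightarrow> ('a \<Rightarrow> real) \<Rightarrow> 'a \<Rightarrow> 'a" where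
  "weak_grad \<Omega> u x = (\<Sum>e\<in>Basis. weak_deriv \<Omega> [e] u x *\<^sub>R e)"

definition weak_laplacian :: "'a::euclidean_space set \<Rightarrow> ('a \<Rightarrow> real) \<Rightarrow> 'a \<Rightarrow> real" where
  "weak_laplacian \<Omega> u x = (\<Sum>e\<in>Basis. weak_deriv \<Omega> [e, e] u x)"


section \<open>The operators\<close>

text \<open>The plane is the type \<^typ>\<open>complex\<close>, with \<open>Basis = {1, \<i>}\<close> and
  the real inner product of \<open>\<real>\<^sup>2\<close>.\<close>

definition inversion :: "complex \<Rightarrow> complex" where
  "inversion x = (1 / (norm x)\<^sup>2) *\<^sub>R x"

definition L_op :: "complex set \<Rightarrow> real \<Rightarrow> (complex \<Rightarrow> real) \<Rightarrow> complex \<Rightarrow> real" where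
  "L_op \<Omega> m u x =
     weak_laplacian \<Omega> u x + 2 * (m - 1) * (inversion x \<bullet> weak_grad \<Omega> u x)
     + (m - 1)\<^sup>2 / (norm x)\<^sup>2 * u x"

definition dz :: "complex set \<Rightarrow> (complex \<Rightarrow> complex) \<Rightarrow> complex \<Rightarrow> complex" where
  "dz \<Omega> f z = (1 / 2) * (weak_deriv \<Omega> [1] f z - \<i> * weak_deriv \<Omega> [\<i>] f z)"

definition frakL_op :: "complex set \<Rightarrow> real \<Rightarrow> (complex \<Rightarrow> real) \<Rightarrow> complex \<Rightarrow> complex" where
  "frakL_op \<Omega> m u z =
     (let f = (\<lambda>w. complex_of_real (u w))
      in dz \<Omega> (dz \<Omega> f) z + of_real (m - 1) / z * dz \<Omega> f z
         + of_real ((m - 1) * (m - 3)) / (4 * z\<^sup>2) * f z)"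

text \<open>For \<open>u \<in> W\<^sup>2\<^sup>,\<^sup>2(\<Omega>)\<close> the function \<open>L\<^sub>m u\<close> is only square integrable, so the
  fourth-order equation \<open>L\<^sub>m\<^sup>* L\<^sub>m u = 0\<close> is read in the sense of distributions on \<open>\<Omega>\<close>:
  pairing \<open>L\<^sub>m\<^sup>* (L\<^sub>m u)\<close> with a test function \<open>\<phi>\<close> moves the formal \<open>L\<^sup>2\<close>-adjoint
  \<open>L\<^sub>m\<^sup>*\<close> onto \<open>\<phi>\<close>, where it becomes \<open>L\<^sub>m\<close>. Since \<open>x / |x|\<^sup>2\<close> is
  divergence free off the origin, \<open>L\<^sub>m\<^sup>*\<close> is \<open>L\<^sub>m\<close> with the sign of the first-order term
  reversed. On \<open>\<phi>\<close> the weak derivatives in \<^const>\<open>L_op\<close> are the classical ones (a.e.).\<close>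

definition L_adjoint_L_zero :: "complex set \<Rightarrow> real \<Rightarrow> (complex \<Rightarrow> real) \<Rightarrow> bool" where
  "L_adjoint_L_zero \<Omega> m u \<longleftrightarrow>
     (\<forall>\<phi>\<in>test_functions \<Omega>. (LINT x:\<Omega>|lebesgue. L_op \<Omega> m u x * L_op \<Omega> m \<phi> x) = 0)"

definition annulus :: "real \<Rightarrow> real \<Rightarrow> complex set" where
  "annulus a b = ball 0 b - cball 0 a"


section \<open>The threshold\<close>

definition P_poly :: "real poly" where
  "P_poly = [:7, -16, 10, -8, 3:]"

definition m0 :: real where
  "m0 =
     (let c = root 3 (32 + 3 * sqrt 114);
          A = -1 - 2 powr (2/3) / c + root 3 (2 * (32 + 3 * sqrt 114))
      in 2/3 + 1/3 * sqrt A
         + 1/2 * sqrt (- (8/9) + 2 powr (8/3) / (9 * c)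
                       - 4/9 * root 3 (2 * (32 + 3 * sqrt 114)) + 88 / (9 * sqrt A)))"

end

theory Submission
  imports Defs
begin

text \<open>
  Put \<open>k = m - 1\<close> and \<open>v = |x|\<^sup>k u\<close>. Then \<open>\<nabla>u + k x / |x|\<^sup>2 u = |x|\<^sup>-\<^sup>k \<nabla>v\<close>,
  \<open>L\<^sub>m u = |x|\<^sup>-\<^sup>k \<Delta>v\<close>, and the complex operator applied to \<open>u\<close> is \<open>|x|\<^sup>-\<^sup>k \<partial>\<^sub>z\<^sup>2 v\<close>, so the last two
  integrals on the right control \<open>|x|\<^sup>-\<^sup>2\<^sup>k |\<nabla>\<^sup>2 v|\<^sup>2\<close>. As the weights on the left are at most \<open>2\<close> and
  the weight of \<open>u\<^sup>2\<close> is bounded below near the inner circle, a Hardy inequality suffices: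
  \<open>\<integral> |x|\<^sup>-\<^sup>2\<^sup>k\<^sup>-\<^sup>2 |\<nabla>v|\<^sup>2 \<le> C (\<integral>\<^bsub>|x|\<^sup>2 \<le> 6a\<^sup>2\<^esub> |x|\<^sup>-\<^sup>2\<^sup>k\<^sup>-\<^sup>4 v\<^sup>2 + \<integral> |x|\<^sup>-\<^sup>2\<^sup>k |\<nabla>\<^sup>2 v|\<^sup>2)\<close>.
  Pair the derivatives \<open>f\<close> of \<open>v\<close> with the divergence of \<open>|x|\<^sup>-\<^sup>2\<^sup>k\<^sup>-\<^sup>2 q(|x|\<^sup>2/a\<^sup>2) x\<close>, where \<open>q\<close> is
  negative near the inner circle and tends to \<open>1\<close>; the boundary terms at both circles then have the
  favourable sign, and the divergence has the wrong sign only in a collar away from the boundary,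
  where \<open>\<nabla>v\<close> is estimated by \<open>v\<close> and \<open>\<nabla>\<^sup>2v\<close>.

  The weak product rule behind these integrations by parts comes from doubling variables: testing
  with \<open>\<eta>(x) \<rho>\<^sub>n(x - y)\<close> in either variable, the derivatives of the mollifier \<open>\<rho>\<^sub>n\<close> cancel.
\<close>

section \<open>Smooth functions and test functions\<close>

text \<open>In the plane the divergence of |x|^(-2k-2) x is -2k |x|^(-2k-2), so for \<open>k\<close>
  > 0 integrating f^2 against it produces the weighted norm of \<open>f\<close> with a coefficient
  of fixed sign. The flux of the same field through the inner circle has the wrong sign, however,
  and no trace of \<open>f\<close> is at hand to bound it. This forces the factor q to change sign
  between the circles, and the collar is the price of that change. Boundary terms never appear as
  such: the field is multiplied by a cutoff that vanishes near both circles, and the sign of the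
  flux reappears as the sign of q times the derivative of the cutoff. A limit removes the cutoff at
  the end. No interior regularity is invoked: all functions stay square integrable with weak
  derivatives, which is why a product rule for two such factors is the central tool. The constants
  fit as follows: \<open>m0\<close> is at least 2, so \<open>k\<close> is at least 1, which makes
  the exponential in q decay at a uniform rate; and log(b/a) at least log 4 gives b^2 >= 16 a^2,
  which leaves room for the collar and its surrounding cutoff, both inside |x|^2 <= 6 a^2.\<close>

definition smooth_on :: "'a::euclidean_space set \<Rightarrow> ('a \<Rightarrow> 'b::real_normed_vector) \<Rightarrow> bool" where
  "smooth_on U f \<longleftrightarrow> (\<forall>es. set es \<subseteq> Basis \<longrightarrow> (\<forall>x\<in>U. partial es f differentiable (at x)))"

lemma smooth_iff: "smooth f \<longleftrightarrow> smooth_on UNIV f"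
  by (auto simp: smooth_def smooth_on_def differentiable_on_def)

lemma smooth_on_subset: "smooth_on U f \<Longrightarrow> V \<subseteq> U \<Longrightarrow> smooth_on V f"
  by (auto simp: smooth_on_def)

lemma partial_append: "partial (es @ fs) f = partial es (partial fs f)"
  by (induction es) auto

lemma smooth_on_partial:
  assumes "smooth_on U f" "set fs \<subseteq> Basis"
  shows "smooth_on U (partial fs f)"
  unfolding smooth_on_def
proof (intro allI impI)
  fix es :: "'a list" assume "set es \<subseteq> Basis"
  with assms(2) have "set (es @ fs) \<subseteq> Basis" by simp
  with assms(1) show "\<forall>x\<in>U. partial es (partial fs f) differentiable at x"
    unfolding smooth_on_def partial_append[symmetric] by blast
qed

lemma smooth_on_differentiable:
  assumes "smooth_on U f" "x \<in> U"
  shows "f differentiable (at x)"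
  using assms unfolding smooth_on_def by (auto dest!: spec[of _ "[]"])

lemma smooth_on_imp_continuous_on: "smooth_on U f \<Longrightarrow> continuous_on U f"
  by (auto intro!: continuous_at_imp_continuous_on differentiable_imp_continuous_within
      smooth_on_differentiable)

text \<open>Membership in \<open>X\<close> serves as an invariant: by induction on the list of
  directions, every iterated partial derivative coincides on \<open>U\<close> with some member of
  \<open>X\<close>. Agreement on \<open>U\<close> suffices because \<open>U\<close> is open, and it
  lets the textbook formula of a derivative stand in for \<open>frechet_derivative\<close>.\<close>

lemma smooth_on_coinduct:
  assumes "open U" and "f \<in> X"
    and diff: "\<And>g x. g \<in> X \<Longrightarrow> x \<in> U \<Longrightarrow> g differentiable (at x)"
    and closed: "\<And>g e. g \<in> X \<Longrightarrow> e \<in> Basis \<Longrightarrow>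
           \<exists>h\<in>X. \<forall>x\<in>U. frechet_derivative g (at x) e = h x"
  shows "smooth_on U f"
proof -
  have *: "\<exists>h\<in>X. \<forall>x\<in>U. partial es f x = h x" if "set es \<subseteq> Basis" for es
    using that
  proof (induction es)
    case Nil
    then show ?case using \<open>f \<in> X\<close> by auto
  next
    case (Cons e es)
    then obtain g where g: "g \<in> X" "\<forall>x\<in>U. partial es f x = g x" by auto
    obtain h where h: "h \<in> X" "\<forall>x\<in>U. frechet_derivative g (at x) e = h x"
      using closed[OF g(1), of e] Cons.prems by (meson list.set_intros(1) subsetD)
    have "partial (e # es) f x = h x" if "x \<in> U" for x
    proof -
      have "frechet_derivative g (at x) = frechet_derivative (partial es f) (at x)"
        using diff[OF g(1) that] g(2) that \<open>open U\<close>
        by (intro frechet_derivative_transform_within_open) auto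
      then show ?thesis using bspec[OF h(2) that] by simp
    qed
    with h(1) show ?case by auto
  qed
  then show ?thesis
    unfolding smooth_on_def
  proof (intro allI impI ballI)
    fix es :: "'a list" and x assume "set es \<subseteq> Basis" "x \<in> U"
    obtain h where h: "h \<in> X" "\<forall>x\<in>U. partial es f x = h x"
      using * \<open>set es \<subseteq> Basis\<close> by blast
    obtain D where "(h has_derivative D) (at x)"
      using diff[OF h(1) \<open>x \<in> U\<close>] by (auto simp: differentiable_def)
    then have "(partial es f has_derivative D) (at x)"
      by (rule has_derivative_transform_within_open[OF _ \<open>open U\<close> \<open>x \<in> U\<close>]) (use h in auto)
    then show "partial es f differentiable at x" by (auto simp: differentiable_def)
  qed
qed

lemma partial_cong:
  assumes "open U" "smooth_on U f" "\<And>x. x \<in> U \<Longrightarrow> f x = g x" "set es \<subseteq> Basis" "x \<in> U"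
  shows "partial es g x = partial es f x"
  using assms(4,5)
proof (induction es arbitrary: x)
  case (Cons e es)
  have "frechet_derivative (partial es f) (at x) = frechet_derivative (partial es g) (at x)"
    using Cons assms(1,2)
    by (intro frechet_derivative_transform_within_open[where X=U]) (auto simp: smooth_on_def)
  then show ?case by simp
qed (use assms in auto)

lemma smooth_on_cong:
  assumes "open U" "smooth_on U f" "\<And>x. x \<in> U \<Longrightarrow> f x = g x"
  shows "smooth_on U g"
  unfolding smooth_on_def
proof (intro allI impI ballI)
  fix es :: "'a list" and x assume "set es \<subseteq> Basis" "x \<in> U"
  then have "partial es f differentiable at x" using assms(2) by (auto simp: smooth_on_def)
  moreover have "\<And>y. y \<in> U \<Longrightarrow> partial es f y = partial es g y"
    using partial_cong[OF assms] \<open>set es \<subseteq> Basis\<close> by metis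
  ultimately show "partial es g differentiable at x"
    unfolding differentiable_def
    using has_derivative_transform_within_open[OF _ \<open>open U\<close> \<open>x \<in> U\<close>] by blast
qed

lemma smooth_on_Un: "smooth_on U f \<Longrightarrow> smooth_on V f \<Longrightarrow> smooth_on (U \<union> V) f"
  by (auto simp: smooth_on_def)

text \<open>The algebra generated by smooth functions and closed under composition with smooth
  functions of one variable is closed under partial derivatives, hence consists of smooth
  functions.\<close>

inductive_set smooth_closure :: "'a::euclidean_space set \<Rightarrow> ('a \<Rightarrow> real) set"
  for U :: "'a set" where
  base: "smooth_on U f \<Longrightarrow> f \<in> smooth_closure U"
| add: "f \<in> smooth_closure U \<Longrightarrow> g \<in> smooth_closure U \<Longrightarrow> (\<lambda>x. f x + g x) \<in> smooth_closure U"
| mult: "f \<in> smooth_closure U \<Longrightarrow> g \<in> smooth_closure U \<Longrightarrow> (\<lambda>x. f x * g x) \<in> smooth_closure U"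
| comp: "f \<in> smooth_closure U \<Longrightarrow> smooth_on V \<phi> \<Longrightarrow> f ` U \<subseteq> V \<Longrightarrow>
         (\<lambda>x. (\<phi> :: real \<Rightarrow> real) (f x)) \<in> smooth_closure U"

lemma frechet_derivative_add_at:
  assumes "f differentiable (at x)" "g differentiable (at x)"
  shows "frechet_derivative (\<lambda>x. f x + g x) (at x) e
         = frechet_derivative f (at x) e + frechet_derivative g (at x) e"
  using frechet_derivative_at[OF has_derivative_add[OF assms[unfolded frechet_derivative_works]]]
  by metis

lemma frechet_derivative_mult_at:
  fixes f g :: "'a::real_normed_vector \<Rightarrow> real"
  assumes "f differentiable (at x)" "g differentiable (at x)"
  shows "frechet_derivative (\<lambda>x. f x * g x) (at x) e
         = f x * frechet_derivative g (at x) e + frechet_derivative f (at x) e * g x"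
  using frechet_derivative_at[OF has_derivative_mult[OF assms[unfolded frechet_derivative_works]]]
  by metis

lemma frechet_derivative_compose_real:
  fixes f :: "'a::real_normed_vector \<Rightarrow> real" and \<phi> :: "real \<Rightarrow> real"
  assumes "f differentiable (at x)" "\<phi> differentiable (at (f x))"
  shows "(\<lambda>x. \<phi> (f x)) differentiable (at x)"
    and "frechet_derivative (\<lambda>x. \<phi> (f x)) (at x) e
         = frechet_derivative \<phi> (at (f x)) 1 * frechet_derivative f (at x) e"
proof -
  let ?f = "frechet_derivative f (at x)" and ?p = "frechet_derivative \<phi> (at (f x))"
  have f: "(f has_derivative ?f) (at x)" and p: "(\<phi> has_derivative ?p) (at (f x))"
    using assms frechet_derivative_works by auto
  have *: "((\<lambda>x. \<phi> (f x)) has_derivative (\<lambda>h. ?p (?f h))) (at x)"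
    using has_derivative_compose[OF f p] .
  then show "(\<lambda>x. \<phi> (f x)) differentiable (at x)" by (auto simp: differentiable_def)
  have "?p (?f e) = ?p (?f e *\<^sub>R 1)" by simp
  also have "\<dots> = ?f e *\<^sub>R ?p 1"
    using linear_cmul[OF has_derivative_linear[OF p]] .
  finally show "frechet_derivative (\<lambda>x. \<phi> (f x)) (at x) e = ?p 1 * ?f e"
    using fun_cong[OF frechet_derivative_at[OF *], of e] by (simp add: mult.commute)
qed

lemma smooth_closure_smooth:
  assumes "open U" "f \<in> smooth_closure U"
  shows "smooth_on U f"
proof -
  have *: "(\<forall>x\<in>U. f differentiable (at x)) \<and>
        (\<forall>e\<in>Basis. \<exists>h\<in>smooth_closure U. \<forall>x\<in>U. frechet_derivative f (at x) e = h x)"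
    if "f \<in> smooth_closure U" for f
    using that
  proof induction
    case (base f)
    have "partial [e] f \<in> smooth_closure U" if "e \<in> Basis" for e
      using that base by (intro smooth_closure.base smooth_on_partial) auto
    moreover have "frechet_derivative f (at x) e = partial [e] f x" for x e by simp
    ultimately show ?case using base smooth_on_differentiable by blast
  next
    case (add f g)
    have df: "f differentiable (at x)" and dg: "g differentiable (at x)" if "x \<in> U" for x
      using add.IH that by blast+
    have "\<exists>h\<in>smooth_closure U. \<forall>x\<in>U. frechet_derivative (\<lambda>x. f x + g x) (at x) e = h x"
      if e: "e \<in> Basis" for e
    proof -
      obtain f' where "f' \<in> smooth_closure U" "\<forall>x\<in>U. frechet_derivative f (at x) e = f' x"
        using bspec[OF conjunct2[OF add.IH(1)] e] by auto
      moreover obtain g' where "g' \<in> smooth_closure U" "\<forall>x\<in>U. frechet_derivative g (at x) e = g' x"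
        using bspec[OF conjunct2[OF add.IH(2)] e] by auto
      ultimately show ?thesis
        by (intro bexI[of _ "\<lambda>x. f' x + g' x"] smooth_closure.add)
           (simp_all add: frechet_derivative_add_at df dg)
    qed
    then show ?case using df dg by simp
  next
    case (mult f g)
    have df: "f differentiable (at x)" and dg: "g differentiable (at x)" if "x \<in> U" for x
      using mult.IH that by blast+
    have "\<exists>h\<in>smooth_closure U. \<forall>x\<in>U. frechet_derivative (\<lambda>x. f x * g x) (at x) e = h x"
      if e: "e \<in> Basis" for e
    proof -
      obtain f' where "f' \<in> smooth_closure U" "\<forall>x\<in>U. frechet_derivative f (at x) e = f' x"
        using bspec[OF conjunct2[OF mult.IH(1)] e] by auto
      moreover obtain g' where "g' \<in> smooth_closure U" "\<forall>x\<in>U. frechet_derivative g (at x) e = g' x"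
        using bspec[OF conjunct2[OF mult.IH(2)] e] by auto
      ultimately show ?thesis
        by (intro bexI[of _ "\<lambda>x. f x * g' x + f' x * g x"] smooth_closure.add smooth_closure.mult)
           (simp_all add: frechet_derivative_mult_at df dg mult.hyps)
    qed
    then show ?case using df dg by simp
  next
    case (comp f V \<phi>)
    have df: "f differentiable (at x)" and d: "\<phi> differentiable (at (f x))" if "x \<in> U" for x
      using that comp smooth_on_differentiable by blast+
    have "\<exists>h\<in>smooth_closure U. \<forall>x\<in>U. frechet_derivative (\<lambda>x. \<phi> (f x)) (at x) e = h x"
      if e: "e \<in> Basis" for e
    proof -
      obtain f' where "f' \<in> smooth_closure U" "\<forall>x\<in>U. frechet_derivative f (at x) e = f' x"
        using bspec[OF conjunct2[OF comp.IH] e] by auto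
      \<comment> \<open>The only basis vector of the reals is 1, so
        \<open>partial [1] \<phi>\<close> is the ordinary derivative. It is again smooth on
        \<open>V\<close>, and the rule \<open>comp\<close> applies to it with the same inner
        function.\<close>
      moreover have "(\<lambda>x. partial [1] \<phi> (f x)) \<in> smooth_closure U"
        by (intro smooth_closure.comp[where V=V and \<phi>="partial [1] \<phi>"] comp.hyps smooth_on_partial) simp
      ultimately show ?thesis
        by (intro bexI[of _ "\<lambda>x. partial [1] \<phi> (f x) * f' x"] smooth_closure.mult)
           (simp_all add: frechet_derivative_compose_real(2) df d)
    qed
    then show ?case using df d by (simp add: frechet_derivative_compose_real(1))
  qed
  show ?thesis
    by (rule smooth_on_coinduct[OF assms]) (use * in blast)+
qed

lemma smooth_on_add:
  fixes f g :: "'a::euclidean_space \<Rightarrow> real"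
  shows "open U \<Longrightarrow> smooth_on U f \<Longrightarrow> smooth_on U g \<Longrightarrow> smooth_on U (\<lambda>x. f x + g x)"
  using smooth_closure_smooth[OF _ smooth_closure.add[OF smooth_closure.base smooth_closure.base]] .

lemma smooth_on_mult:
  fixes f g :: "'a::euclidean_space \<Rightarrow> real"
  shows "open U \<Longrightarrow> smooth_on U f \<Longrightarrow> smooth_on U g \<Longrightarrow> smooth_on U (\<lambda>x. f x * g x)"
  using smooth_closure_smooth[OF _ smooth_closure.mult[OF smooth_closure.base smooth_closure.base]] .

lemma smooth_on_compose:
  fixes f :: "'a::euclidean_space \<Rightarrow> real" and \<phi> :: "real \<Rightarrow> real"
  shows "open U \<Longrightarrow> smooth_on V \<phi> \<Longrightarrow> smooth_on U f \<Longrightarrow> f ` U \<subseteq> V \<Longrightarrow> smooth_on U (\<lambda>x. \<phi> (f x))"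
  using smooth_closure_smooth[OF _ smooth_closure.comp[OF smooth_closure.base]] by blast

lemma smooth_on_const: "smooth_on UNIV (\<lambda>x. c)"
  by (rule smooth_on_coinduct[where X="range (\<lambda>c x. c)"]) auto

lemma smooth_on_const' [intro, simp]: "smooth_on U (\<lambda>x. c)"
  using smooth_on_const smooth_on_subset by blast

lemma frechet_derivative_inner_left_at: "frechet_derivative (\<lambda>x. x \<bullet> v) (at x) e = e \<bullet> v"
proof -
  have "((\<lambda>x. x \<bullet> v) has_derivative (\<lambda>h. h \<bullet> v)) (at x)"
    by (intro has_derivative_inner_left has_derivative_ident)
  from frechet_derivative_at[OF this] show ?thesis by metis
qed

lemma smooth_on_inner [intro, simp]: "smooth_on U (\<lambda>x. x \<bullet> v)"
proof -
  have "smooth_on UNIV (\<lambda>x::'a. x \<bullet> v)"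
    by (rule smooth_on_coinduct[where X="insert (\<lambda>x. x \<bullet> v) (range (\<lambda>c x. c))"])
       (auto simp: frechet_derivative_inner_left_at)
  then show ?thesis using smooth_on_subset by blast
qed

lemma smooth_on_ident_real [intro, simp]: "smooth_on U (\<lambda>x::real. x)"
  using smooth_on_inner[of U "1::real"] by simp

lemma smooth_on_minus:
  fixes f :: "'a::euclidean_space \<Rightarrow> real"
  shows "open U \<Longrightarrow> smooth_on U f \<Longrightarrow> smooth_on U (\<lambda>x. - f x)"
  using smooth_on_mult[of U "\<lambda>x. -1" f] by simp

lemma smooth_on_diff:
  fixes f g :: "'a::euclidean_space \<Rightarrow> real"
  shows "open U \<Longrightarrow> smooth_on U f \<Longrightarrow> smooth_on U g \<Longrightarrow> smooth_on U (\<lambda>x. f x - g x)"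
  using smooth_on_add[of U f "\<lambda>x. - g x"] smooth_on_minus[of U g] by simp

lemma smooth_on_sum:
  fixes f :: "'i \<Rightarrow> 'a::euclidean_space \<Rightarrow> real"
  assumes "open U" "finite I" "\<And>i. i \<in> I \<Longrightarrow> smooth_on U (f i)"
  shows "smooth_on U (\<lambda>x. \<Sum>i\<in>I. f i x)"
  using assms(2,3) by (induction I) (auto intro!: smooth_on_add[OF assms(1)])

lemma smooth_on_norm_sq: "open U \<Longrightarrow> smooth_on U (\<lambda>x. (norm x)\<^sup>2)"
proof -
  assume "open U"
  have "(\<lambda>x::'a. (norm x)\<^sup>2) = (\<lambda>x. \<Sum>b\<in>Basis. (x \<bullet> b) * (x \<bullet> b))"
    unfolding power2_norm_eq_inner by (subst euclidean_inner) simp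
  then show ?thesis using \<open>open U\<close> by (simp add: smooth_on_sum smooth_on_mult)
qed

section \<open>Smooth functions of one real variable\<close>

lemma frechet_derivative_DERIV:
  "(f has_real_derivative d) (at x) \<Longrightarrow> frechet_derivative f (at x) 1 = d"
  using frechet_derivative_at[of f "(*) d" x, symmetric] by (simp add: has_field_derivative_def)

text \<open>If each derivative is a combination of members of the family, the finite linear
  combinations form a set closed under differentiation, as \<open>smooth_on_coinduct\<close>
  requires. Two terms are what \<open>flat\<close> needs; the exponential and the powers get by with
  one.\<close>

lemma smooth_on_family:
  fixes F :: "'i \<Rightarrow> real \<Rightarrow> real"
  assumes "open U"
    and "\<And>i x. x \<in> U \<Longrightarrow> (F i has_real_derivative (a i * F (p i) x + b i * F (q i) x)) (at x)"
  shows "smooth_on U (F i)"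
proof -
  \<comment> \<open>Linear combinations are coded as lists of coefficient-index pairs;
    differentiation replaces each pair by two.\<close>
  define X where "X = range (\<lambda>cs x. \<Sum>(c, i)\<leftarrow>cs. c * F i x)"
  have deriv: "((\<lambda>x. \<Sum>(c, i)\<leftarrow>cs. c * F i x) has_real_derivative
      (\<Sum>(c, i)\<leftarrow>concat (map (\<lambda>(c, i). [(c * a i, p i), (c * b i, q i)]) cs). c * F i x)) (at x)"
    if "x \<in> U" for x cs
  proof (induction cs)
    case (Cons ci cs)
    obtain c i where "ci = (c, i)" by force
    show ?case
      using DERIV_add[OF DERIV_cmult[OF assms(2)[OF that, of i], of c] Cons]
      by (simp add: \<open>ci = (c, i)\<close> algebra_simps)
  qed simp
  show ?thesis
  proof (rule smooth_on_coinduct[where X=X])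
    have "F i = (\<lambda>x. \<Sum>(c, i)\<leftarrow>[(1, i)]. c * F i x)" by simp
    then show "F i \<in> X" unfolding X_def by blast
    fix g assume "g \<in> X"
    then obtain cs where g: "g = (\<lambda>x. \<Sum>(c, i)\<leftarrow>cs. c * F i x)" unfolding X_def by auto
    show "g differentiable at x" if "x \<in> U" for x
      using deriv[OF that, of cs] unfolding g real_differentiable_def by blast
    show "\<exists>h\<in>X. \<forall>x\<in>U. frechet_derivative g (at x) e = h x" if "e \<in> Basis" for e
    proof (rule bexI)
      show "\<forall>x\<in>U. frechet_derivative g (at x) e
          = (\<Sum>(c, i)\<leftarrow>concat (map (\<lambda>(c, i). [(c * a i, p i), (c * b i, q i)]) cs). c * F i x)"
        using that frechet_derivative_DERIV[OF deriv] by (auto simp: g)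
    qed (auto simp: X_def)
  qed fact
qed

lemma smooth_on_exp [intro, simp]: "smooth_on U (exp :: real \<Rightarrow> real)"
proof -
  have "smooth_on UNIV ((\<lambda>_::unit. exp :: real \<Rightarrow> real) ())"
    by (rule smooth_on_family[where a="\<lambda>_. 1" and b="\<lambda>_. 0"]) (auto intro!: derivative_eq_intros)
  then show ?thesis by (auto intro: smooth_on_subset)
qed

lemma smooth_on_powr: "smooth_on {0<..} (\<lambda>s::real. s powr p)"
  by (rule smooth_on_family[where F="\<lambda>p s. s powr p" and a="\<lambda>p. p" and b="\<lambda>_. 0" and p="\<lambda>p. p - 1"])
     (auto intro!: derivative_eq_intros)

text \<open>The index records the negative powers of \<open>s\<close> that differentiation produces,
  so that the whole family is closed under it. \<open>flat 0\<close> is the classical function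
  exp(-1/s) extended by zero, and \<open>flat 2\<close> is its derivative.\<close>

definition flat :: "nat \<Rightarrow> real \<Rightarrow> real" where
  "flat j s = (if 0 < s then exp (- 1 / s) / s ^ j else 0)"

text \<open>Only s = 0 is delicate. There the right-hand difference quotient is x^(j+1) / exp x at x
  = 1/h, which tends to zero as x grows; the left-hand one is zero.\<close>

lemma flat_has_derivative:
  "(flat j has_real_derivative (flat (j + 2) s - real j * flat (j + 1) s)) (at s)"
proof -
  consider "s > 0" | "s < 0" | "s = 0" by linarith
  then show ?thesis
  proof cases
    case 1
    have "((\<lambda>s. exp (- 1 / s) / s ^ j) has_real_derivative
        (flat (j + 2) s - real j * flat (j + 1) s)) (at s)"
      using 1 by (auto intro!: derivative_eq_intros
          simp: flat_def field_simps power2_eq_square power_add) (cases j; auto simp: field_simps)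
    then show ?thesis
      by (rule has_field_derivative_transform_within_open[where S="{0<..}"])
         (use 1 in \<open>auto simp: flat_def\<close>)
  next
    case 2
    have "((\<lambda>s. 0) has_real_derivative 0) (at s)" by simp
    then have "(flat j has_real_derivative 0) (at s)"
      by (rule has_field_derivative_transform_within_open[where S="{..<0}"])
         (use 2 in \<open>auto simp: flat_def\<close>)
    then show ?thesis using 2 by (simp add: flat_def)
  next
    case 3
    have "((\<lambda>h. flat j h / h) \<longlongrightarrow> 0) (at_right 0)"
    proof -
      have "((\<lambda>x::real. x ^ (j + 1) / exp x) \<longlongrightarrow> 0) at_top"
        by (rule tendsto_power_div_exp_0)
      then have "((\<lambda>h. inverse h ^ (j + 1) / exp (inverse h)) \<longlongrightarrow> 0) (at_right (0::real))"
        by (rule filterlim_compose[OF _ filterlim_inverse_at_top_right])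
      then show ?thesis
        by (rule Lim_transform_eventually)
           (auto simp: eventually_at_filter flat_def exp_minus field_simps)
    qed
    moreover have "((\<lambda>h. flat j h / h) \<longlongrightarrow> 0) (at_left 0)"
      by (rule Lim_transform_eventually[OF tendsto_const]) (auto simp: eventually_at_filter flat_def)
    ultimately have "((\<lambda>h. flat j h / h) \<longlongrightarrow> 0) (at 0)"
      by (simp add: filterlim_split_at)
    then show ?thesis using 3 by (simp add: DERIV_def flat_def)
  qed
qed

lemma smooth_on_flat [intro, simp]: "smooth_on U (flat j)"
proof -
  have "smooth_on UNIV (flat j)"
    by (rule smooth_on_family[where a="\<lambda>_. 1" and b="\<lambda>j. - real j" and p="\<lambda>j. j + 2" and q="\<lambda>j. j + 1"])
       (use flat_has_derivative in auto)
  then show ?thesis by (auto intro: smooth_on_subset)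
qed

lemma flat_nonneg: "0 \<le> flat j s"
  by (simp add: flat_def)

lemma flat_pos: "0 < s \<Longrightarrow> 0 < flat j s"
  by (simp add: flat_def)

lemma flat_eq_0: "s \<le> 0 \<Longrightarrow> flat j s = 0"
  by (simp add: flat_def)

lemma flat_0_le_1: "flat 0 s \<le> 1"
  by (simp add: flat_def)

text \<open>Squaring y/2 <= exp(y/2) at y = 1/s gives the bound. As \<open>flat 2\<close> is the
  derivative of \<open>flat 0\<close>, it controls the derivatives of the bumps and of the collar
  cutoff.\<close>

lemma flat_2_le: "flat 2 s \<le> 4"
proof (cases "s > 0")
  case True
  define y where "y = 1 / s"
  have "y > 0" using True by (simp add: y_def)
  have "y / 2 \<le> exp (y / 2)" using exp_ge_add_one_self[of "y/2"] by linarith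
  then have "(y / 2)\<^sup>2 \<le> (exp (y / 2))\<^sup>2" using \<open>y > 0\<close> by (intro power_mono) auto
  also have "(exp (y / 2))\<^sup>2 = exp y" by (simp add: power2_eq_square flip: exp_add)
  finally have "y\<^sup>2 * exp (- y) \<le> 4"
    by (simp add: exp_minus field_simps power2_eq_square)
  then show ?thesis using True by (simp add: flat_def y_def field_simps)
qed (simp add: flat_def)

section \<open>Test functions and bumps\<close>

lemma test_functions_smooth: "\<phi> \<in> test_functions \<Omega> \<Longrightarrow> smooth_on U \<phi>"
  by (auto simp: test_functions_def smooth_iff intro: smooth_on_subset)

lemma partial_eq_0:
  assumes "\<And>x. x \<notin> K \<Longrightarrow> f x = 0" "closed K" "x \<notin> K" "set es \<subseteq> Basis"
  shows "partial es f x = 0"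
proof -
  have "smooth_on (- K) (\<lambda>x. 0 :: 'b)" by simp
  from partial_cong[OF _ this, of f es x] assms
  have "partial es f x = partial es (\<lambda>x. 0) x" by (simp add: open_Compl)
  also have "partial es (\<lambda>x. 0 :: 'b) = (\<lambda>x. 0)"
    by (induction es) auto
  finally show ?thesis .
qed

text \<open>\<open>U\<close> and the complement of \<open>K\<close> are open, cover the space, and
  the function vanishes on the second; hence it is smooth everywhere. Keeping \<open>U\<close>
  separate from \<Omega> suits radial functions, which are smooth on the plane without the
  origin.\<close>

lemma test_functionsI:
  assumes "open U" "smooth_on U f" "compact K" "K \<subseteq> U" "K \<subseteq> \<Omega>" "\<And>x. x \<notin> K \<Longrightarrow> f x = 0"
  shows "f \<in> test_functions \<Omega>"
proof -
  have cl: "closed K" using assms by (simp add: compact_imp_closed)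
  have "smooth_on (- K) f"
    by (rule smooth_on_cong[of _ "\<lambda>x. 0"]) (use assms cl in \<open>auto simp: open_Compl\<close>)
  then have "smooth_on (U \<union> - K) f" using assms smooth_on_Un by blast
  then have "smooth f" using assms(4) by (auto simp: smooth_iff intro: smooth_on_subset)
  moreover have sub: "closure {x. f x \<noteq> 0} \<subseteq> K"
    using cl assms(6) by (intro closure_minimal) auto
  moreover have "compact (closure {x. f x \<noteq> 0})"
    using sub assms(3) by (metis closed_closure compact_Int_closed inf.absorb_iff2)
  ultimately show ?thesis using assms(5) by (auto simp: test_functions_def)
qed

lemma test_functionsE:
  assumes "\<phi> \<in> test_functions \<Omega>"
  obtains K where "compact K" "K \<subseteq> \<Omega>" "\<And>x. x \<notin> K \<Longrightarrow> \<phi> x = 0"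
proof -
  let ?K = "closure {x. \<phi> x \<noteq> 0}"
  have "compact ?K" "?K \<subseteq> \<Omega>" using assms by (auto simp: test_functions_def)
  moreover have "\<phi> x = 0" if "x \<notin> ?K" for x
    using that closure_subset[of "{x. \<phi> x \<noteq> 0}"] by auto
  ultimately show ?thesis by (rule that)
qed

lemma test_functions_mult:
  assumes "\<phi> \<in> test_functions \<Omega>" "smooth_on U c" "open U" "\<Omega> \<subseteq> U"
  shows "(\<lambda>x. \<phi> x * c x) \<in> test_functions \<Omega>"
proof -
  obtain K where "compact K" "K \<subseteq> \<Omega>" "\<And>x. x \<notin> K \<Longrightarrow> \<phi> x = 0"
    using test_functionsE[OF assms(1)] by metis
  then show ?thesis
    using assms(3,4) test_functions_smooth[OF assms(1), of U]
    by (intro test_functionsI[of U _ K] smooth_on_mult assms(2,3)) auto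
qed

definition bump :: "'a::euclidean_space \<Rightarrow> real \<Rightarrow> 'a \<Rightarrow> real" where
  "bump c r x = flat 0 (r\<^sup>2 - (norm (x - c))\<^sup>2)"

lemma smooth_bump: "smooth_on U (bump c r)"
proof -
  have eq: "(norm (x - c))\<^sup>2 = (norm x)\<^sup>2 - 2 * (x \<bullet> c) + (norm c)\<^sup>2" for x
    by (simp add: power2_norm_eq_inner inner_diff inner_commute)
  have "smooth_on UNIV (\<lambda>x. r\<^sup>2 - ((norm x)\<^sup>2 - 2 * (x \<bullet> c) + (norm c)\<^sup>2))"
    by (intro smooth_on_diff smooth_on_add smooth_on_mult smooth_on_norm_sq smooth_on_inner
        smooth_on_const' open_UNIV)
  from smooth_on_compose[OF open_UNIV smooth_on_flat[of UNIV 0] this]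
  have "smooth_on UNIV (bump c r)"
    unfolding bump_def[abs_def] eq by simp
  then show ?thesis by (rule smooth_on_subset) auto
qed

lemma bump_eq_0: "r \<ge> 0 \<Longrightarrow> x \<notin> cball c r \<Longrightarrow> bump c r x = 0"
  by (auto simp: bump_def dist_norm norm_minus_commute intro!: flat_eq_0 power_mono)

lemma bump_test: "0 \<le> r \<Longrightarrow> cball c r \<subseteq> \<Omega> \<Longrightarrow> bump c r \<in> test_functions \<Omega>"
  using bump_eq_0 by (intro test_functionsI[of UNIV _ "cball c r"] smooth_bump) auto

section \<open>Mollification\<close>

text \<open>Fubini's theorem is applied to the product of two completed measures, so
  sigma-finiteness is established for the completion itself.\<close>

interpretation lebesgue: sigma_finite_measure "lebesgue :: 'a::euclidean_space measure"
proof
  show "\<exists>A::'a set set. countable A \<and> A \<subseteq> sets lebesgue \<and> \<Union>A = space lebesgue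
          \<and> (\<forall>a\<in>A. emeasure lebesgue a \<noteq> \<infinity>)"
    by (intro exI[of _ "range (\<lambda>n::nat. box (- real n *\<^sub>R One) (real n *\<^sub>R One))"])
       (auto simp: emeasure_lborel_cbox_eq UN_box_eq_UNIV)
qed

interpretation lebesgue_pair:
  pair_sigma_finite "lebesgue :: 'a::euclidean_space measure" "lebesgue :: 'a measure" ..

text \<open>The two projections are measurable from the product of the completed sigma-algebras to
  the Borel sets, and so is their difference. This is why kernels are taken Borel rather than
  Lebesgue measurable.\<close>

lemma borel_measurable_lebesgue_pair_diff:
  assumes "\<rho> \<in> borel_measurable borel"
  shows "(\<lambda>(x, y). \<rho> (x - y)) \<in> borel_measurable (lebesgue \<Otimes>\<^sub>M (lebesgue :: 'a::euclidean_space measure))"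
proof -
  have id: "(\<lambda>x::'a. x) \<in> lebesgue \<rightarrow>\<^sub>M borel" by (simp add: measurable_completion)
  have [measurable]: "fst \<in> (lebesgue \<Otimes>\<^sub>M (lebesgue :: 'a measure)) \<rightarrow>\<^sub>M (borel :: 'a measure)"
    "snd \<in> ((lebesgue :: 'a measure) \<Otimes>\<^sub>M lebesgue) \<rightarrow>\<^sub>M (borel :: 'a measure)"
    by (rule measurable_compose[OF measurable_fst id], rule measurable_compose[OF measurable_snd id])
  note assms[measurable]
  show ?thesis unfolding case_prod_beta' by measurable
qed

lemma kernel_integrable:
  fixes F G \<rho> :: "'a::euclidean_space \<Rightarrow> real"
  assumes F: "integrable lebesgue F" and G: "integrable lebesgue G"
    and \<rho>: "\<rho> \<in> borel_measurable borel" "\<And>z. \<bar>\<rho> z\<bar> \<le> B"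
  shows "integrable (lebesgue \<Otimes>\<^sub>M lebesgue) (\<lambda>(x, y). \<rho> (x - y) * (F x * G y))"
proof -
  note [measurable] = borel_measurable_integrable[OF F] borel_measurable_integrable[OF G]
    borel_measurable_lebesgue_pair_diff[OF \<rho>(1)]
  have int: "integrable (lebesgue \<Otimes>\<^sub>M lebesgue) (\<lambda>(x, y). F x * G y)"
  proof (rule lebesgue_pair.Fubini_integrable)
    show "integrable lebesgue (\<lambda>x. \<integral>y. norm (case (x, y) of (x, y) \<Rightarrow> F x * G y) \<partial>lebesgue)"
      using F by (simp add: abs_mult)
    show "AE x in lebesgue. integrable lebesgue (\<lambda>y. case (x, y) of (x, y) \<Rightarrow> F x * G y)"
      using G by simp
  qed measurable
  show ?thesis
  proof (rule Bochner_Integration.integrable_bound[OF integrable_mult_right[OF int, of B]])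
    have "(\<lambda>p. (case p of (x, y) \<Rightarrow> \<rho> (x - y)) * (F (fst p) * G (snd p)))
        \<in> borel_measurable (lebesgue \<Otimes>\<^sub>M lebesgue)" by measurable
    then show "(\<lambda>(x, y). \<rho> (x - y) * (F x * G y)) \<in> borel_measurable (lebesgue \<Otimes>\<^sub>M lebesgue)"
      by (simp add: case_prod_beta')
    have "\<bar>\<rho> z\<bar> \<le> \<bar>B\<bar>" for z using \<rho>(2)[of z] by linarith
    then show "AE p in lebesgue \<Otimes>\<^sub>M lebesgue. norm (case p of (x, y) \<Rightarrow> \<rho> (x - y) * (F x * G y))
        \<le> norm (B * (case p of (x, y) \<Rightarrow> F x * G y))"
      by (intro AE_I2) (simp add: case_prod_beta' abs_mult mult_right_mono)
  qed
qed

text \<open>The pairing of \<open>F\<close> with the convolution of \<rho> and \<open>G\<close>,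
  kept as a double integral. In this form either variable can be integrated first, and no
  convolution ever has to be differentiated.\<close>

definition kint :: "('a::euclidean_space \<Rightarrow> real) \<Rightarrow> ('a \<Rightarrow> real) \<Rightarrow> ('a \<Rightarrow> real) \<Rightarrow> real" where
  "kint \<rho> F G = (\<integral>p. (case p of (x, y) \<Rightarrow> \<rho> (x - y) * (F x * G y)) \<partial>(lebesgue \<Otimes>\<^sub>M lebesgue))"

lemma
  fixes F G \<rho> :: "'a::euclidean_space \<Rightarrow> real"
  assumes "integrable lebesgue F" "integrable lebesgue G"
    and "\<rho> \<in> borel_measurable borel" "\<And>z. \<bar>\<rho> z\<bar> \<le> B"
  shows kint_fst: "kint \<rho> F G = (\<integral>x. F x * (\<integral>y. \<rho> (x - y) * G y \<partial>lebesgue) \<partial>lebesgue)"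
    and kint_snd: "kint \<rho> F G = (\<integral>y. G y * (\<integral>x. \<rho> (x - y) * F x \<partial>lebesgue) \<partial>lebesgue)"
    and kernel_integrable_fst:
      "integrable lebesgue (\<lambda>x. F x * (\<integral>y. \<rho> (x - y) * G y \<partial>lebesgue))"
    and kernel_integrable_snd:
      "integrable lebesgue (\<lambda>y. G y * (\<integral>x. \<rho> (x - y) * F x \<partial>lebesgue))"
proof -
  note int = kernel_integrable[OF assms]
  have "\<rho> (x - y) * (F x * G y) = F x * (\<rho> (x - y) * G y)"
    "\<rho> (x - y) * (F x * G y) = G y * (\<rho> (x - y) * F x)" for x y by simp_all
  note eq = this
  have 1: "(\<lambda>x. \<integral>y. \<rho> (x - y) * (F x * G y) \<partial>lebesgue)
      = (\<lambda>x. F x * (\<integral>y. \<rho> (x - y) * G y \<partial>lebesgue))"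
    unfolding eq(1) by simp
  have 2: "(\<lambda>y. \<integral>x. \<rho> (x - y) * (F x * G y) \<partial>lebesgue)
      = (\<lambda>y. G y * (\<integral>x. \<rho> (x - y) * F x \<partial>lebesgue))"
    unfolding eq(2) by simp
  show "kint \<rho> F G = (\<integral>x. F x * (\<integral>y. \<rho> (x - y) * G y \<partial>lebesgue) \<partial>lebesgue)"
    unfolding kint_def using lebesgue_pair.integral_fst[OF int] 1 by simp
  show "kint \<rho> F G = (\<integral>y. G y * (\<integral>x. \<rho> (x - y) * F x \<partial>lebesgue) \<partial>lebesgue)"
    unfolding kint_def using lebesgue_pair.integral_snd[OF int] 2 by simp
  show "integrable lebesgue (\<lambda>x. F x * (\<integral>y. \<rho> (x - y) * G y \<partial>lebesgue))"
    using lebesgue_pair.integrable_fst[OF int] 1 by simp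
  show "integrable lebesgue (\<lambda>y. G y * (\<integral>x. \<rho> (x - y) * F x \<partial>lebesgue))"
    using lebesgue_pair.integrable_snd[OF int] 2 by simp
qed

section \<open>Normalised bumps as mollifiers\<close>

lemma continuous_bump: "continuous_on U (bump c r)"
  by (rule smooth_on_imp_continuous_on[OF smooth_bump])

lemma bump_nonneg: "0 \<le> bump c r x" and bump_le_1: "bump c r x \<le> 1"
  by (simp_all add: bump_def flat_nonneg flat_0_le_1)

lemma bump_measurable: "bump c r \<in> borel_measurable borel"
  by (simp add: borel_measurable_continuous_onI continuous_bump)

lemma bump_shift: "bump c r x = bump 0 r (x - c)" and bump_sym: "bump c r x = bump x r c"
  by (simp_all add: bump_def norm_minus_commute)

lemma integrable_bump:
  assumes "r \<ge> 0"
  shows "integrable lebesgue (bump c r)"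
proof (rule Bochner_Integration.integrable_bound)
  show "integrable lebesgue (indicator (cball c r) :: 'a \<Rightarrow> real)"
    using lmeasurable_cball[of c r] by (simp add: fmeasurable_def)
  show "bump c r \<in> borel_measurable lebesgue"
    by (simp add: bump_measurable measurable_completion)
  show "AE x in lebesgue. norm (bump c r x) \<le> norm (indicator (cball c r) x :: real)"
    using bump_nonneg[of c r] bump_le_1[of c r] bump_eq_0[OF assms, of _ c]
    by (auto simp: indicator_def)
qed

lemma integral_bump_shift:
  fixes c :: "'a::euclidean_space"
  assumes "r \<ge> 0"
  shows "integral\<^sup>L lebesgue (bump c r) = integral\<^sup>L lebesgue (bump 0 r :: 'a \<Rightarrow> real)"
proof -
  have "integral\<^sup>L lebesgue (bump c r) = integral\<^sup>L lborel (bump c r)"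
    by (simp add: integral_completion bump_measurable)
  also have "\<dots> = integral\<^sup>L (distr lborel borel ((+) c)) (bump c r)"
    by (simp add: lborel_distr_plus)
  also have "\<dots> = integral\<^sup>L lborel (\<lambda>x. bump c r (c + x))"
    by (rule integral_distr) (auto simp: bump_measurable)
  also have "(\<lambda>x. bump c r (c + x)) = bump 0 r"
    by (simp add: fun_eq_iff bump_shift[of c])
  also have "integral\<^sup>L lborel (bump 0 r :: 'a \<Rightarrow> real) = integral\<^sup>L lebesgue (bump 0 r :: 'a \<Rightarrow> real)"
    by (simp add: integral_completion bump_measurable)
  finally show ?thesis .
qed

lemma integral_bump_pos:
  assumes "r > 0"
  shows "0 < integral\<^sup>L lebesgue (bump c r)"
proof (rule ccontr)
  assume "\<not> ?thesis"
  moreover have "0 \<le> integral\<^sup>L lebesgue (bump c r)" by (simp add: bump_nonneg)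
  ultimately have "integral\<^sup>L lebesgue (bump c r) = 0" by linarith
  then have "AE x in lebesgue. bump c r x = 0"
    using assms integral_nonneg_eq_0_iff_AE[OF integrable_bump[of r c]] by (simp add: bump_nonneg)
  moreover have "bump c r x \<noteq> 0" if "x \<in> ball c r" for x
  proof -
    have "(norm (x - c))\<^sup>2 < r\<^sup>2"
      using that by (intro power_strict_mono) (auto simp: dist_norm norm_minus_commute)
    then show ?thesis unfolding bump_def using flat_pos[of "r\<^sup>2 - (norm (x - c))\<^sup>2" 0] by simp
  qed
  ultimately have "AE x in lebesgue. x \<notin> ball c r" by (auto elim: eventually_mono)
  then have "ball c r \<in> null_sets lebesgue" by (subst AE_iff_null_sets) auto
  then have "negligible (ball c r)" by (simp add: negligible_iff_null_sets)
  then show False using assms open_not_negligible[of "ball c r"] by simp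
qed

definition mollifier :: "nat \<Rightarrow> 'a::euclidean_space \<Rightarrow> real" where
  "mollifier n z = bump 0 (1 / real (Suc n)) z / integral\<^sup>L lebesgue (bump 0 (1 / real (Suc n)) :: 'a \<Rightarrow> real)"

lemma mollifier_nonneg: "0 \<le> mollifier n z"
  by (simp add: mollifier_def bump_nonneg)

lemma mollifier_diff:
  fixes x y :: "'a::euclidean_space"
  shows "mollifier n (x - y) = bump y (1 / real (Suc n)) x / integral\<^sup>L lebesgue (bump 0 (1 / real (Suc n)) :: 'a \<Rightarrow> real)"
  by (simp add: mollifier_def flip: bump_shift)

lemma mollifier_commute: "mollifier n (x - y) = mollifier n (y - x)"
  by (simp add: mollifier_diff bump_sym)

lemma mollifier_eq_0: "dist x y > 1 / real (Suc n) \<Longrightarrow> mollifier n (x - y) = 0"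
  using bump_eq_0[of "1 / real (Suc n)" x y] by (simp add: mollifier_diff dist_commute)

lemma mollifier_measurable: "mollifier n \<in> borel_measurable borel"
  unfolding mollifier_def[abs_def] using bump_measurable by measurable

lemma mollifier_bounded:
  fixes z :: "'a::euclidean_space"
  shows "\<bar>mollifier n z\<bar> \<le> 1 / integral\<^sup>L lebesgue (bump 0 (1 / real (Suc n)) :: 'a \<Rightarrow> real)"
  by (simp add: mollifier_def abs_mult bump_nonneg bump_le_1 divide_right_mono)

lemma integrable_mollifier: "integrable lebesgue (\<lambda>y. mollifier n (x - y))"
  using integrable_bump[of "1 / real (Suc n)" x]
  unfolding mollifier_diff bump_sym[of _ _ x] by simp

lemma integral_mollifier: "(\<integral>y. mollifier n (x - y) \<partial>lebesgue) = 1"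
  using integral_bump_pos[of "1 / real (Suc n)" "0 :: 'a"] integral_bump_shift[of "1 / real (Suc n)" x]
  unfolding mollifier_diff bump_sym[of _ _ x] by simp

lemma integral_mollifier_indicator_le:
  assumes [measurable]: "A \<in> sets lebesgue"
  shows "(\<integral>y. mollifier n (x - y) * indicator A y \<partial>lebesgue) \<le> 1"
proof -
  have "(\<integral>y. mollifier n (x - y) * indicator A y \<partial>lebesgue) \<le> (\<integral>y. mollifier n (x - y) \<partial>lebesgue)"
    by (intro integral_mono integrable_mollifier integrable_real_mult_indicator assms)
       (auto simp: indicator_def mollifier_nonneg)
  then show ?thesis by (simp add: integral_mollifier)
qed

lemma inverse_Suc_less: "1 / real (Suc N) < d \<Longrightarrow> N \<le> n \<Longrightarrow> 1 / real (Suc n) < d"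
  by (rule le_less_trans[OF divide_left_mono]) auto

lemma mollifier_tendsto:
  fixes g :: "'a::euclidean_space \<Rightarrow> real"
  assumes g: "g \<in> borel_measurable lebesgue" "\<And>y. \<bar>g y\<bar> \<le> B" "isCont g x"
  shows "(\<lambda>n. \<integral>y. mollifier n (x - y) * g y \<partial>lebesgue) \<longlonglongrightarrow> g x"
proof (rule LIMSEQ_I)
  fix e :: real assume "e > 0"
  then obtain d where "d > 0" and d: "\<And>y. dist y x < d \<Longrightarrow> dist (g y) (g x) < e / 2"
    using assms(3) unfolding continuous_at_eps_delta by (metis half_gt_zero)
  obtain N where N: "1 / real (Suc N) < d"
    using \<open>d > 0\<close> nat_approx_posE by blast
  have int: "integrable lebesgue (\<lambda>y. mollifier n (x - y) * g y)" for n
  proof (rule Bochner_Integration.integrable_bound[OF integrable_mult_right[OF integrable_mollifier[of n x], of B]])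
    show "(\<lambda>y. mollifier n (x - y) * g y) \<in> borel_measurable lebesgue"
      using borel_measurable_integrable[OF integrable_mollifier[of n x]] g(1) by measurable
    have "\<bar>g y\<bar> \<le> \<bar>B\<bar>" for y using g(2)[of y] by linarith
    then show "AE y in lebesgue. norm (mollifier n (x - y) * g y) \<le> norm (B * mollifier n (x - y))"
      by (auto simp: abs_mult mult.commute intro!: mult_right_mono)
  qed
  have "norm ((\<integral>y. mollifier n (x - y) * g y \<partial>lebesgue) - g x) < e" if "n \<ge> N" for n
  proof -
    have n: "1 / real (Suc n) < d"
      using inverse_Suc_less[OF N that] .
    have "(\<integral>y. mollifier n (x - y) * g y \<partial>lebesgue) - g x
        = (\<integral>y. mollifier n (x - y) * g y \<partial>lebesgue) - (\<integral>y. mollifier n (x - y) * g x \<partial>lebesgue)"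
      by (simp add: integral_mollifier)
    also have "\<dots> = (\<integral>y. mollifier n (x - y) * g y - mollifier n (x - y) * g x \<partial>lebesgue)"
      by (intro Bochner_Integration.integral_diff[symmetric] int integrable_mult_left integrable_mollifier)
    finally have eq: "(\<integral>y. mollifier n (x - y) * g y \<partial>lebesgue) - g x
        = (\<integral>y. mollifier n (x - y) * g y - mollifier n (x - y) * g x \<partial>lebesgue)" .
    have "norm (\<integral>y. mollifier n (x - y) * g y - mollifier n (x - y) * g x \<partial>lebesgue)
        \<le> (\<integral>y. mollifier n (x - y) * (e / 2) \<partial>lebesgue)"
    proof (rule Bochner_Integration.integral_norm_bound_integral)
      show "integrable lebesgue (\<lambda>y. mollifier n (x - y) * g y - mollifier n (x - y) * g x)"
        by (intro Bochner_Integration.integrable_diff int integrable_mult_left integrable_mollifier)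
      show "integrable lebesgue (\<lambda>y. mollifier n (x - y) * (e / 2))"
        by (intro integrable_mult_left integrable_mollifier)
      fix y
      show "norm (mollifier n (x - y) * g y - mollifier n (x - y) * g x) \<le> mollifier n (x - y) * (e / 2)"
      proof (cases "dist y x < d")
        case True
        then have "\<bar>g y - g x\<bar> \<le> e / 2" using d[of y] by (simp add: dist_real_def)
        from mult_left_mono[OF this mollifier_nonneg[of n "x - y"]] show ?thesis
          by (simp add: abs_mult mollifier_nonneg flip: right_diff_distrib)
      next
        case False
        then have "mollifier n (x - y) = 0" using n by (intro mollifier_eq_0) (simp add: dist_commute)
        then show ?thesis by simp
      qed
    qed
    then show ?thesis using \<open>e > 0\<close> eq by (simp add: integral_mollifier)
  qed
  then show "\<exists>N. \<forall>n\<ge>N. norm ((\<integral>y. mollifier n (x - y) * g y \<partial>lebesgue) - g x) < e" by blast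
qed

section \<open>Convergence of mollified pairings\<close>

definition nice_on :: "'a::euclidean_space set \<Rightarrow> ('a \<Rightarrow> real) \<Rightarrow> bool" where
  "nice_on D g \<longleftrightarrow> g \<in> borel_measurable lebesgue \<and> (\<exists>B. \<forall>x. \<bar>g x\<bar> \<le> B)
     \<and> (\<forall>x\<in>interior D. isCont g x) \<and> (\<forall>x. x \<notin> D \<longrightarrow> g x = 0)"

lemma integrable_indicator_compact: "compact D \<Longrightarrow> integrable lebesgue (indicator D :: 'a::euclidean_space \<Rightarrow> real)"
  using lmeasurable_compact[of D] by (intro integrable_real_indicator) (auto simp: fmeasurable_def)

lemma integrable_bounded_support:
  fixes g :: "'a::euclidean_space \<Rightarrow> real"
  assumes "compact D" "g \<in> borel_measurable lebesgue" "\<And>x. \<bar>g x\<bar> \<le> B" "\<And>x. x \<notin> D \<Longrightarrow> g x = 0"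
  shows "integrable lebesgue g"
proof (rule Bochner_Integration.integrable_bound[OF integrable_mult_right[OF integrable_indicator_compact[OF assms(1)], of B]])
  show "AE x in lebesgue. norm (g x) \<le> norm (B * indicator D x)"
  proof (intro AE_I2)
    fix x show "norm (g x) \<le> norm (B * indicator D x)"
      using assms(3)[of x] assms(4)[of x] by (cases "x \<in> D") auto
  qed
qed fact

lemma abs_add_power_le:
  fixes x y :: real
  assumes "p \<ge> 1"
  shows "\<bar>x + y\<bar> ^ p \<le> 2 ^ p * (\<bar>x\<bar> ^ p + \<bar>y\<bar> ^ p)"
proof -
  have "\<bar>x + y\<bar> ^ p \<le> (2 * max \<bar>x\<bar> \<bar>y\<bar>) ^ p" by (intro power_mono) auto
  also have "\<dots> = 2 ^ p * (max \<bar>x\<bar> \<bar>y\<bar>) ^ p" by (simp add: power_mult_distrib)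
  also have "(max \<bar>x\<bar> \<bar>y\<bar>) ^ p \<le> \<bar>x\<bar> ^ p + \<bar>y\<bar> ^ p" by (simp add: max_def)
  finally show ?thesis by simp
qed

lemma clamp_dist_le: "M \<ge> 0 \<Longrightarrow> \<bar>t - max (- M) (min M t)\<bar> \<le> \<bar>t\<bar>" for t :: real
  by (auto simp: max_def min_def)

text \<open>Truncate \<open>G\<close> at a height \<open>M\<close>, approximate it almost everywhere
  by continuous functions, truncate these as well and restrict them to \<open>D\<close>; dominated
  convergence controls both errors. The restriction may jump on the boundary of \<open>D\<close>,
  which is why \<open>nice_on\<close> asks for continuity in the interior only. The exponent covers
  the L1 and the L2 version at once.\<close>

lemma Lp_approx_nice:
  fixes G :: "'a::euclidean_space \<Rightarrow> real"
  assumes "compact D" and G: "G \<in> borel_measurable lebesgue" and p: "p \<ge> 1"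
    and Gp: "integrable lebesgue (\<lambda>x. \<bar>G x\<bar> ^ p)"
    and G0: "\<And>x. x \<notin> D \<Longrightarrow> G x = 0" and "e > 0"
  obtains g where "nice_on D g" "integrable lebesgue (\<lambda>x. \<bar>G x - g x\<bar> ^ p)"
    "(\<integral>x. \<bar>G x - g x\<bar> ^ p \<partial>lebesgue) < e"
proof -
  note [measurable] = G
  have D [measurable]: "D \<in> sets lebesgue"
    using lmeasurable_compact[OF \<open>compact D\<close>] by (simp add: fmeasurableD)
  define cl where "cl M t = max (- M) (min M t)" for M t :: real
  have cl_meas [measurable]: "cl M \<in> borel_measurable borel" for M
    unfolding cl_def[abs_def] by measurable
  have "(\<lambda>n. \<integral>x. \<bar>G x - cl (real n) (G x)\<bar> ^ p \<partial>lebesgue) \<longlonglongrightarrow> integral\<^sup>L (lebesgue :: 'a measure) (\<lambda>x. 0::real)"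
  proof (rule integral_dominated_convergence[where w="\<lambda>x. \<bar>G x\<bar> ^ p"])
    show "AE x in lebesgue. (\<lambda>n. \<bar>G x - cl (real n) (G x)\<bar> ^ p) \<longlonglongrightarrow> 0"
    proof (intro AE_I2)
      fix x
      obtain N :: nat where "\<bar>G x\<bar> \<le> real N" using real_arch_simple by blast
      then have "\<bar>G x - cl (real n) (G x)\<bar> ^ p = 0" if "n \<ge> N" for n
        using that p by (auto simp: cl_def max_def min_def)
      then show "(\<lambda>n. \<bar>G x - cl (real n) (G x)\<bar> ^ p) \<longlonglongrightarrow> 0"
        by (intro tendsto_eventually) (auto simp: eventually_sequentially)
    qed
    show "AE x in lebesgue. norm (\<bar>G x - cl (real n) (G x)\<bar> ^ p) \<le> \<bar>G x\<bar> ^ p" for n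
      by (intro AE_I2) (simp add: cl_def clamp_dist_le power_mono)
    show "integrable lebesgue (\<lambda>x. \<bar>G x\<bar> ^ p)" by (rule Gp)
    show "(\<lambda>x. \<bar>G x - cl (real n) (G x)\<bar> ^ p) \<in> borel_measurable lebesgue" for n by measurable
  qed simp
  \<comment> \<open>Chosen so that the two errors, weighted by the factor 2^p from
    \<open>abs_add_power_le\<close>, add up to \<open>e\<close>.\<close>
  moreover define e' where "e' = e / 2 ^ p / 2"
  have "e' > 0" using \<open>e > 0\<close> by (simp add: e'_def)
  ultimately have "\<forall>\<^sub>F n in sequentially. (\<integral>x. \<bar>G x - cl (real n) (G x)\<bar> ^ p \<partial>lebesgue) < e'"
    by (simp add: order_tendstoD)
  then obtain M :: nat where M: "(\<integral>x. \<bar>G x - cl (real M) (G x)\<bar> ^ p \<partial>lebesgue) < e'"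
    by (auto simp: eventually_sequentially)
  \<comment> \<open>Lebesgue measurability in the form of a sequence of continuous functions
    converging off a negligible set.\<close>
  have "G measurable_on UNIV"
    using lebesgue_measurable_imp_measurable_on[OF G, of UNIV] by simp
  then obtain N and g where N: "negligible N" and gc: "\<And>n. continuous_on UNIV (g n)"
    and glim: "\<And>x. x \<notin> N \<Longrightarrow> (\<lambda>n. g n x) \<longlonglongrightarrow> G x"
    unfolding measurable_on_def by auto
  define h where "h n x = indicator D x * cl (real M) (g n x)" for n :: nat and x
  have g_meas [measurable]: "g n \<in> borel_measurable lebesgue" for n
    using borel_measurable_continuous_onI[OF gc[of n]] by (simp add: measurable_completion)
  have h_meas [measurable]: "h n \<in> borel_measurable lebesgue" for n
    unfolding h_def by measurable
  have cl_cont: "continuous_on UNIV (cl (real M))" unfolding cl_def[abs_def] by (intro continuous_intros)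
  have clb: "\<bar>cl (real M) t\<bar> \<le> real M" for t by (auto simp: cl_def)
  have dom: "norm (\<bar>cl (real M) (G x) - h n x\<bar> ^ p) \<le> (2 * real M) ^ p * indicator D x" for n x
  proof (cases "x \<in> D")
    case True
    have "\<bar>cl (real M) (G x) - h n x\<bar> \<le> 2 * real M"
      using clb[of "G x"] clb[of "g n x"] True unfolding h_def by simp
    from power_mono[OF this, of p] show ?thesis using True by simp
  next
    case False
    then show ?thesis using p G0[of x] by (simp add: h_def cl_def zero_power)
  qed
  have dom_int: "integrable lebesgue (\<lambda>x. (2 * real M) ^ p * indicator D x)"
    by (intro integrable_mult_right integrable_indicator_compact assms)
  have "(\<lambda>n. \<integral>x. \<bar>cl (real M) (G x) - h n x\<bar> ^ p \<partial>lebesgue) \<longlonglongrightarrow> integral\<^sup>L (lebesgue :: 'a measure) (\<lambda>x. 0::real)"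
  proof (rule integral_dominated_convergence[where w="\<lambda>x. (2 * real M) ^ p * indicator D x"])
    have "AE x in lebesgue. x \<notin> N"
      using N by (simp add: negligible_iff_null_sets AE_not_in)
    then show "AE x in lebesgue. (\<lambda>n. \<bar>cl (real M) (G x) - h n x\<bar> ^ p) \<longlonglongrightarrow> 0"
    proof (rule eventually_mono)
      fix x assume "x \<notin> N"
      from glim[OF this] have "(\<lambda>n. cl (real M) (g n x)) \<longlonglongrightarrow> cl (real M) (G x)"
        by (intro continuous_on_tendsto_compose[OF cl_cont]) auto
      then have "(\<lambda>n. h n x) \<longlonglongrightarrow> indicator D x * cl (real M) (G x)"
        unfolding h_def by (intro tendsto_mult tendsto_const)
      also have "indicator D x * cl (real M) (G x) = cl (real M) (G x)"
        using G0[of x] by (cases "x \<in> D") (auto simp: cl_def)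
      finally have "(\<lambda>n. \<bar>cl (real M) (G x) - h n x\<bar>) \<longlonglongrightarrow> \<bar>cl (real M) (G x) - cl (real M) (G x)\<bar>"
        by (intro tendsto_intros)
      then show "(\<lambda>n. \<bar>cl (real M) (G x) - h n x\<bar> ^ p) \<longlonglongrightarrow> 0"
        using p by (intro tendsto_null_power) auto
    qed
    show "AE x in lebesgue. norm (\<bar>cl (real M) (G x) - h n x\<bar> ^ p) \<le> (2 * real M) ^ p * indicator D x" for n
      using dom by (intro AE_I2)
    show "(\<lambda>x. \<bar>cl (real M) (G x) - h n x\<bar> ^ p) \<in> borel_measurable lebesgue" for n by measurable
  qed (simp_all add: integrable_indicator_compact[OF assms(1)])
  then have "\<forall>\<^sub>F n in sequentially. (\<integral>x. \<bar>cl (real M) (G x) - h n x\<bar> ^ p \<partial>lebesgue) < e'"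
    using \<open>e' > 0\<close> by (simp add: order_tendstoD)
  then obtain n :: nat where n: "(\<integral>x. \<bar>cl (real M) (G x) - h n x\<bar> ^ p \<partial>lebesgue) < e'"
    by (auto simp: eventually_sequentially)
  have i1: "integrable lebesgue (\<lambda>x. \<bar>G x - cl (real M) (G x)\<bar> ^ p)"
    by (rule Bochner_Integration.integrable_bound[OF Gp])
       (auto simp: cl_def clamp_dist_le power_mono)
  have i2: "integrable lebesgue (\<lambda>x. \<bar>cl (real M) (G x) - h n x\<bar> ^ p)"
    by (rule Bochner_Integration.integrable_bound[OF dom_int])
       (use dom in \<open>auto intro!: AE_I2 intro: order_trans[OF _ abs_ge_self]\<close>)
  have le: "\<bar>G x - h n x\<bar> ^ p \<le> 2 ^ p * (\<bar>G x - cl (real M) (G x)\<bar> ^ p + \<bar>cl (real M) (G x) - h n x\<bar> ^ p)" for x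
    using abs_add_power_le[OF p, of "G x - cl (real M) (G x)" "cl (real M) (G x) - h n x"] by simp
  have i3: "integrable lebesgue (\<lambda>x. 2 ^ p * (\<bar>G x - cl (real M) (G x)\<bar> ^ p + \<bar>cl (real M) (G x) - h n x\<bar> ^ p))"
    by (intro integrable_mult_right Bochner_Integration.integrable_add i1 i2)
  have i4: "integrable lebesgue (\<lambda>x. \<bar>G x - h n x\<bar> ^ p)"
    by (rule Bochner_Integration.integrable_bound[OF i3])
       (use le in \<open>auto intro!: AE_I2 order_trans[OF _ abs_ge_self]\<close>)
  have "(\<integral>x. \<bar>G x - h n x\<bar> ^ p \<partial>lebesgue)
      \<le> (\<integral>x. 2 ^ p * (\<bar>G x - cl (real M) (G x)\<bar> ^ p + \<bar>cl (real M) (G x) - h n x\<bar> ^ p) \<partial>lebesgue)"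
    by (intro integral_mono i3 i4 le)
  also have "\<dots> < 2 ^ p * (e' + e')"
    using M n i1 i2 by simp
  also have "\<dots> = e" by (simp add: e'_def)
  finally have "(\<integral>x. \<bar>G x - h n x\<bar> ^ p \<partial>lebesgue) < e" .
  moreover have "nice_on D (h n)"
    unfolding nice_on_def
  proof (intro conjI ballI allI impI h_meas)
    show "\<exists>B. \<forall>x. \<bar>h n x\<bar> \<le> B"
      using clb by (intro exI[of _ "real M"]) (auto simp: h_def indicator_def)
    show "h n x = 0" if "x \<notin> D" for x using that by (simp add: h_def)
    fix x assume x: "x \<in> interior D"
    have "isCont (\<lambda>x. cl (real M) (g n x)) x"
      using gc[of n] unfolding cl_def
      by (intro continuous_intros) (auto simp: continuous_on_eq_continuous_at)
    moreover have "\<forall>\<^sub>F y in nhds x. cl (real M) (g n y) = h n y"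
      unfolding eventually_nhds using x interior_subset[of D]
      by (intro exI[of _ "interior D"]) (auto simp: h_def)
    ultimately show "isCont (h n) x" using isCont_cong[of "\<lambda>x. cl (real M) (g n x)" "h n" x] by simp
  qed
  ultimately show ?thesis using that i4 by blast
qed

lemma kint_diff_right:
  assumes F: "integrable lebesgue F" and "integrable lebesgue G" "integrable lebesgue H"
    and \<rho>: "\<rho> \<in> borel_measurable borel" "\<And>z. \<bar>\<rho> z\<bar> \<le> B"
  shows "kint \<rho> F (\<lambda>x. G x - H x) = kint \<rho> F G - kint \<rho> F H"
proof -
  have "kint \<rho> F (\<lambda>x. G x - H x)
      = (\<integral>p. (case p of (x, y) \<Rightarrow> \<rho> (x - y) * (F x * G y)) - (case p of (x, y) \<Rightarrow> \<rho> (x - y) * (F x * H y)) \<partial>(lebesgue \<Otimes>\<^sub>M lebesgue))"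
    unfolding kint_def by (intro Bochner_Integration.integral_cong) (auto simp: algebra_simps)
  also have "\<dots> = kint \<rho> F G - kint \<rho> F H"
    unfolding kint_def by (intro Bochner_Integration.integral_diff kernel_integrable[OF F _ \<rho>] assms)
  finally show ?thesis .
qed

text \<open>\<open>F\<close> vanishes off the interior of \<open>D\<close>, so pointwise convergence
  of the mollified \<open>g\<close> is needed only where \<open>g\<close> is continuous; the
  multiple \<open>B * \<bar>F x\<bar>\<close> dominates.\<close>

lemma kint_mollifier_nice:
  assumes "compact D" "nice_on D g" "integrable lebesgue F" "\<And>x. x \<notin> interior D \<Longrightarrow> F x = 0"
  shows "(\<lambda>n. kint (mollifier n) F g) \<longlonglongrightarrow> (\<integral>x. F x * g x \<partial>lebesgue)"
proof -
  from assms(2) obtain B where B: "\<And>x. \<bar>g x\<bar> \<le> B" and g: "g \<in> borel_measurable lebesgue"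
    "\<And>x. x \<in> interior D \<Longrightarrow> isCont g x" "\<And>x. x \<notin> D \<Longrightarrow> g x = 0"
    by (auto simp: nice_on_def)
  have gi: "integrable lebesgue g"
    by (rule integrable_bounded_support[OF assms(1) g(1) B g(3)])
  note rho = mollifier_measurable mollifier_bounded
  have "(\<lambda>n. \<integral>x. F x * (\<integral>y. mollifier n (x - y) * g y \<partial>lebesgue) \<partial>lebesgue)
      \<longlonglongrightarrow> (\<integral>x. F x * g x \<partial>lebesgue)"
  proof (rule integral_dominated_convergence[where w="\<lambda>x. B * \<bar>F x\<bar>"])
    show "(\<lambda>x. F x * g x) \<in> borel_measurable lebesgue"
      using g(1) borel_measurable_integrable[OF assms(3)] by measurable
    show "(\<lambda>x. F x * (\<integral>y. mollifier n (x - y) * g y \<partial>lebesgue)) \<in> borel_measurable lebesgue" for n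
      using kernel_integrable_fst[OF assms(3) gi rho] by (rule borel_measurable_integrable)
    show "integrable lebesgue (\<lambda>x. B * \<bar>F x\<bar>)"
      using assms(3) by (intro integrable_mult_right integrable_abs)
    show "AE x in lebesgue. (\<lambda>n. F x * (\<integral>y. mollifier n (x - y) * g y \<partial>lebesgue)) \<longlonglongrightarrow> F x * g x"
    proof (intro AE_I2)
      fix x show "(\<lambda>n. F x * (\<integral>y. mollifier n (x - y) * g y \<partial>lebesgue)) \<longlonglongrightarrow> F x * g x"
      proof (cases "x \<in> interior D")
        case True
        then show ?thesis by (intro tendsto_mult tendsto_const mollifier_tendsto[OF g(1) B] g(2))
      qed (simp add: assms(4))
    qed
    have "\<bar>\<integral>y. mollifier n (x - y) * g y \<partial>lebesgue\<bar> \<le> B" for n x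
    proof -
      have "norm (\<integral>y. mollifier n (x - y) * g y \<partial>lebesgue) \<le> (\<integral>y. mollifier n (x - y) * B \<partial>lebesgue)"
      proof (rule Bochner_Integration.integral_norm_bound_integral)
        show i: "integrable lebesgue (\<lambda>y. mollifier n (x - y) * B)"
          by (intro integrable_mult_left integrable_mollifier)
        show le: "norm (mollifier n (x - y) * g y) \<le> mollifier n (x - y) * B" for y
          using B[of y] by (simp add: abs_mult mollifier_nonneg mult_left_mono)
        show "integrable lebesgue (\<lambda>y. mollifier n (x - y) * g y)"
          by (rule Bochner_Integration.integrable_bound[OF i])
             (use g(1) borel_measurable_integrable[OF integrable_mollifier[of n x]] le in
              \<open>auto intro!: order_trans[OF _ abs_ge_self]\<close>)
      qed
      then show ?thesis by (simp add: integral_mollifier)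
    qed
    then show "AE x in lebesgue. norm (F x * (\<integral>y. mollifier n (x - y) * g y \<partial>lebesgue)) \<le> B * \<bar>F x\<bar>" for n
      by (intro AE_I2) (simp add: abs_mult mult.commute[of B] mult_left_mono)
  qed
  then show ?thesis unfolding kint_fst[OF assms(3) gi rho] .
qed

text \<open>A density argument detached from the norm in which \<open>G\<close> is approximated:
  what is required is an error in the pairing that is uniform in \<open>n\<close>. Three errors of
  size r/4 then stay below r.\<close>

lemma kint_mollifier_tendsto_approx:
  assumes "compact D" "integrable lebesgue F" "\<And>x. x \<notin> interior D \<Longrightarrow> F x = 0" "integrable lebesgue G"
    and FG: "integrable lebesgue (\<lambda>x. F x * G x)"
    and approx: "\<And>e. e > 0 \<Longrightarrow> \<exists>g. nice_on D g \<and> (\<forall>n. \<bar>kint (mollifier n) F (\<lambda>x. G x - g x)\<bar> \<le> e)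
            \<and> \<bar>\<integral>x. F x * (G x - g x) \<partial>lebesgue\<bar> \<le> e"
  shows "(\<lambda>n. kint (mollifier n) F G) \<longlonglongrightarrow> (\<integral>x. F x * G x \<partial>lebesgue)"
proof (rule LIMSEQ_I)
  fix r :: real assume "r > 0"
  then have "r / 4 > 0" by simp
  from approx[OF this] obtain g where g: "nice_on D g"
    and 1: "\<And>n. \<bar>kint (mollifier n) F (\<lambda>x. G x - g x)\<bar> \<le> r / 4"
    and 2: "\<bar>\<integral>x. F x * (G x - g x) \<partial>lebesgue\<bar> \<le> r / 4" by blast
  from g obtain B where B: "\<And>x. \<bar>g x\<bar> \<le> B" and g': "g \<in> borel_measurable lebesgue"
     "\<And>x. x \<notin> D \<Longrightarrow> g x = 0"
    by (auto simp: nice_on_def)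
  have gi: "integrable lebesgue g"
    by (rule integrable_bounded_support[OF assms(1) g'(1) B g'(2)])
  have Fg: "integrable lebesgue (\<lambda>x. F x * g x)"
  proof (rule Bochner_Integration.integrable_bound[OF integrable_mult_right[OF assms(2), of B]])
    show "(\<lambda>x. F x * g x) \<in> borel_measurable lebesgue"
      using g'(1) borel_measurable_integrable[OF assms(2)] by measurable
    have "\<bar>g x\<bar> \<le> \<bar>B\<bar>" for x using B[of x] by linarith
    then show "AE x in lebesgue. norm (F x * g x) \<le> norm (B * F x)"
      by (intro AE_I2) (simp add: abs_mult mult.commute[of "\<bar>B\<bar>"] mult_left_mono)
  qed
  obtain N where N: "\<And>n. n \<ge> N \<Longrightarrow> norm (kint (mollifier n) F g - (\<integral>x. F x * g x \<partial>lebesgue)) < r / 4"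
    using LIMSEQ_D[OF kint_mollifier_nice[OF assms(1) g assms(2,3)] \<open>r / 4 > 0\<close>] by blast
  have "norm (kint (mollifier n) F G - (\<integral>x. F x * G x \<partial>lebesgue)) < r" if "n \<ge> N" for n
  proof -
    have "kint (mollifier n) F (\<lambda>x. G x - g x) = kint (mollifier n) F G - kint (mollifier n) F g"
      by (rule kint_diff_right[OF assms(2,4) gi mollifier_measurable mollifier_bounded])
    moreover have "(\<integral>x. F x * (G x - g x) \<partial>lebesgue) = (\<integral>x. F x * G x \<partial>lebesgue) - (\<integral>x. F x * g x \<partial>lebesgue)"
      using Bochner_Integration.integral_diff[OF FG Fg] by (simp add: right_diff_distrib)
    ultimately show ?thesis using 1[of n] 2 N[OF that] unfolding real_norm_def by linarith
  qed
  then show "\<exists>N. \<forall>n\<ge>N. norm (kint (mollifier n) F G - (\<integral>x. F x * G x \<partial>lebesgue)) < r" by blast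
qed

text \<open>Integrating first over the variable of \<open>F\<close> gives a mollified
  \<open>F\<close>, still bounded by \<open>B\<close>; hence the error is at most \<open>B\<close>
  times the L1 norm of G - g. This version serves the fundamental lemma, where \<open>F\<close> is a
  sign.\<close>

lemma kint_mollifier_tendsto_bounded:
  assumes D: "compact D" and F: "F \<in> borel_measurable lebesgue" "\<And>x. \<bar>F x\<bar> \<le> B"
    "\<And>x. x \<notin> interior D \<Longrightarrow> F x = 0"
    and G: "integrable lebesgue G" "\<And>x. x \<notin> D \<Longrightarrow> G x = 0"
  shows "(\<lambda>n. kint (mollifier n) F G) \<longlonglongrightarrow> (\<integral>x. F x * G x \<partial>lebesgue)"
proof -
  have F0: "F x = 0" if "x \<notin> D" for x using F(3) that interior_subset[of D] by blast
  have Fi: "integrable lebesgue F" by (rule integrable_bounded_support[OF D F(1,2) F0])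
  have FH: "integrable lebesgue (\<lambda>x. F x * H x)" and FH_le: "\<bar>\<integral>x. F x * H x \<partial>lebesgue\<bar> \<le> B * (\<integral>x. \<bar>H x\<bar> \<partial>lebesgue)"
    if H: "integrable lebesgue H" for H
  proof -
    have le: "norm (F x * H x) \<le> B * \<bar>H x\<bar>" for x
      using F(2)[of x] by (simp add: abs_mult mult_right_mono)
    have i: "integrable lebesgue (\<lambda>x. B * \<bar>H x\<bar>)" using H by (intro integrable_mult_right integrable_abs)
    show FH: "integrable lebesgue (\<lambda>x. F x * H x)"
      by (rule Bochner_Integration.integrable_bound[OF i])
         (use F(1) borel_measurable_integrable[OF H] le in \<open>auto intro!: AE_I2 order_trans[OF _ abs_ge_self]\<close>)
    have "norm (\<integral>x. F x * H x \<partial>lebesgue) \<le> (\<integral>x. B * \<bar>H x\<bar> \<partial>lebesgue)"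
      by (rule Bochner_Integration.integral_norm_bound_integral[OF FH i le])
    then show "\<bar>\<integral>x. F x * H x \<partial>lebesgue\<bar> \<le> B * (\<integral>x. \<bar>H x\<bar> \<partial>lebesgue)" by simp
  qed
  have B0: "B \<ge> 0" using F(2)[of undefined] by linarith
  show ?thesis
  proof (rule kint_mollifier_tendsto_approx[OF D Fi F(3) G(1) FH[OF G(1)]])
    fix e :: real assume "e > 0"
    then have e: "e / (B + 1) > 0" using B0 by simp
    obtain g where g: "nice_on D g" "integrable lebesgue (\<lambda>x. \<bar>G x - g x\<bar> ^ 1)"
      "(\<integral>x. \<bar>G x - g x\<bar> ^ 1 \<partial>lebesgue) < e / (B + 1)"
      using Lp_approx_nice[OF D borel_measurable_integrable[OF G(1)] order_refl _ G(2) e]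
        integrable_abs[OF G(1)] by auto
    define H where "H x = G x - g x" for x
    have gm: "g \<in> borel_measurable lebesgue" using g(1) by (simp add: nice_on_def)
    have Hm: "H \<in> borel_measurable lebesgue"
      using gm borel_measurable_integrable[OF G(1)] unfolding H_def by measurable
    have Hi: "integrable lebesgue H"
      using g(2) Hm by (subst integrable_abs_iff[symmetric]) (simp_all add: H_def)
    have "B * (\<integral>x. \<bar>H x\<bar> \<partial>lebesgue) \<le> (B + 1) * (e / (B + 1))"
      using g(3) B0 by (intro mult_mono) (simp_all add: H_def)
    also have "\<dots> = e" using B0 by simp
    finally have He: "B * (\<integral>x. \<bar>H x\<bar> \<partial>lebesgue) \<le> e" .
    have k: "\<bar>kint (mollifier n) F H\<bar> \<le> e" for n
    proof -
      note rho = mollifier_measurable[of n] mollifier_bounded[of n]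
      have eq: "kint (mollifier n) F H = (\<integral>y. H y * (\<integral>x. mollifier n (x - y) * F x \<partial>lebesgue) \<partial>lebesgue)"
        by (rule kint_snd[OF Fi Hi rho])
      have inner: "\<bar>\<integral>x. mollifier n (x - y) * F x \<partial>lebesgue\<bar> \<le> B" for y
      proof -
        have i: "integrable lebesgue (\<lambda>x. mollifier n (x - y) * B)"
          unfolding mollifier_commute[of n _ y] by (intro integrable_mult_left integrable_mollifier)
        have le: "norm (mollifier n (x - y) * F x) \<le> mollifier n (x - y) * B" for x
          using F(2)[of x] by (simp add: abs_mult mollifier_nonneg mult_left_mono)
        have m: "(\<lambda>x. mollifier n (x - y)) \<in> borel_measurable lebesgue"
          unfolding mollifier_commute[of n _ y] using integrable_mollifier by (rule borel_measurable_integrable)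
        have "integrable lebesgue (\<lambda>x. mollifier n (x - y) * F x)"
          by (rule Bochner_Integration.integrable_bound[OF i])
             (use F(1) m le in \<open>auto intro!: AE_I2 order_trans[OF _ abs_ge_self]\<close>)
        from Bochner_Integration.integral_norm_bound_integral[OF this i le]
        show ?thesis unfolding mollifier_commute[of n _ y] by (simp add: integral_mollifier)
      qed
      have i: "integrable lebesgue (\<lambda>y. B * \<bar>H y\<bar>)" using Hi by (intro integrable_mult_right integrable_abs)
      have le: "norm (H y * (\<integral>x. mollifier n (x - y) * F x \<partial>lebesgue)) \<le> B * \<bar>H y\<bar>" for y
        using mult_left_mono[OF inner[of y] abs_ge_zero[of "H y"]] by (simp add: abs_mult mult.commute)
      have "norm (kint (mollifier n) F H) \<le> (\<integral>y. B * \<bar>H y\<bar> \<partial>lebesgue)"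
        unfolding eq
        by (rule Bochner_Integration.integral_norm_bound_integral[OF kernel_integrable_snd[OF Fi Hi rho] i le])
      then show ?thesis using He by simp
    qed
    show "\<exists>g. nice_on D g \<and> (\<forall>n. \<bar>kint (mollifier n) F (\<lambda>x. G x - g x)\<bar> \<le> e)
            \<and> \<bar>\<integral>x. F x * (G x - g x) \<partial>lebesgue\<bar> \<le> e"
      using g(1) k FH_le[OF Hi] He by (intro exI[of _ g]) (auto simp flip: H_def)
  qed
qed

text \<open>Young's inequality with a free weight, read off from the square of l|x| - |y|. All later
  absorptions are instances of it.\<close>

lemma abs_mult_le_weighted: "l > 0 \<Longrightarrow> \<bar>x * y\<bar> \<le> l / 2 * x\<^sup>2 + 1 / (2 * l) * y\<^sup>2" for x y l :: real
proof -
  assume "l > 0"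
  have "0 \<le> (l * \<bar>x\<bar> - \<bar>y\<bar>)\<^sup>2 / (2 * l)" using \<open>l > 0\<close> by simp
  also have "\<dots> = l / 2 * x\<^sup>2 + 1 / (2 * l) * y\<^sup>2 - \<bar>x\<bar> * \<bar>y\<bar>"
    using \<open>l > 0\<close> by (simp add: power2_diff power_mult_distrib field_simps power2_eq_square)
  finally show ?thesis by (simp add: abs_mult)
qed

lemma square_integrable_product:
  fixes F G :: "'a \<Rightarrow> real"
  assumes "F \<in> borel_measurable M" "G \<in> borel_measurable M"
    "integrable M (\<lambda>x. (F x)\<^sup>2)" "integrable M (\<lambda>x. (G x)\<^sup>2)"
  shows "integrable M (\<lambda>x. F x * G x)"
proof (rule Bochner_Integration.integrable_bound[of M "\<lambda>x. (F x)\<^sup>2 + (G x)\<^sup>2"])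
  show "AE x in M. norm (F x * G x) \<le> norm ((F x)\<^sup>2 + (G x)\<^sup>2)"
  proof (intro AE_I2)
    fix x show "norm (F x * G x) \<le> norm ((F x)\<^sup>2 + (G x)\<^sup>2)"
      using abs_mult_le_weighted[of 1 "F x" "G x"] zero_le_power2[of "F x"] zero_le_power2[of "G x"]
      unfolding real_norm_def by simp
  qed
qed (use assms in auto)

lemma square_integrable_imp_integrable:
  fixes F :: "'a::euclidean_space \<Rightarrow> real"
  assumes "compact D" "F \<in> borel_measurable lebesgue" "integrable lebesgue (\<lambda>x. (F x)\<^sup>2)" "\<And>x. x \<notin> D \<Longrightarrow> F x = 0"
  shows "integrable lebesgue F"
proof -
  have [measurable]: "(indicator D :: 'a \<Rightarrow> real) \<in> borel_measurable lebesgue"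
    using integrable_indicator_compact[OF assms(1)] by (rule borel_measurable_integrable)
  have "(indicator D x :: real)\<^sup>2 = indicator D x" for x by (simp add: indicator_def)
  then have "integrable lebesgue (\<lambda>x. indicator D x * F x)"
    using assms integrable_indicator_compact[OF assms(1)] by (intro square_integrable_product) auto
  moreover have "indicator D x * F x = F x" for x using assms(4)[of x] by (cases "x \<in> D") auto
  ultimately show ?thesis by simp
qed

text \<open>Young's inequality is applied inside the double integral. Each resulting square depends
  on one variable, and the kernel has mass at most one in the other. The indicators of
  \<open>D\<close> keep the one-variable squares integrable on the product.\<close>

lemma kint_mollifier_le:
  fixes F H :: "'a::euclidean_space \<Rightarrow> real"
  assumes D: "compact D"
    and F: "F \<in> borel_measurable lebesgue" "integrable lebesgue (\<lambda>x. (F x)\<^sup>2)" "\<And>x. x \<notin> D \<Longrightarrow> F x = 0"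
    and H: "H \<in> borel_measurable lebesgue" "integrable lebesgue (\<lambda>x. (H x)\<^sup>2)" "\<And>x. x \<notin> D \<Longrightarrow> H x = 0"
    and l: "l > 0"
  shows "\<bar>kint (mollifier n) F H\<bar> \<le> l / 2 * (\<integral>x. (F x)\<^sup>2 \<partial>lebesgue) + 1 / (2 * l) * (\<integral>x. (H x)\<^sup>2 \<partial>lebesgue)"
proof -
  note rho = mollifier_measurable[of n] mollifier_bounded[of n]
  note iD = integrable_indicator_compact[OF D]
  have Fi: "integrable lebesgue F" by (rule square_integrable_imp_integrable[OF D F])
  have Hi: "integrable lebesgue H" by (rule square_integrable_imp_integrable[OF D H])
  have Dm: "D \<in> sets lebesgue" using lmeasurable_compact[OF D] by (rule fmeasurableD)
  let ?I = "indicator D :: 'a \<Rightarrow> real"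
  note i1 = kernel_integrable[OF F(2) iD rho] and i2 = kernel_integrable[OF iD H(2) rho]
  have "norm (kint (mollifier n) F H) \<le>
      (\<integral>p. l / 2 * (case p of (x, y) \<Rightarrow> mollifier n (x - y) * ((F x)\<^sup>2 * ?I y))
          + 1 / (2 * l) * (case p of (x, y) \<Rightarrow> mollifier n (x - y) * (?I x * (H y)\<^sup>2)) \<partial>(lebesgue \<Otimes>\<^sub>M lebesgue))"
    unfolding kint_def
  proof (rule Bochner_Integration.integral_norm_bound_integral)
    show "integrable (lebesgue \<Otimes>\<^sub>M lebesgue) (\<lambda>p. l / 2 * (case p of (x, y) \<Rightarrow> mollifier n (x - y) * ((F x)\<^sup>2 * ?I y))
          + 1 / (2 * l) * (case p of (x, y) \<Rightarrow> mollifier n (x - y) * (?I x * (H y)\<^sup>2)))"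
      by (intro Bochner_Integration.integrable_add integrable_mult_right i1 i2)
    fix p :: "'a \<times> 'a"
    obtain x y where p: "p = (x, y)" by force
    have "\<bar>F x * H y\<bar> \<le> l / 2 * ((F x)\<^sup>2 * ?I y) + 1 / (2 * l) * (?I x * (H y)\<^sup>2)"
      using abs_mult_le_weighted[OF l, of "F x" "H y"] F(3)[of x] H(3)[of y] l
      by (cases "x \<in> D"; cases "y \<in> D") auto
    from mult_left_mono[OF this mollifier_nonneg[of n "x - y"]]
    show "norm (case p of (x, y) \<Rightarrow> mollifier n (x - y) * (F x * H y))
      \<le> l / 2 * (case p of (x, y) \<Rightarrow> mollifier n (x - y) * ((F x)\<^sup>2 * ?I y))
          + 1 / (2 * l) * (case p of (x, y) \<Rightarrow> mollifier n (x - y) * (?I x * (H y)\<^sup>2))"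
      by (simp add: p abs_mult mollifier_nonneg algebra_simps)
  qed (rule kernel_integrable[OF Fi Hi rho])
  also have "\<dots> = l / 2 * kint (mollifier n) (\<lambda>x. (F x)\<^sup>2) ?I + 1 / (2 * l) * kint (mollifier n) ?I (\<lambda>x. (H x)\<^sup>2)"
    unfolding kint_def
    by (subst Bochner_Integration.integral_add) (use i1 i2 in auto)
  also have "\<dots> \<le> l / 2 * (\<integral>x. (F x)\<^sup>2 \<partial>lebesgue) + 1 / (2 * l) * (\<integral>x. (H x)\<^sup>2 \<partial>lebesgue)"
  proof (intro add_mono mult_left_mono)
    show "kint (mollifier n) (\<lambda>x. (F x)\<^sup>2) ?I \<le> (\<integral>x. (F x)\<^sup>2 \<partial>lebesgue)"
      unfolding kint_fst[OF F(2) iD rho]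
      using mult_left_mono[OF integral_mollifier_indicator_le[OF Dm, of n] zero_le_power2]
      by (intro integral_mono kernel_integrable_fst[OF F(2) iD rho] F(2)) simp
    show "kint (mollifier n) ?I (\<lambda>x. (H x)\<^sup>2) \<le> (\<integral>x. (H x)\<^sup>2 \<partial>lebesgue)"
      unfolding kint_snd[OF iD H(2) rho]
    proof (intro integral_mono kernel_integrable_snd[OF iD H(2) rho] H(2))
      fix y
      have "(\<integral>x. mollifier n (x - y) * ?I x \<partial>lebesgue) \<le> 1"
        unfolding mollifier_commute[of n _ y] by (rule integral_mollifier_indicator_le[OF Dm])
      from mult_left_mono[OF this zero_le_power2[of "H y"]]
      show "(H y)\<^sup>2 * (\<integral>x. mollifier n (x - y) * ?I x \<partial>lebesgue) \<le> (H y)\<^sup>2" by simp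
    qed
  qed (use l in auto)
  finally show ?thesis by simp
qed

lemma kint_mollifier_tendsto_L2:
  fixes F G :: "'a::euclidean_space \<Rightarrow> real"
  assumes D: "compact D"
    and F: "F \<in> borel_measurable lebesgue" "integrable lebesgue (\<lambda>x. (F x)\<^sup>2)" "\<And>x. x \<notin> interior D \<Longrightarrow> F x = 0"
    and G: "G \<in> borel_measurable lebesgue" "integrable lebesgue (\<lambda>x. (G x)\<^sup>2)" "\<And>x. x \<notin> D \<Longrightarrow> G x = 0"
  shows "(\<lambda>n. kint (mollifier n) F G) \<longlonglongrightarrow> (\<integral>x. F x * G x \<partial>lebesgue)"
proof -
  have F0: "F x = 0" if "x \<notin> D" for x using F(3) that interior_subset[of D] by blast
  have Fi: "integrable lebesgue F" by (rule square_integrable_imp_integrable[OF D F(1,2) F0])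
  have Gi: "integrable lebesgue G" by (rule square_integrable_imp_integrable[OF D G])
  show ?thesis
  proof (rule kint_mollifier_tendsto_approx[OF D Fi F(3) Gi square_integrable_product[OF F(1) G(1) F(2) G(2)]])
    fix e :: real assume "e > 0"
    define A where "A = (\<integral>x. (F x)\<^sup>2 \<partial>lebesgue)"
    have "A \<ge> 0" by (simp add: A_def)
    \<comment> \<open>With this weight the \<open>F\<close> term is at most e/2; approximating
      \<open>G\<close> with squared L2 error below l e makes the other term at most e/2.\<close>
    define l where "l = e / (A + 1)"
    have "l > 0" using \<open>e > 0\<close> \<open>A \<ge> 0\<close> by (simp add: l_def)
    then have le: "l * e > 0" using \<open>e > 0\<close> by simp
    have G2: "integrable lebesgue (\<lambda>x. \<bar>G x\<bar> ^ 2)" using G(2) by simp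
    obtain g where g: "nice_on D g" "integrable lebesgue (\<lambda>x. \<bar>G x - g x\<bar> ^ 2)"
      "(\<integral>x. \<bar>G x - g x\<bar> ^ 2 \<partial>lebesgue) < l * e"
      using Lp_approx_nice[OF D G(1) one_le_numeral G2 G(3) le] by blast
    define H where "H x = G x - g x" for x
    have gm: "g \<in> borel_measurable lebesgue" using g(1) by (simp add: nice_on_def)
    have Hm: "H \<in> borel_measurable lebesgue"
      using gm G(1) unfolding H_def by measurable
    have H2: "integrable lebesgue (\<lambda>x. (H x)\<^sup>2)" using g(2) by (simp add: H_def)
    have H0: "H x = 0" if "x \<notin> D" for x using that G(3) g(1) by (simp add: H_def nice_on_def)
    have "l / 2 * A + 1 / (2 * l) * (\<integral>x. (H x)\<^sup>2 \<partial>lebesgue) \<le> e / 2 + 1 / (2 * l) * (l * e)"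
    proof (intro add_mono mult_left_mono)
      have "l * A \<le> l * (A + 1)" using \<open>l > 0\<close> by (intro mult_left_mono) auto
      also have "\<dots> = e" using \<open>A \<ge> 0\<close> by (simp add: l_def)
      finally show "l / 2 * A \<le> e / 2" by simp
      show "(\<integral>x. (H x)\<^sup>2 \<partial>lebesgue) \<le> l * e" using g(3) by (simp add: H_def)
    qed (use \<open>l > 0\<close> in auto)
    also have "\<dots> = e" using \<open>l > 0\<close> by simp
    finally have He: "l / 2 * A + 1 / (2 * l) * (\<integral>x. (H x)\<^sup>2 \<partial>lebesgue) \<le> e" .
    have k: "\<bar>kint (mollifier n) F H\<bar> \<le> e" for n
      using kint_mollifier_le[OF D F(1,2) F0 Hm H2 H0 \<open>l > 0\<close>, of n] He by (simp add: A_def)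
    have "norm (\<integral>x. F x * H x \<partial>lebesgue) \<le> (\<integral>x. l / 2 * (F x)\<^sup>2 + 1 / (2 * l) * (H x)\<^sup>2 \<partial>lebesgue)"
      using abs_mult_le_weighted[OF \<open>l > 0\<close>]
      by (intro Bochner_Integration.integral_norm_bound_integral square_integrable_product F Hm H2
          Bochner_Integration.integrable_add integrable_mult_right) auto
    also have "\<dots> = l / 2 * A + 1 / (2 * l) * (\<integral>x. (H x)\<^sup>2 \<partial>lebesgue)"
      unfolding A_def by (subst Bochner_Integration.integral_add) (use F(2) H2 in auto)
    finally have "\<bar>\<integral>x. F x * H x \<partial>lebesgue\<bar> \<le> e" using He by simp
    then show "\<exists>g. nice_on D g \<and> (\<forall>n. \<bar>kint (mollifier n) F (\<lambda>x. G x - g x)\<bar> \<le> e)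
            \<and> \<bar>\<integral>x. F x * (G x - g x) \<partial>lebesgue\<bar> \<le> e"
      using g(1) k by (intro exI[of _ g]) (auto simp flip: H_def)
  qed
qed

section \<open>The product rule for weak derivatives\<close>

lemma compact_nbhd:
  fixes K :: "'a::euclidean_space set"
  assumes "compact K" "open U" "K \<subseteq> U"
  obtains D d where "compact D" "D \<subseteq> U" "d > 0" "\<And>x. x \<in> K \<Longrightarrow> cball x d \<subseteq> interior D"
proof -
  obtain e where e: "e > 0" "(\<Union>x\<in>K. cball x e) \<subseteq> U"
    using compact_subset_open_imp_cball_epsilon_subset[OF assms] by blast
  let ?D = "\<Union>x\<in>K. cball x e"
  have "cball x (e / 2) \<subseteq> interior ?D" if "x \<in> K" for x
  proof -
    have "cball x (e / 2) \<subseteq> ball x e" using \<open>e > 0\<close> by auto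
    also have "ball x e \<subseteq> interior ?D"
    proof (rule interior_maximal)
      show "ball x e \<subseteq> ?D" using ball_subset_cball[of x e] that by auto
    qed simp
    finally show ?thesis .
  qed
  moreover have "compact ?D" using compact_minkowski_sum_cball[OF assms(1)] .
  ultimately show ?thesis using that[of ?D "e / 2"] e by auto
qed

lemma has_derivative_bump:
  fixes x :: "'a::euclidean_space"
  shows "((\<lambda>x. flat j (r\<^sup>2 - (norm (x - c))\<^sup>2)) has_derivative
     (\<lambda>h. (flat (j + 2) (r\<^sup>2 - (norm (x - c))\<^sup>2) - real j * flat (j + 1) (r\<^sup>2 - (norm (x - c))\<^sup>2))
        * (- 2 * ((x - c) \<bullet> h)))) (at x)"
proof -
  have "((\<lambda>x. r\<^sup>2 - (norm (x - c))\<^sup>2) has_derivative (\<lambda>h. - 2 * ((x - c) \<bullet> h))) (at x)"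
    unfolding power2_norm_eq_inner
    by (auto intro!: derivative_eq_intros simp: inner_commute)
  from has_derivative_compose[OF this flat_has_derivative[of j, unfolded has_field_derivative_def]]
  show ?thesis .
qed

lemma partial_bump:
  "partial [e] (bump c r) x = - 2 * ((x - c) \<bullet> e) * flat 2 (r\<^sup>2 - (norm (x - c))\<^sup>2)"
  using fun_cong[OF frechet_derivative_at[OF has_derivative_bump[of 0 r c x]], of e, symmetric]
  by (simp add: bump_def[abs_def] numeral_2_eq_2 mult.commute)

text \<open>Symmetry of second derivatives is needed for bumps alone, since these are the only
  functions tested in \<open>weak_deriv_fundamental\<close>; the explicit formula is symmetric in
  the two directions.\<close>

lemma partial_bump_commute: "partial [d, e] (bump c r) x = partial [e, d] (bump c r) x"
proof -
  define s where "s = r\<^sup>2 - (norm (x - c))\<^sup>2"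
  have *: "partial [d, e] (bump c r) x = (- 2 * ((x - c) \<bullet> e)) * ((flat (2 + 2) s
             - real 2 * flat (2 + 1) s) * (- 2 * ((x - c) \<bullet> d))) + (- 2 * (d \<bullet> e)) * flat 2 s" for d e
  proof -
    have "((\<lambda>x. - 2 * ((x - c) \<bullet> e) * flat 2 (r\<^sup>2 - (norm (x - c))\<^sup>2)) has_derivative
        (\<lambda>h. (- 2 * ((x - c) \<bullet> e)) * ((flat (2 + 2) s - real 2 * flat (2 + 1) s) * (- 2 * ((x - c) \<bullet> h)))
            + (- 2 * (h \<bullet> e)) * flat 2 s)) (at x)"
      unfolding s_def
      by (rule has_derivative_mult[OF _ has_derivative_bump]) (auto intro!: derivative_eq_intros)
    from fun_cong[OF frechet_derivative_at[OF this], of d]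
    have "(- 2 * ((x - c) \<bullet> e)) * ((flat (2 + 2) s - real 2 * flat (2 + 1) s) * (- 2 * ((x - c) \<bullet> d)))
            + (- 2 * (d \<bullet> e)) * flat 2 s = frechet_derivative (partial [e] (bump c r)) (at x) d"
      unfolding partial_bump[abs_def] .
    then show ?thesis by (simp only: partial.simps(2)[of d "[e]"])
  qed
  show ?thesis unfolding *[of d e] *[of e d] by (simp only: inner_commute mult_ac)
qed

lemma set_integrable_cut:
  fixes g :: "'a::euclidean_space \<Rightarrow> real"
  assumes "locally_integrable \<Omega> g" "compact D" "D \<subseteq> \<Omega>"
  shows "integrable lebesgue (\<lambda>x. indicator D x * g x)"
  using assms by (simp add: locally_integrable_def set_integrable_def)

text \<open>Pairing with the sign of \<open>g\<close> on a compact set \<open>K\<close> gives the L1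
  norm of \<open>g\<close> on \<open>K\<close> in the limit. For large \<open>n\<close> the
  mollified pairing vanishes, because around each point of \<open>K\<close> the mollifier is a
  multiple of a bump supported in \<Omega>.\<close>

lemma weak_deriv_fundamental:
  fixes g :: "'a::euclidean_space \<Rightarrow> real"
  assumes "open \<Omega>" and g: "locally_integrable \<Omega> g"
    and bump: "\<And>c r. r > 0 \<Longrightarrow> cball c r \<subseteq> \<Omega> \<Longrightarrow> (LINT x:\<Omega>|lebesgue. bump c r x *\<^sub>R g x) = 0"
  shows "AE x in lebesgue. x \<in> \<Omega> \<longrightarrow> g x = 0"
proof -
  have *: "AE x in lebesgue. x \<in> K \<longrightarrow> g x = 0" if K: "compact K" "K \<subseteq> \<Omega>" for K
  proof -
    obtain D d where D: "compact D" "D \<subseteq> \<Omega>" "d > 0" "\<And>x. x \<in> K \<Longrightarrow> cball x d \<subseteq> interior D"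
      using compact_nbhd[OF K(1) \<open>open \<Omega>\<close> K(2)] by metis
    define G where "G x = indicator D x * g x" for x
    define F where "F x = indicator K x * sgn (G x)" for x
    have Gi: "integrable lebesgue G" unfolding G_def[abs_def] by (rule set_integrable_cut[OF g D(1,2)])
    have [measurable]: "K \<in> sets lebesgue" "G \<in> borel_measurable lebesgue"
      using lmeasurable_compact[OF K(1)] Gi by (auto simp: fmeasurableD)
    have Fm: "F \<in> borel_measurable lebesgue" unfolding F_def[abs_def] by measurable
    have Fb: "\<bar>F x\<bar> \<le> 1" for x by (simp add: F_def indicator_def sgn_if)
    have KD: "K \<subseteq> interior D" using D(3,4) by (meson centre_in_cball less_imp_le subset_iff)
    have F0: "F x = 0" if "x \<notin> interior D" for x using that KD by (auto simp: F_def indicator_def)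
    have F0': "F x = 0" if "x \<notin> D" for x using that F0 interior_subset[of D] by blast
    have Fi: "integrable lebesgue F" by (rule integrable_bounded_support[OF D(1) Fm Fb F0'])
    have lim: "(\<lambda>n. kint (mollifier n) F G) \<longlonglongrightarrow> (\<integral>x. F x * G x \<partial>lebesgue)"
      by (rule kint_mollifier_tendsto_bounded[OF D(1) Fm Fb F0 Gi]) (auto simp: G_def)
    obtain N where N: "1 / real (Suc N) < d" using \<open>d > 0\<close> nat_approx_posE by blast
    have "kint (mollifier n) F G = 0" if "n \<ge> N" for n
    proof -
      have n: "1 / real (Suc n) < d"
        using inverse_Suc_less[OF N that] .
      have "F x * (\<integral>y. mollifier n (x - y) * G y \<partial>lebesgue) = 0" for x
      proof (cases "x \<in> K")
        case True
        have sub: "cball x (1 / real (Suc n)) \<subseteq> D"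
          using D(4)[OF True] n interior_subset[of D] by (meson order_trans less_imp_le subset_cball)
        have eq: "mollifier n (x - y) * G y = (indicator \<Omega> y *\<^sub>R (bump x (1 / real (Suc n)) y *\<^sub>R g y))
              / integral\<^sup>L lebesgue (bump 0 (1 / real (Suc n)) :: 'a \<Rightarrow> real)" for y
        proof (cases "y \<in> D")
          case True
          then show ?thesis using D(2) by (auto simp: mollifier_diff G_def bump_sym[of y])
        next
          case False
          then have "bump x (1 / real (Suc n)) y = 0" using sub by (intro bump_eq_0) auto
          with False show ?thesis by (simp add: G_def)
        qed
        have "(\<integral>y. mollifier n (x - y) * G y \<partial>lebesgue) = 
          (LINT y:\<Omega>|lebesgue. bump x (1 / real (Suc n)) y *\<^sub>R g y) / integral\<^sup>L lebesgue (bump 0 (1 / real (Suc n)) :: 'a \<Rightarrow> real)"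
          unfolding eq set_lebesgue_integral_def by simp
        also have "\<dots> = 0" using bump[of "1 / real (Suc n)" x] sub D(2) by simp
        finally show ?thesis by simp
      qed (simp add: F_def)
      then have "(\<lambda>x. F x * (\<integral>y. mollifier n (x - y) * G y \<partial>lebesgue)) = (\<lambda>x. 0)" by (intro ext)
      then show ?thesis
        unfolding kint_fst[OF Fi Gi mollifier_measurable mollifier_bounded] by simp
    qed
    then have "(\<lambda>n. kint (mollifier n) F G) \<longlonglongrightarrow> 0"
      by (intro tendsto_eventually) (auto simp: eventually_sequentially)
    with lim have "(\<integral>x. F x * G x \<partial>lebesgue) = 0" using LIMSEQ_unique by blast
    moreover have FG: "F x * G x = indicator K x * \<bar>G x\<bar>" for x by (simp add: F_def sgn_if)
    ultimately have "(\<integral>x. indicator K x * \<bar>G x\<bar> \<partial>lebesgue) = 0" by simp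
    moreover have "integrable lebesgue (\<lambda>x. indicator K x * \<bar>G x\<bar>)"
      using integrable_mult_indicator[of K lebesgue "\<lambda>x. \<bar>G x\<bar>"] Gi by simp
    ultimately have "AE x in lebesgue. indicator K x * \<bar>G x\<bar> = 0"
      by (subst (asm) integral_nonneg_eq_0_iff_AE) auto
    then show ?thesis
      by (rule eventually_mono) (use KD interior_subset[of D] in \<open>auto simp: G_def indicator_def split: if_splits\<close>)
  qed
  \<comment> \<open>A countable exhaustion of \<Omega> by compact sets, so that the exceptional null
    sets may be united.\<close>
  obtain C :: "nat \<Rightarrow> 'a set" where C: "\<And>n. compact (C n)" "\<And>n. C n \<subseteq> \<Omega>" "\<Union>(range C) = \<Omega>"
    using open_Union_compact_subsets[OF \<open>open \<Omega>\<close>] by metis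
  have "AE x in lebesgue. \<forall>n. x \<in> C n \<longrightarrow> g x = 0"
    using * C by (subst AE_all_countable) blast
  then show ?thesis by (rule eventually_mono) (use C(3) in blast)
qed

lemma test_functions_partial:
  assumes "\<eta> \<in> test_functions \<Omega>" "set es \<subseteq> Basis"
  shows "partial es \<eta> \<in> test_functions \<Omega>"
proof -
  obtain K where K: "compact K" "K \<subseteq> \<Omega>" "\<And>x. x \<notin> K \<Longrightarrow> \<eta> x = 0"
    using test_functionsE[OF assms(1)] by metis
  show ?thesis
    using K(1,2) assms(2) test_functions_smooth[OF assms(1)]
      partial_eq_0[OF K(3) compact_imp_closed[OF K(1)] _ assms(2)]
    by (intro test_functionsI[of UNIV _ K] smooth_on_partial) auto
qed

lemma test_functions_bounded:
  assumes "\<eta> \<in> test_functions \<Omega>"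
  obtains B where "\<And>x. \<bar>\<eta> x\<bar> \<le> B"
proof -
  obtain K where K: "compact K" "K \<subseteq> \<Omega>" "\<And>x. x \<notin> K \<Longrightarrow> \<eta> x = 0"
    using test_functionsE[OF assms] by metis
  have "continuous_on K \<eta>" by (rule smooth_on_imp_continuous_on[OF test_functions_smooth[OF assms]])
  then have "bounded (\<eta> ` K)" using K(1) compact_continuous_image compact_imp_bounded by blast
  then obtain B where B: "\<And>x. x \<in> K \<Longrightarrow> \<bar>\<eta> x\<bar> \<le> B" unfolding bounded_iff by auto
  have "\<bar>\<eta> x\<bar> \<le> max B 0" for x using B[of x] K(3)[of x] by (cases "x \<in> K") auto
  then show ?thesis by (rule that)
qed

lemma test_functions_borel: "\<eta> \<in> test_functions \<Omega> \<Longrightarrow> \<eta> \<in> borel_measurable borel"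
  by (intro borel_measurable_continuous_onI smooth_on_imp_continuous_on test_functions_smooth)

lemma test_functions_measurable: "\<eta> \<in> test_functions \<Omega> \<Longrightarrow> \<eta> \<in> borel_measurable lebesgue"
  by (simp add: measurable_completion test_functions_borel)

lemma square_integrable_cut:
  fixes f :: "'a::euclidean_space \<Rightarrow> real"
  assumes "square_integrable \<Omega> f" "compact D" "D \<subseteq> \<Omega>"
  shows "(\<lambda>x. indicator D x * f x) \<in> borel_measurable lebesgue"
    and "integrable lebesgue (\<lambda>x. (indicator D x * f x)\<^sup>2)"
proof -
  have D: "D \<in> sets lebesgue" using lmeasurable_compact[OF assms(2)] by (rule fmeasurableD)
  have f: "(\<lambda>x. indicator \<Omega> x * f x) \<in> borel_measurable lebesgue"
    and f2: "integrable lebesgue (\<lambda>x. indicator \<Omega> x * (f x)\<^sup>2)"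
    using assms(1) by (auto simp: square_integrable_def set_borel_measurable_def set_integrable_def)
  have "indicator D x * f x = indicator D x * (indicator \<Omega> x * f x)" for x
    using assms(3) by (auto simp: indicator_def)
  moreover have "(\<lambda>x. indicator D x * (indicator \<Omega> x * f x)) \<in> borel_measurable lebesgue"
    by (rule borel_measurable_times[OF borel_measurable_indicator[OF D] f])
  ultimately show "(\<lambda>x. indicator D x * f x) \<in> borel_measurable lebesgue" by presburger
  have "(indicator D x * f x)\<^sup>2 = indicator D x *\<^sub>R (indicator \<Omega> x * (f x)\<^sup>2)" for x
    using assms(3) by (auto simp: indicator_def)
  then show "integrable lebesgue (\<lambda>x. (indicator D x * f x)\<^sup>2)"
    using integrable_mult_indicator[OF D f2] by simp
qed

lemma bounded_mult_square_integrable: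
  fixes f \<eta> :: "'a \<Rightarrow> real"
  assumes "\<eta> \<in> borel_measurable M" "\<And>x. \<bar>\<eta> x\<bar> \<le> B" "f \<in> borel_measurable M" "integrable M (\<lambda>x. (f x)\<^sup>2)"
  shows "integrable M (\<lambda>x. (\<eta> x * f x)\<^sup>2)"
proof (rule Bochner_Integration.integrable_bound[OF integrable_mult_right[OF assms(4), of "B\<^sup>2"]])
  show "AE x in M. norm ((\<eta> x * f x)\<^sup>2) \<le> norm (B\<^sup>2 * (f x)\<^sup>2)"
  proof (intro AE_I2)
    fix x
    have "\<bar>\<eta> x\<bar>\<^sup>2 \<le> B\<^sup>2" using assms(2)[of x] by (intro power_mono) auto
    then show "norm ((\<eta> x * f x)\<^sup>2) \<le> norm (B\<^sup>2 * (f x)\<^sup>2)"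
      by (simp add: power_mult_distrib mult_right_mono)
  qed
qed (use assms in measurable)

lemma integrable_kernel_mult:
  fixes F \<rho> :: "'a::euclidean_space \<Rightarrow> real"
  assumes "integrable lebesgue F" "\<rho> \<in> borel_measurable borel" "\<And>z. \<bar>\<rho> z\<bar> \<le> B"
  shows "integrable lebesgue (\<lambda>x. \<rho> x * F x)"
proof (rule Bochner_Integration.integrable_bound[OF integrable_mult_right[OF assms(1), of B]])
  show "(\<lambda>x. \<rho> x * F x) \<in> borel_measurable lebesgue"
    using assms(2) by (intro borel_measurable_times borel_measurable_integrable[OF assms(1)])
      (simp add: measurable_completion)
  have "\<bar>\<rho> z\<bar> \<le> \<bar>B\<bar>" for z using assms(3)[of z] by linarith
  then show "AE x in lebesgue. norm (\<rho> x * F x) \<le> norm (B * F x)"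
    by (intro AE_I2) (simp add: abs_mult mult_right_mono)
qed

lemma has_weak_derivD:
  fixes f f' :: "'a::euclidean_space \<Rightarrow> real"
  assumes "has_weak_deriv \<Omega> [e] f f'" "\<phi> \<in> test_functions \<Omega>"
    and D: "D \<subseteq> \<Omega>" "\<And>x. x \<notin> D \<Longrightarrow> \<phi> x = 0" "\<And>x. x \<notin> D \<Longrightarrow> partial [e] \<phi> x = 0"
  shows "(\<integral>x. partial [e] \<phi> x * (indicator D x * f x) \<partial>lebesgue)
       = - (\<integral>x. \<phi> x * (indicator D x * f' x) \<partial>lebesgue)"
proof -
  have eq: "indicator \<Omega> x *\<^sub>R (partial [e] \<phi> x *\<^sub>R f x) = partial [e] \<phi> x * (indicator D x * f x)"
       "indicator \<Omega> x *\<^sub>R (\<phi> x *\<^sub>R f' x) = \<phi> x * (indicator D x * f' x)" for x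
    using D(1) D(2,3)[of x] by (cases "x \<in> D"; auto)+
  have "(\<integral>x. indicator \<Omega> x *\<^sub>R (partial [e] \<phi> x *\<^sub>R f x) \<partial>lebesgue)
      = (-1) ^ length [e] *\<^sub>R (\<integral>x. indicator \<Omega> x *\<^sub>R (\<phi> x *\<^sub>R f' x) \<partial>lebesgue)"
    using assms(1,2) unfolding has_weak_deriv_def set_lebesgue_integral_def by blast
  then show ?thesis unfolding eq by simp
qed

text \<open>The mollifier is shared between the two factors: its derivative in x, produced by
  testing \<open>f\<close>, is eliminated against its derivative in y, produced by testing
  \<open>g\<close>. What remains are pairings with the mollifier itself, which converge by
  \<open>kint_mollifier_tendsto_L2\<close>.\<close>

theorem weak_deriv_product_rule:
  fixes f g f' g' :: "'a::euclidean_space \<Rightarrow> real"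
  assumes "open \<Omega>" and e: "e \<in> Basis" and \<eta>: "\<eta> \<in> test_functions \<Omega>"
    and f: "has_weak_deriv \<Omega> [e] f f'" and g: "has_weak_deriv \<Omega> [e] g g'"
    and sq: "square_integrable \<Omega> f" "square_integrable \<Omega> f'" "square_integrable \<Omega> g" "square_integrable \<Omega> g'"
  shows "(LINT x:\<Omega>|lebesgue. partial [e] \<eta> x * (f x * g x))
       = - (LINT x:\<Omega>|lebesgue. \<eta> x * (f x * g' x + f' x * g x))"
proof -
  obtain K where K: "compact K" "K \<subseteq> \<Omega>" "\<And>x. x \<notin> K \<Longrightarrow> \<eta> x = 0"
    using test_functionsE[OF \<eta>] by metis
  define \<theta> where "\<theta> = partial [e] \<eta>"
  have \<theta>: "\<theta> \<in> test_functions \<Omega>" unfolding \<theta>_def by (rule test_functions_partial[OF \<eta>]) (use e in auto)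
  have \<theta>0: "\<theta> x = 0" if "x \<notin> K" for x
    unfolding \<theta>_def by (rule partial_eq_0[OF K(3)]) (use e K(1) that in \<open>auto simp: compact_imp_closed\<close>)
  obtain D d where D: "compact D" "D \<subseteq> \<Omega>" "d > 0" "\<And>x. x \<in> K \<Longrightarrow> cball x d \<subseteq> interior D"
    using compact_nbhd[OF K(1) \<open>open \<Omega>\<close> K(2)] by metis
  have KD: "K \<subseteq> interior D" using D(3,4) by (meson centre_in_cball less_imp_le subset_iff)
  have KD': "K \<subseteq> D" using KD interior_subset[of D] by blast
  obtain B1 where B1: "\<And>x. \<bar>\<eta> x\<bar> \<le> B1" using test_functions_bounded[OF \<eta>] by metis
  obtain B2 where B2: "\<And>x. \<bar>\<theta> x\<bar> \<le> B2" using test_functions_bounded[OF \<theta>] by metis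
  \<comment> \<open>Nothing is known outside \<Omega>, so all functions are cut to the compact
    \<open>D\<close>, which contains a \<open>d\<close>-neighbourhood of the support of \<eta>;
    kernels of radius below \<open>d\<close> do not see the cut.\<close>
  define cut where "cut h x = indicator D x * h x" for h :: "'a \<Rightarrow> real" and x
  have cut0: "cut h x = 0" if "x \<notin> D" for h x using that by (simp add: cut_def)
  have cut: "cut h \<in> borel_measurable lebesgue" "integrable lebesgue (\<lambda>x. (cut h x)\<^sup>2)"
    if "square_integrable \<Omega> h" for h
    using square_integrable_cut[OF that D(1,2)] by (simp_all add: cut_def[abs_def])
  have cuti: "integrable lebesgue (cut h)" if "square_integrable \<Omega> h" for h
    by (rule square_integrable_imp_integrable[OF D(1) cut[OF that] cut0])
  have prod: "(\<lambda>x. \<xi> x * cut h x) \<in> borel_measurable lebesgue"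
       "integrable lebesgue (\<lambda>x. (\<xi> x * cut h x)\<^sup>2)" "integrable lebesgue (\<lambda>x. \<xi> x * cut h x)"
    if h: "square_integrable \<Omega> h" and \<xi>: "\<xi> \<in> test_functions \<Omega>" for h \<xi>
  proof -
    obtain B where B: "\<And>x. \<bar>\<xi> x\<bar> \<le> B" using test_functions_bounded[OF \<xi>] by metis
    show 1: "(\<lambda>x. \<xi> x * cut h x) \<in> borel_measurable lebesgue"
      using test_functions_measurable[OF \<xi>] cut[OF h] by (intro borel_measurable_times)
    show 2: "integrable lebesgue (\<lambda>x. (\<xi> x * cut h x)\<^sup>2)"
      by (rule bounded_mult_square_integrable[OF test_functions_measurable[OF \<xi>] B cut[OF h]])
    show "integrable lebesgue (\<lambda>x. \<xi> x * cut h x)"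
      by (rule square_integrable_imp_integrable[OF D(1) 1 2]) (simp add: cut0)
  qed
  \<comment> \<open>The three products that survive: \<eta> f will be paired with g', while (partial
    \<eta>) f and \<eta> f' will be paired with g.\<close>
  define A where "A x = \<eta> x * cut f x" for x
  define B where "B x = \<theta> x * cut f x" for x
  define C where "C x = \<eta> x * cut f' x" for x
  have A: "A \<in> borel_measurable lebesgue" "integrable lebesgue (\<lambda>x. (A x)\<^sup>2)" "integrable lebesgue A"
    unfolding A_def[abs_def] by (rule prod[OF sq(1) \<eta>])+
  have B: "B \<in> borel_measurable lebesgue" "integrable lebesgue (\<lambda>x. (B x)\<^sup>2)" "integrable lebesgue B"
    unfolding B_def[abs_def] by (rule prod[OF sq(1) \<theta>])+
  have C: "C \<in> borel_measurable lebesgue" "integrable lebesgue (\<lambda>x. (C x)\<^sup>2)" "integrable lebesgue C"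
    unfolding C_def[abs_def] by (rule prod[OF sq(2) \<eta>])+
  have ABC0: "A x = 0" "B x = 0" "C x = 0" if "x \<notin> interior D" for x
    using that KD K(3) \<theta>0 by (auto simp: A_def B_def C_def)
  note Gi = cuti[OF sq(3)] and G'i = cuti[OF sq(4)]

  have eq0: "kint (mollifier n) A (cut g') + kint (mollifier n) B (cut g) + kint (mollifier n) C (cut g) = 0"
    if n: "1 / real (Suc n) < d" for n
  proof -
    define r where "r = 1 / real (Suc n)"
    define c where "c = integral\<^sup>L lebesgue (bump 0 r :: 'a \<Rightarrow> real)"
    \<comment> \<open>The derivative of \<open>mollifier n\<close> in the direction
      \<open>e\<close>. It is odd, so differentiating the kernel at x - y in \<open>y\<close> gives
      minus its derivative in \<open>x\<close>.\<close>
    define \<sigma> where "\<sigma> z = - 2 * (z \<bullet> e) * flat 2 (r\<^sup>2 - (norm z)\<^sup>2) / c" for z :: 'a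
    have "r > 0" by (simp add: r_def)
    then have "c > 0" unfolding c_def by (rule integral_bump_pos)
    have cancel: "X = Y" if "c * X = c * Y" for X Y :: real using that \<open>c > 0\<close> by simp
    have mol: "mollifier n (x - y) = bump y r x / c" for x y :: 'a
      by (simp add: mollifier_diff r_def c_def)
    have \<sigma>m: "\<sigma> \<in> borel_measurable borel"
    proof -
      have "continuous_on UNIV (\<lambda>z::'a. flat 2 (r\<^sup>2 - (norm z)\<^sup>2))"
        by (intro continuous_on_compose2[OF smooth_on_imp_continuous_on[OF smooth_on_flat[of UNIV 2]]]
            continuous_intros) auto
      then show ?thesis unfolding \<sigma>_def[abs_def] using \<open>c > 0\<close>
        by (intro borel_measurable_continuous_onI continuous_intros) auto
    qed
    have \<sigma>b: "\<bar>\<sigma> z\<bar> \<le> 8 * r / c" for z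
    proof (cases "norm z \<le> r")
      case True
      have "\<bar>z \<bullet> e\<bar> \<le> r" using Basis_le_norm[OF e, of z] True by linarith
      then have "2 * \<bar>z \<bullet> e\<bar> * flat 2 (r\<^sup>2 - (norm z)\<^sup>2) \<le> (2 * r) * 4"
        using \<open>r > 0\<close> by (intro mult_mono flat_2_le) (auto simp: flat_nonneg)
      then show ?thesis using \<open>c > 0\<close> flat_nonneg[of 2 "r\<^sup>2 - (norm z)\<^sup>2"]
        by (simp add: \<sigma>_def abs_mult divide_right_mono)
    next
      case False
      then have "r\<^sup>2 \<le> (norm z)\<^sup>2" using \<open>r > 0\<close> by (intro power_mono) auto
      then show ?thesis using \<open>r > 0\<close> \<open>c > 0\<close> by (simp add: \<sigma>_def flat_eq_0)
    qed
    have pb: "partial [e] (bump y r) x = c * \<sigma> (x - y)" for x y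
      using \<open>c > 0\<close> by (simp only: partial_bump \<sigma>_def) simp
    have \<sigma>odd: "\<sigma> (y - x) = - \<sigma> (x - y)" for x y
      by (simp add: \<sigma>_def norm_minus_commute[of y x] inner_diff_left algebra_simps diff_divide_distrib)
    note rho = mollifier_measurable[of n, where 'a='a] mollifier_bounded[of n, where 'a='a]
    note sig = \<sigma>m \<sigma>b
    have shift: "(\<lambda>x. \<rho> (x - y)) \<in> borel_measurable borel" if "\<rho> \<in> borel_measurable borel"
      for \<rho> :: "'a \<Rightarrow> real" and y using that by measurable
    have kin: "integrable lebesgue (\<lambda>x. mollifier n (x - y) * F x)"
              "integrable lebesgue (\<lambda>x. \<sigma> (x - y) * F x)" if "integrable lebesgue F" for F y
      using integrable_kernel_mult[OF that shift[OF rho(1)] rho(2)]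
        integrable_kernel_mult[OF that shift[OF sig(1)] sig(2)] by blast+
    \<comment> \<open>With \<open>y\<close> frozen, \<open>f\<close> is tested in \<open>x\<close>
      against \<eta> times the bump centred at \<open>y\<close>.\<close>
    have 1: "(\<integral>x. \<sigma> (x - y) * A x \<partial>lebesgue) + (\<integral>x. mollifier n (x - y) * B x \<partial>lebesgue)
        = - (\<integral>x. mollifier n (x - y) * C x \<partial>lebesgue)" for y
    proof -
      define \<psi> where "\<psi> x = \<eta> x * bump y r x" for x
      have \<psi>: "\<psi> \<in> test_functions \<Omega>"
        unfolding \<psi>_def[abs_def] by (rule test_functions_mult[OF \<eta> smooth_bump open_UNIV]) simp
      have d\<psi>: "partial [e] \<psi> x = c * (\<sigma> (x - y) * \<eta> x + mollifier n (x - y) * \<theta> x)" for x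
      proof -
        have "partial [e] \<psi> x = \<eta> x * partial [e] (bump y r) x + \<theta> x * bump y r x"
          unfolding \<psi>_def[abs_def] \<theta>_def
          using frechet_derivative_mult_at[of \<eta> x "bump y r" e]
            smooth_on_differentiable[OF test_functions_smooth[OF \<eta>, of UNIV]]
            smooth_on_differentiable[OF smooth_bump[of UNIV y r]] by simp
        then show ?thesis using \<open>c > 0\<close> unfolding pb mol by (simp add: algebra_simps)
      qed
      have "(\<integral>x. partial [e] \<psi> x * cut f x \<partial>lebesgue) = - (\<integral>x. \<psi> x * cut f' x \<partial>lebesgue)"
        unfolding cut_def
      proof (rule has_weak_derivD[OF f \<psi> D(2)])
        fix x assume "x \<notin> D"
        then have "x \<notin> K" using KD' by blast
        then show "\<psi> x = 0" "partial [e] \<psi> x = 0"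
          unfolding d\<psi> by (simp_all add: \<psi>_def K(3) \<theta>0)
      qed
      moreover have "(\<lambda>x. partial [e] \<psi> x * cut f x) = (\<lambda>x. c * (\<sigma> (x - y) * A x + mollifier n (x - y) * B x))"
        unfolding d\<psi> A_def B_def by (simp add: algebra_simps)
      moreover have "(\<lambda>x. \<psi> x * cut f' x) = (\<lambda>x. c * (mollifier n (x - y) * C x))"
        using \<open>c > 0\<close> by (simp add: \<psi>_def C_def mol fun_eq_iff)
      ultimately have "c * (\<integral>x. \<sigma> (x - y) * A x + mollifier n (x - y) * B x \<partial>lebesgue)
          = c * - (\<integral>x. mollifier n (x - y) * C x \<partial>lebesgue)" by simp
      then have "(\<integral>x. \<sigma> (x - y) * A x + mollifier n (x - y) * B x \<partial>lebesgue)
          = - (\<integral>x. mollifier n (x - y) * C x \<partial>lebesgue)"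
        by (rule cancel)
      then show ?thesis
        using Bochner_Integration.integral_add[OF kin(2)[OF A(3)] kin(1)[OF B(3)]] by simp
    qed
    \<comment> \<open>With \<open>x\<close> frozen, \<open>g\<close> is tested in \<open>y\<close>
      against the bump centred at \<open>x\<close>. For \<open>x\<close> in \<open>K\<close> this
      bump lives in \<open>D\<close>; for other \<open>x\<close> the factor \<open>A x\<close> is
      zero.\<close>
    have 2: "A x * (\<integral>y. \<sigma> (x - y) * cut g y \<partial>lebesgue) = A x * (\<integral>y. mollifier n (x - y) * cut g' y \<partial>lebesgue)" for x
    proof (cases "x \<in> K")
      case True
      have sub: "cball x r \<subseteq> D"
        using D(4)[OF True] n interior_subset[of D] unfolding r_def by (meson order_trans less_imp_le subset_cball)
      have b: "bump x r \<in> test_functions \<Omega>" using sub D(2) \<open>r > 0\<close> by (intro bump_test) auto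
      have b0: "bump x r y = 0" if "y \<notin> cball x r" for y using that \<open>r > 0\<close> by (intro bump_eq_0) auto
      have "(\<integral>y. partial [e] (bump x r) y * cut g y \<partial>lebesgue) = - (\<integral>y. bump x r y * cut g' y \<partial>lebesgue)"
        unfolding cut_def
      proof (rule has_weak_derivD[OF g b D(2)])
        show "bump x r y = 0" if "y \<notin> D" for y using that sub b0 by blast
        show "partial [e] (bump x r) y = 0" if "y \<notin> D" for y
          by (rule partial_eq_0[where K="cball x r"], rule b0) (use that sub e in auto)
      qed
      moreover have "(\<lambda>y. partial [e] (bump x r) y * cut g y) = (\<lambda>y. (- c) * (\<sigma> (x - y) * cut g y))"
        unfolding pb by (simp add: \<sigma>odd[of _ x] mult.assoc)
      moreover have "(\<lambda>y. bump x r y * cut g' y) = (\<lambda>y. c * (mollifier n (x - y) * cut g' y))"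
        using \<open>c > 0\<close> by (simp add: mol bump_sym[of x] fun_eq_iff)
      ultimately have "c * (\<integral>y. \<sigma> (x - y) * cut g y \<partial>lebesgue) = c * (\<integral>y. mollifier n (x - y) * cut g' y \<partial>lebesgue)"
        by simp
      from cancel[OF this] show ?thesis by simp
    qed (simp add: A_def K(3))
    have "kint \<sigma> A (cut g) + kint (mollifier n) B (cut g)
        = (\<integral>y. cut g y * (\<integral>x. \<sigma> (x - y) * A x \<partial>lebesgue) + cut g y * (\<integral>x. mollifier n (x - y) * B x \<partial>lebesgue) \<partial>lebesgue)"
      unfolding kint_snd[OF A(3) Gi sig] kint_snd[OF B(3) Gi rho]
      by (rule Bochner_Integration.integral_add[symmetric, OF kernel_integrable_snd[OF A(3) Gi sig] kernel_integrable_snd[OF B(3) Gi rho]])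
    also have "\<dots> = (\<integral>y. - (cut g y * (\<integral>x. mollifier n (x - y) * C x \<partial>lebesgue)) \<partial>lebesgue)"
      unfolding distrib_left[symmetric] 1 by simp
    also have "\<dots> = - kint (mollifier n) C (cut g)"
      unfolding kint_snd[OF C(3) Gi rho] by simp
    finally have "kint \<sigma> A (cut g) + kint (mollifier n) B (cut g) = - kint (mollifier n) C (cut g)" .
    \<comment> \<open>The kernel \<sigma>, whose bound depends on \<open>n\<close>, is thus removed
      before any limit is taken.\<close>
    moreover have "kint \<sigma> A (cut g) = kint (mollifier n) A (cut g')"
      unfolding kint_fst[OF A(3) Gi sig] kint_fst[OF A(3) G'i rho] 2 ..
    ultimately show ?thesis by simp
  qed
  obtain N where N: "1 / real (Suc N) < d" using \<open>d > 0\<close> nat_approx_posE by blast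
  have "1 / real (Suc n) < d" if "n \<ge> N" for n
    using inverse_Suc_less[OF N that] .
  with eq0 have "(\<lambda>n. kint (mollifier n) A (cut g') + kint (mollifier n) B (cut g) + kint (mollifier n) C (cut g)) \<longlonglongrightarrow> 0"
    by (intro tendsto_eventually) (auto simp: eventually_sequentially)
  moreover have "(\<lambda>n. kint (mollifier n) A (cut g') + kint (mollifier n) B (cut g) + kint (mollifier n) C (cut g))
      \<longlonglongrightarrow> (\<integral>x. A x * cut g' x \<partial>lebesgue) + (\<integral>x. B x * cut g x \<partial>lebesgue) + (\<integral>x. C x * cut g x \<partial>lebesgue)"
    by (intro tendsto_add kint_mollifier_tendsto_L2[OF D(1)] A B C cut sq ABC0 cut0)
  ultimately have "(\<integral>x. A x * cut g' x \<partial>lebesgue) + (\<integral>x. B x * cut g x \<partial>lebesgue) + (\<integral>x. C x * cut g x \<partial>lebesgue) = 0"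
    using LIMSEQ_unique by blast
  moreover have "integrable lebesgue (\<lambda>x. A x * cut g' x)" "integrable lebesgue (\<lambda>x. C x * cut g x)"
    by (intro square_integrable_product A C cut sq)+
  ultimately have *: "(\<integral>x. B x * cut g x \<partial>lebesgue) = - (\<integral>x. A x * cut g' x + C x * cut g x \<partial>lebesgue)"
    by simp
  have "indicator \<Omega> x *\<^sub>R (\<theta> x * (f x * g x)) = B x * cut g x \<and>
       indicator \<Omega> x *\<^sub>R (\<eta> x * (f x * g' x + f' x * g x)) = A x * cut g' x + C x * cut g x" for x
  proof (cases "x \<in> D")
    case True
    then have "x \<in> \<Omega>" using D(2) by blast
    with True show ?thesis by (simp add: A_def B_def C_def cut_def algebra_simps)
  next
    case False
    then have "x \<notin> K" using KD' by blast
    then show ?thesis by (simp add: A_def B_def C_def K(3) \<theta>0)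
  qed
  then show ?thesis using * unfolding set_lebesgue_integral_def \<theta>_def[symmetric] by presburger
qed

section \<open>Calculus of weak derivatives\<close>

lemma set_integrable_test:
  fixes g :: "'a::euclidean_space \<Rightarrow> 'b::{banach, second_countable_topology}"
  assumes "\<phi> \<in> test_functions \<Omega>" "locally_integrable \<Omega> g"
  shows "set_integrable lebesgue \<Omega> (\<lambda>x. \<phi> x *\<^sub>R g x)"
proof -
  obtain K where K: "compact K" "K \<subseteq> \<Omega>" "\<And>x. x \<notin> K \<Longrightarrow> \<phi> x = 0"
    using test_functionsE[OF assms(1)] by metis
  obtain B where B: "\<And>x. \<bar>\<phi> x\<bar> \<le> B" using test_functions_bounded[OF assms(1)] by metis
  have g: "integrable lebesgue (\<lambda>x. indicator K x *\<^sub>R g x)"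
    using assms(2) K by (auto simp: locally_integrable_def set_integrable_def)
  have eq: "indicator \<Omega> x *\<^sub>R (\<phi> x *\<^sub>R g x) = \<phi> x *\<^sub>R (indicator K x *\<^sub>R g x)" for x
    using K(2,3) by (cases "x \<in> K") auto
  have le: "\<bar>\<phi> x\<bar> \<le> \<bar>B\<bar>" for x using B[of x] by linarith
  show ?thesis
    unfolding set_integrable_def eq
  proof (rule Bochner_Integration.integrable_bound[OF integrable_scaleR_right[OF g, of B]])
    show "(\<lambda>x. \<phi> x *\<^sub>R (indicator K x *\<^sub>R g x)) \<in> borel_measurable lebesgue"
      by (rule borel_measurable_scaleR[OF test_functions_measurable[OF assms(1)] borel_measurable_integrable[OF g]])
    show "AE x in lebesgue. norm (\<phi> x *\<^sub>R (indicator K x *\<^sub>R g x)) \<le> norm (B *\<^sub>R (indicator K x *\<^sub>R g x))"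
    proof (intro AE_I2)
      fix x show "norm (\<phi> x *\<^sub>R (indicator K x *\<^sub>R g x)) \<le> norm (B *\<^sub>R (indicator K x *\<^sub>R g x))"
        using mult_right_mono[OF le[of x] norm_ge_zero[of "indicator K x *\<^sub>R g x"]]
        unfolding norm_scaleR[of _ "indicator K x *\<^sub>R g x"] .
    qed
  qed
qed

lemma has_weak_derivI:
  assumes "locally_integrable \<Omega> f" "locally_integrable \<Omega> g"
    and "\<And>\<phi>. \<phi> \<in> test_functions \<Omega> \<Longrightarrow> (LINT x:\<Omega>|lebesgue. partial es \<phi> x *\<^sub>R f x) =
        (-1) ^ length es *\<^sub>R (LINT x:\<Omega>|lebesgue. \<phi> x *\<^sub>R g x)"
  shows "has_weak_deriv \<Omega> es f g"
  using assms by (simp add: has_weak_deriv_def)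

lemma has_weak_deriv_locally_integrable:
  assumes "has_weak_deriv \<Omega> es f g"
  shows "locally_integrable \<Omega> f" "locally_integrable \<Omega> g"
  using assms by (simp_all add: has_weak_deriv_def)

lemma has_weak_deriv_eq:
  assumes "has_weak_deriv \<Omega> es f g" "\<phi> \<in> test_functions \<Omega>"
  shows "(LINT x:\<Omega>|lebesgue. partial es \<phi> x *\<^sub>R f x) =
        (-1) ^ length es *\<^sub>R (LINT x:\<Omega>|lebesgue. \<phi> x *\<^sub>R g x)"
  using assms unfolding has_weak_deriv_def by blast

lemma locally_integrable_bounded_linear:
  assumes "bounded_linear T" "locally_integrable \<Omega> f"
  shows "locally_integrable \<Omega> (\<lambda>x. T (f x))"
proof -
  interpret T: bounded_linear T by fact
  show ?thesis
    using assms(2) integrable_bounded_linear[OF assms(1), of lebesgue]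
    by (auto simp: locally_integrable_def set_integrable_def T.scaleR[symmetric] simp del: T.scaleR)
qed

lemma locally_integrable_add:
  assumes "locally_integrable \<Omega> f" "locally_integrable \<Omega> g"
  shows "locally_integrable \<Omega> (\<lambda>x. f x + g x)"
  using assms by (auto simp: locally_integrable_def intro: set_integral_add(1))

lemma has_weak_deriv_bounded_linear:
  fixes f :: "'a::euclidean_space \<Rightarrow> 'b::{banach, second_countable_topology}"
    and T :: "'b \<Rightarrow> 'c::{banach, second_countable_topology}"
  assumes T: "bounded_linear T" and f: "has_weak_deriv \<Omega> es f g" and es: "set es \<subseteq> Basis"
  shows "has_weak_deriv \<Omega> es (\<lambda>x. T (f x)) (\<lambda>x. T (g x))"
proof -
  interpret T: bounded_linear T by fact
  note loc = has_weak_deriv_locally_integrable[OF f]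
  have T_int: "(LINT x:\<Omega>|lebesgue. \<phi> x *\<^sub>R T (h x)) = T (LINT x:\<Omega>|lebesgue. \<phi> x *\<^sub>R h x)"
    if "\<phi> \<in> test_functions \<Omega>" "locally_integrable \<Omega> h" for \<phi> h
    using integral_bounded_linear[OF T set_integrable_test[OF that, unfolded set_integrable_def]]
    by (simp add: set_lebesgue_integral_def T.scaleR)
  show ?thesis
  proof (rule has_weak_derivI)
    fix \<phi> assume \<phi>: "\<phi> \<in> test_functions \<Omega>"
    show "(LINT x:\<Omega>|lebesgue. partial es \<phi> x *\<^sub>R T (f x)) =
        (-1) ^ length es *\<^sub>R (LINT x:\<Omega>|lebesgue. \<phi> x *\<^sub>R T (g x))"
      unfolding T_int[OF \<phi> loc(2)] T_int[OF test_functions_partial[OF \<phi> es] loc(1)]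
        has_weak_deriv_eq[OF f \<phi>] T.scaleR ..
  qed (use locally_integrable_bounded_linear[OF T] loc in auto)
qed

lemma has_weak_deriv_add:
  fixes f1 f2 :: "'a::euclidean_space \<Rightarrow> 'b::{banach, second_countable_topology}"
  assumes f1: "has_weak_deriv \<Omega> es f1 g1" and f2: "has_weak_deriv \<Omega> es f2 g2" and es: "set es \<subseteq> Basis"
  shows "has_weak_deriv \<Omega> es (\<lambda>x. f1 x + f2 x) (\<lambda>x. g1 x + g2 x)"
proof -
  note l1 = has_weak_deriv_locally_integrable[OF f1] and l2 = has_weak_deriv_locally_integrable[OF f2]
  have add: "(LINT x:\<Omega>|lebesgue. \<phi> x *\<^sub>R (h1 x + h2 x))
        = (LINT x:\<Omega>|lebesgue. \<phi> x *\<^sub>R h1 x) + (LINT x:\<Omega>|lebesgue. \<phi> x *\<^sub>R h2 x)"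
    if "\<phi> \<in> test_functions \<Omega>" "locally_integrable \<Omega> h1" "locally_integrable \<Omega> h2"
    for \<phi> and h1 h2 :: "'a \<Rightarrow> 'b"
    unfolding scaleR_add_right
    by (rule set_integral_add(2)[OF set_integrable_test[OF that(1,2)] set_integrable_test[OF that(1,3)]])
  show ?thesis
  proof (rule has_weak_derivI)
    fix \<phi> assume \<phi>: "\<phi> \<in> test_functions \<Omega>"
    show "(LINT x:\<Omega>|lebesgue. partial es \<phi> x *\<^sub>R (f1 x + f2 x)) =
        (-1) ^ length es *\<^sub>R (LINT x:\<Omega>|lebesgue. \<phi> x *\<^sub>R (g1 x + g2 x))"
      unfolding add[OF \<phi> l1(2) l2(2)] add[OF test_functions_partial[OF \<phi> es] l1(1) l2(1)]
        has_weak_deriv_eq[OF f1 \<phi>] has_weak_deriv_eq[OF f2 \<phi>] by (simp only: scaleR_add_right)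
  qed (intro locally_integrable_add l1 l2)+
qed

text \<open>In the nested operator \<open>dz\<close> the inner weak derivative is a chosen
  representative, known only almost everywhere; this lemma lets an explicit representative replace
  it under a further derivative.\<close>

lemma has_weak_deriv_AE_cong:
  fixes f f' :: "'a::euclidean_space \<Rightarrow> 'b::{banach, second_countable_topology}"
  assumes f: "has_weak_deriv \<Omega> es f g" and es: "set es \<subseteq> Basis"
    and ae: "AE x in lebesgue. x \<in> \<Omega> \<longrightarrow> f x = f' x" and f': "locally_integrable \<Omega> f'"
  shows "has_weak_deriv \<Omega> es f' g"
proof -
  note loc = has_weak_deriv_locally_integrable[OF f]
  show ?thesis
  proof (rule has_weak_derivI[OF f' loc(2)])
    fix \<phi> assume \<phi>: "\<phi> \<in> test_functions \<Omega>"
    note d = test_functions_partial[OF \<phi> es]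
    have "(LINT x:\<Omega>|lebesgue. partial es \<phi> x *\<^sub>R f' x) = (LINT x:\<Omega>|lebesgue. partial es \<phi> x *\<^sub>R f x)"
      unfolding set_lebesgue_integral_def
    proof (rule integral_cong_AE)
      show "AE x in lebesgue. indicator \<Omega> x *\<^sub>R (partial es \<phi> x *\<^sub>R f' x) = indicator \<Omega> x *\<^sub>R (partial es \<phi> x *\<^sub>R f x)"
        using ae by eventually_elim (auto simp: indicator_def)
    qed (use set_integrable_test[OF d f'] set_integrable_test[OF d loc(1)] in
         \<open>auto simp: set_integrable_def dest: borel_measurable_integrable\<close>)
    then show "(LINT x:\<Omega>|lebesgue. partial es \<phi> x *\<^sub>R f' x) =
        (-1) ^ length es *\<^sub>R (LINT x:\<Omega>|lebesgue. \<phi> x *\<^sub>R g x)"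
      using has_weak_deriv_eq[OF f \<phi>] by simp
  qed
qed

text \<open>Componentwise, the difference of two weak derivatives is a weak derivative of zero,
  hence orthogonal to every bump.\<close>

lemma has_weak_deriv_unique:
  fixes f :: "'a::euclidean_space \<Rightarrow> 'b::euclidean_space"
  assumes "open \<Omega>" "set es \<subseteq> Basis" and g: "has_weak_deriv \<Omega> es f g" and h: "has_weak_deriv \<Omega> es f h"
  shows "AE x in lebesgue. x \<in> \<Omega> \<longrightarrow> g x = h x"
proof -
  have "AE x in lebesgue. x \<in> \<Omega> \<longrightarrow> (g x \<bullet> b + - (h x \<bullet> b)) = 0" if "b \<in> Basis" for b
  proof -
    have bl: "bounded_linear (\<lambda>y::'b. y \<bullet> b)" "bounded_linear (\<lambda>y::'b. - (y \<bullet> b))"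
      by (intro bounded_linear_inner_left bounded_linear_minus)+
    have "has_weak_deriv \<Omega> es (\<lambda>x. f x \<bullet> b + - (f x \<bullet> b)) (\<lambda>x. g x \<bullet> b + - (h x \<bullet> b))"
      by (intro has_weak_deriv_add has_weak_deriv_bounded_linear[OF bl(1) g]
          has_weak_deriv_bounded_linear[OF bl(2) h] assms)
    then have 0: "has_weak_deriv \<Omega> es (\<lambda>x. 0) (\<lambda>x. g x \<bullet> b + - (h x \<bullet> b))" by simp
    show ?thesis
    proof (rule weak_deriv_fundamental[OF assms(1) has_weak_deriv_locally_integrable(2)[OF 0]])
      fix c :: 'a and r :: real assume "r > 0" "cball c r \<subseteq> \<Omega>"
      then have "bump c r \<in> test_functions \<Omega>" by (intro bump_test) auto
      from has_weak_deriv_eq[OF 0 this]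
      show "(LINT x:\<Omega>|lebesgue. bump c r x *\<^sub>R (g x \<bullet> b + - (h x \<bullet> b))) = 0"
        by (simp add: set_lebesgue_integral_def)
    qed
  qed
  then have "AE x in lebesgue. \<forall>b\<in>Basis. x \<in> \<Omega> \<longrightarrow> g x \<bullet> b + - (h x \<bullet> b) = 0"
    by (intro AE_ball_countable[THEN iffD2]) (auto intro: countable_finite)
  then show ?thesis by (rule eventually_mono) (auto intro: euclidean_eqI)
qed

lemma has_weak_deriv_weak_deriv: "has_weak_deriv \<Omega> es f g \<Longrightarrow> has_weak_deriv \<Omega> es f (weak_deriv \<Omega> es f)"
  unfolding weak_deriv_def by (rule someI[of "has_weak_deriv \<Omega> es f"])

lemma weak_deriv_AE_eq:
  fixes f :: "'a::euclidean_space \<Rightarrow> 'b::euclidean_space"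
  assumes "open \<Omega>" "set es \<subseteq> Basis" "has_weak_deriv \<Omega> es f g"
  shows "AE x in lebesgue. x \<in> \<Omega> \<longrightarrow> weak_deriv \<Omega> es f x = g x"
  by (rule has_weak_deriv_unique[OF assms(1,2) has_weak_deriv_weak_deriv[OF assms(3)] assms(3)])

text \<open>\<open>partial [a, d] \<phi>\<close> is the \<open>a\<close>-derivative of the test
  function \<open>partial [d] \<phi>\<close>, so the defining equation of \<open>h\<close> can be
  tested with the latter. In this way the second derivatives supplied by \<open>sobolev2\<close>
  become first derivatives of first derivatives, the form that the product rule takes.\<close>

lemma has_weak_deriv_iterate:
  fixes f :: "'a::euclidean_space \<Rightarrow> 'b::{banach, second_countable_topology}"
  assumes h: "has_weak_deriv \<Omega> [a] f h" and g: "has_weak_deriv \<Omega> [a, d] f g" and d: "d \<in> Basis"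
  shows "has_weak_deriv \<Omega> [d] h g"
proof (rule has_weak_derivI)
  fix \<phi> assume \<phi>: "\<phi> \<in> test_functions \<Omega>"
  have "partial [d] \<phi> \<in> test_functions \<Omega>" using d by (intro test_functions_partial[OF \<phi>]) simp
  from has_weak_deriv_eq[OF h this] has_weak_deriv_eq[OF g \<phi>]
  have "- (LINT x:\<Omega>|lebesgue. partial [d] \<phi> x *\<^sub>R h x) = (LINT x:\<Omega>|lebesgue. \<phi> x *\<^sub>R g x)"
    by simp
  from this[symmetric]
  show "(LINT x:\<Omega>|lebesgue. partial [d] \<phi> x *\<^sub>R h x) = (-1) ^ length [d] *\<^sub>R (LINT x:\<Omega>|lebesgue. \<phi> x *\<^sub>R g x)"
    by simp
qed (use has_weak_deriv_locally_integrable[OF h] has_weak_deriv_locally_integrable[OF g] in auto)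

text \<open>Against a bump both functions give the integral of \<open>f\<close> times the same
  second derivative of the bump.\<close>

lemma has_weak_deriv_commute:
  fixes f :: "'a::euclidean_space \<Rightarrow> real"
  assumes "open \<Omega>" and g: "has_weak_deriv \<Omega> [a, d] f g" and h: "has_weak_deriv \<Omega> [d, a] f h"
  shows "AE x in lebesgue. x \<in> \<Omega> \<longrightarrow> g x = h x"
proof -
  note lg = has_weak_deriv_locally_integrable(2)[OF g] and lh = has_weak_deriv_locally_integrable(2)[OF h]
  have lh': "locally_integrable \<Omega> (\<lambda>x. - h x)"
    using locally_integrable_bounded_linear[OF bounded_linear_minus[OF bounded_linear_ident] lh] .
  have "AE x in lebesgue. x \<in> \<Omega> \<longrightarrow> g x + - h x = 0"
  proof (rule weak_deriv_fundamental[OF assms(1) locally_integrable_add[OF lg lh']])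
    fix c :: 'a and r :: real assume "r > 0" "cball c r \<subseteq> \<Omega>"
    then have b: "bump c r \<in> test_functions \<Omega>" by (intro bump_test) auto
    have "(LINT x:\<Omega>|lebesgue. bump c r x *\<^sub>R (g x + - h x))
        = (LINT x:\<Omega>|lebesgue. bump c r x *\<^sub>R g x) + (LINT x:\<Omega>|lebesgue. bump c r x *\<^sub>R - h x)"
      unfolding scaleR_add_right
      by (rule set_integral_add(2)[OF set_integrable_test[OF b lg] set_integrable_test[OF b lh']])
    also have "(LINT x:\<Omega>|lebesgue. bump c r x *\<^sub>R - h x) = - (LINT x:\<Omega>|lebesgue. bump c r x *\<^sub>R h x)"
      by (simp add: set_lebesgue_integral_def)
    also have "(LINT x:\<Omega>|lebesgue. bump c r x *\<^sub>R g x) = (LINT x:\<Omega>|lebesgue. bump c r x *\<^sub>R h x)"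
      using has_weak_deriv_eq[OF g b] has_weak_deriv_eq[OF h b] partial_bump_commute[of a d c r]
      by (simp del: partial.simps)
    finally show "(LINT x:\<Omega>|lebesgue. bump c r x *\<^sub>R (g x + - h x)) = 0" by simp
  qed
  then show ?thesis by (rule eventually_mono) simp
qed

lemma locally_integrable_continuous_mult:
  fixes f c :: "'a::euclidean_space \<Rightarrow> real"
  assumes "continuous_on \<Omega> c" "locally_integrable \<Omega> f"
  shows "locally_integrable \<Omega> (\<lambda>x. c x * f x)"
  unfolding locally_integrable_def
proof (intro allI impI, elim conjE)
  fix K :: "'a set" assume K: "compact K" "K \<subseteq> \<Omega>"
  have c: "continuous_on K c" using assms(1) K(2) by (rule continuous_on_subset)
  then have "bounded (c ` K)" using K(1) compact_continuous_image compact_imp_bounded by blast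
  then obtain B where B: "\<And>x. x \<in> K \<Longrightarrow> \<bar>c x\<bar> \<le> B" unfolding bounded_iff by auto
  have m: "(\<lambda>x. indicator K x *\<^sub>R c x) \<in> borel_measurable lebesgue"
    using borel_measurable_continuous_on_indicator[OF _ c] K(1)
    by (simp add: measurable_completion compact_imp_closed)
  have f: "integrable lebesgue (\<lambda>x. indicator K x *\<^sub>R f x)"
    using assms(2) K by (auto simp: locally_integrable_def set_integrable_def)
  have eq: "indicator K x *\<^sub>R (c x * f x) = (indicator K x *\<^sub>R c x) * (indicator K x *\<^sub>R f x)" for x
    by (simp add: indicator_def)
  show "set_integrable lebesgue K (\<lambda>x. c x * f x)"
    unfolding set_integrable_def eq
  proof (rule Bochner_Integration.integrable_bound[OF integrable_mult_right[OF f, of B]])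
    show "(\<lambda>x. (indicator K x *\<^sub>R c x) * (indicator K x *\<^sub>R f x)) \<in> borel_measurable lebesgue"
      by (rule borel_measurable_times[OF m borel_measurable_integrable[OF f]])
    show "AE x in lebesgue. norm (indicator K x *\<^sub>R c x * indicator K x *\<^sub>R f x) \<le> norm (B * indicator K x *\<^sub>R f x)"
    proof (intro AE_I2)
      fix x
      show "norm (indicator K x *\<^sub>R c x * indicator K x *\<^sub>R f x) \<le> norm (B * indicator K x *\<^sub>R f x)"
      proof (cases "x \<in> K")
        case True
        have "\<bar>c x\<bar> \<le> \<bar>B\<bar>" using B[OF True] by linarith
        then show ?thesis using True by (simp add: abs_mult mult_right_mono)
      qed simp
    qed
  qed
qed

text \<open>The defining equation of f' is tested with \<phi> c, a test function although
  \<open>c\<close> is smooth on \<Omega> only. Unlike in \<open>weak_deriv_product_rule\<close>,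
  local integrability of \<open>f\<close> and f' is enough.\<close>

lemma has_weak_deriv_smooth_mult:
  fixes f c :: "'a::euclidean_space \<Rightarrow> real"
  assumes "open \<Omega>" and e: "e \<in> Basis" and c: "smooth_on \<Omega> c" and f: "has_weak_deriv \<Omega> [e] f f'"
  shows "has_weak_deriv \<Omega> [e] (\<lambda>x. c x * f x) (\<lambda>x. c x * f' x + partial [e] c x * f x)"
proof -
  note loc = has_weak_deriv_locally_integrable[OF f]
  have cont: "continuous_on \<Omega> c" "continuous_on \<Omega> (partial [e] c)"
    using c e by (auto intro!: smooth_on_imp_continuous_on smooth_on_partial simp del: partial.simps)
  note l1 = locally_integrable_continuous_mult[OF cont(1) loc(1)]
    and l2 = locally_integrable_continuous_mult[OF cont(1) loc(2)]
    and l3 = locally_integrable_continuous_mult[OF cont(2) loc(1)]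
  show ?thesis
  proof (rule has_weak_derivI[OF l1 locally_integrable_add[OF l2 l3]])
    fix \<phi> assume \<phi>: "\<phi> \<in> test_functions \<Omega>"
    have \<phi>c: "(\<lambda>x. \<phi> x * c x) \<in> test_functions \<Omega>"
      by (rule test_functions_mult[OF \<phi> c \<open>open \<Omega>\<close>]) simp
    have d\<phi>: "partial [e] \<phi> \<in> test_functions \<Omega>" by (rule test_functions_partial[OF \<phi>]) (use e in auto)
    have eq: "indicator \<Omega> x *\<^sub>R (partial [e] (\<lambda>x. \<phi> x * c x) x *\<^sub>R f x)
        = indicator \<Omega> x *\<^sub>R (\<phi> x *\<^sub>R (partial [e] c x * f x) + partial [e] \<phi> x *\<^sub>R (c x * f x))" for x
    proof (cases "x \<in> \<Omega>")
      case True
      have "partial [e] (\<lambda>x. \<phi> x * c x) x = \<phi> x * partial [e] c x + partial [e] \<phi> x * c x"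
        using frechet_derivative_mult_at[of \<phi> x c e]
          smooth_on_differentiable[OF test_functions_smooth[OF \<phi>, of UNIV]]
          smooth_on_differentiable[OF c True] by simp
      then show ?thesis by (simp add: algebra_simps del: partial.simps)
    qed simp
    have i3: "set_integrable lebesgue \<Omega> (\<lambda>x. \<phi> x *\<^sub>R (partial [e] c x * f x))"
      by (rule set_integrable_test[OF \<phi> l3])
    have i1: "set_integrable lebesgue \<Omega> (\<lambda>x. partial [e] \<phi> x *\<^sub>R (c x * f x))"
      by (rule set_integrable_test[OF d\<phi> l1])
    have i2: "set_integrable lebesgue \<Omega> (\<lambda>x. \<phi> x *\<^sub>R (c x * f' x))"
      by (rule set_integrable_test[OF \<phi> l2])
    have "(LINT x:\<Omega>|lebesgue. partial [e] (\<lambda>x. \<phi> x * c x) x *\<^sub>R f x)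
        = (LINT x:\<Omega>|lebesgue. \<phi> x *\<^sub>R (partial [e] c x * f x)) + (LINT x:\<Omega>|lebesgue. partial [e] \<phi> x *\<^sub>R (c x * f x))"
      using set_integral_add(2)[OF i3 i1] unfolding set_lebesgue_integral_def eq by simp
    moreover have "(LINT x:\<Omega>|lebesgue. partial [e] (\<lambda>x. \<phi> x * c x) x *\<^sub>R f x)
        = - (LINT x:\<Omega>|lebesgue. \<phi> x *\<^sub>R (c x * f' x))"
      using has_weak_deriv_eq[OF f \<phi>c] by (simp add: mult.assoc)
    moreover have "(LINT x:\<Omega>|lebesgue. \<phi> x *\<^sub>R (c x * f' x + partial [e] c x * f x))
        = (LINT x:\<Omega>|lebesgue. \<phi> x *\<^sub>R (c x * f' x)) + (LINT x:\<Omega>|lebesgue. \<phi> x *\<^sub>R (partial [e] c x * f x))"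
      unfolding scaleR_add_right by (rule set_integral_add(2)[OF i2 i3])
    ultimately show "(LINT x:\<Omega>|lebesgue. partial [e] \<phi> x *\<^sub>R (c x * f x))
      = (-1) ^ length [e] *\<^sub>R (LINT x:\<Omega>|lebesgue. \<phi> x *\<^sub>R (c x * f' x + partial [e] c x * f x))"
      by (simp del: partial.simps)
  qed
qed

section \<open>Radial test functions\<close>

lemma open_annulus: "open (annulus a b)"
  unfolding annulus_def by (intro open_Diff) auto

lemma annulus_iff: "x \<in> annulus a b \<longleftrightarrow> a < norm x \<and> norm x < b"
  by (auto simp: annulus_def)

lemma annulus_norm_sq:
  assumes "0 < a" "x \<in> annulus a b"
  shows "a\<^sup>2 < (norm x)\<^sup>2" "(norm x)\<^sup>2 < b\<^sup>2" "x \<noteq> 0"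
  using assms by (auto simp: annulus_iff intro!: power_strict_mono)

lemma square_integrable_indicator:
  fixes f :: "'a::euclidean_space \<Rightarrow> real"
  assumes "square_integrable \<Omega> f"
  shows "(\<lambda>x. indicator \<Omega> x *\<^sub>R f x) \<in> borel_measurable lebesgue"
    "integrable lebesgue (\<lambda>x. (indicator \<Omega> x *\<^sub>R f x)\<^sup>2)"
proof -
  have "(indicator \<Omega> x *\<^sub>R f x)\<^sup>2 = indicator \<Omega> x *\<^sub>R (norm (f x))\<^sup>2" for x
    by (cases "x \<in> \<Omega>") auto
  with assms show "(\<lambda>x. indicator \<Omega> x *\<^sub>R f x) \<in> borel_measurable lebesgue"
    "integrable lebesgue (\<lambda>x. (indicator \<Omega> x *\<^sub>R f x)\<^sup>2)"
    unfolding square_integrable_def set_borel_measurable_def set_integrable_def by presburger+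
qed

lemma weighted_integrable:
  fixes f g w :: "'a::euclidean_space \<Rightarrow> real"
  assumes f: "square_integrable \<Omega> f" and g: "square_integrable \<Omega> g"
    and w: "w \<in> borel_measurable borel" "\<And>x. x \<in> \<Omega> \<Longrightarrow> \<bar>w x\<bar> \<le> B"
  shows "set_integrable lebesgue \<Omega> (\<lambda>x. w x * (f x * g x))"
proof -
  have f': "(\<lambda>x. indicator \<Omega> x *\<^sub>R f x) \<in> borel_measurable lebesgue"
    "integrable lebesgue (\<lambda>x. (indicator \<Omega> x *\<^sub>R f x)\<^sup>2)"
    by (rule square_integrable_indicator[OF f])+
  have g': "(\<lambda>x. indicator \<Omega> x *\<^sub>R g x) \<in> borel_measurable lebesgue"
    "integrable lebesgue (\<lambda>x. (indicator \<Omega> x *\<^sub>R g x)\<^sup>2)"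
    by (rule square_integrable_indicator[OF g])+
  have fg: "integrable lebesgue (\<lambda>x. (indicator \<Omega> x *\<^sub>R f x) * (indicator \<Omega> x *\<^sub>R g x))"
    by (rule square_integrable_product[OF f'(1) g'(1) f'(2) g'(2)])
  have wm: "w \<in> borel_measurable lebesgue" using w(1) by (simp add: measurable_completion)
  have eq: "indicator \<Omega> x *\<^sub>R (w x * (f x * g x)) = w x * ((indicator \<Omega> x *\<^sub>R f x) * (indicator \<Omega> x *\<^sub>R g x))" for x
    by (simp add: indicator_def)
  show ?thesis
    unfolding set_integrable_def eq
  proof (rule Bochner_Integration.integrable_bound[OF integrable_mult_right[OF fg, of B]])
    show "(\<lambda>x. w x * ((indicator \<Omega> x *\<^sub>R f x) * (indicator \<Omega> x *\<^sub>R g x))) \<in> borel_measurable lebesgue"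
      by (rule borel_measurable_times[OF wm borel_measurable_integrable[OF fg]])
    show "AE x in lebesgue. norm (w x * ((indicator \<Omega> x *\<^sub>R f x) * (indicator \<Omega> x *\<^sub>R g x)))
        \<le> norm (B * ((indicator \<Omega> x *\<^sub>R f x) * (indicator \<Omega> x *\<^sub>R g x)))"
    proof (intro AE_I2)
      fix x
      show "norm (w x * ((indicator \<Omega> x *\<^sub>R f x) * (indicator \<Omega> x *\<^sub>R g x)))
        \<le> norm (B * ((indicator \<Omega> x *\<^sub>R f x) * (indicator \<Omega> x *\<^sub>R g x)))"
      proof (cases "x \<in> \<Omega>")
        case True
        have "\<bar>w x\<bar> \<le> \<bar>B\<bar>" using w(2)[OF True] by linarith
        then show ?thesis using True by (simp add: abs_mult mult_right_mono)
      qed simp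
    qed
  qed
qed

lemma smooth_on_powr_norm: "smooth_on (- {0}) (\<lambda>x::complex. (norm x)\<^sup>2 powr p)"
  by (rule smooth_on_compose[OF _ smooth_on_powr smooth_on_norm_sq]) auto

lemma powr_norm_bounded:
  assumes "0 < a"
  obtains B where "\<And>x. x \<in> annulus a b \<Longrightarrow> \<bar>(norm x)\<^sup>2 powr p\<bar> \<le> B"
proof -
  let ?K = "cball 0 b - ball 0 a :: complex set"
  have "compact ?K" by (intro compact_diff) auto
  moreover have "continuous_on ?K (\<lambda>x. (norm x)\<^sup>2 powr p)"
    using assms by (intro continuous_on_subset[OF smooth_on_imp_continuous_on[OF smooth_on_powr_norm]]) auto
  ultimately have "bounded ((\<lambda>x. (norm x)\<^sup>2 powr p) ` ?K)"
    using compact_continuous_image compact_imp_bounded by blast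
  then obtain B where "\<forall>y\<in>(\<lambda>x. (norm x)\<^sup>2 powr p) ` ?K. norm y \<le> B" unfolding bounded_iff by blast
  then have B: "\<bar>(norm x)\<^sup>2 powr p\<bar> \<le> B" if "x \<in> ?K" for x using that by simp
  have "\<bar>(norm x)\<^sup>2 powr p\<bar> \<le> B" if "x \<in> annulus a b" for x
    using that by (intro B) (auto simp: annulus_iff)
  then show ?thesis by (rule that)
qed

lemma frechet_derivative_norm_sq:
  "frechet_derivative (\<lambda>x::'a::euclidean_space. (norm x)\<^sup>2) (at x) e = 2 * (x \<bullet> e)"
proof -
  have "((\<lambda>x::'a. (norm x)\<^sup>2) has_derivative (\<lambda>h. 2 * (x \<bullet> h))) (at x)"
    unfolding power2_norm_eq_inner by (auto intro!: derivative_eq_intros simp: inner_commute)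
  from frechet_derivative_at[OF this] show ?thesis by metis
qed

lemma partial_radial:
  fixes x :: "'a::euclidean_space"
  assumes "(H has_real_derivative h) (at ((norm x)\<^sup>2))"
  shows "(\<lambda>x. H ((norm x)\<^sup>2)) differentiable (at x)"
    and "partial [e] (\<lambda>x. H ((norm x)\<^sup>2)) x = h * (2 * (x \<bullet> e))"
    and "partial [e] (\<lambda>x. (x \<bullet> e') * H ((norm x)\<^sup>2)) x = (x \<bullet> e') * (h * (2 * (x \<bullet> e))) + (e \<bullet> e') * H ((norm x)\<^sup>2)"
proof -
  have n: "(\<lambda>x::'a. (norm x)\<^sup>2) differentiable (at x)"
    using smooth_on_differentiable[OF smooth_on_norm_sq[of UNIV]] by simp
  have H: "H differentiable (at ((norm x)\<^sup>2))"
    using assms by (auto simp: real_differentiable_def)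
  show d: "(\<lambda>x. H ((norm x)\<^sup>2)) differentiable (at x)"
    by (rule frechet_derivative_compose_real(1)[OF n H])
  show p: "partial [e] (\<lambda>x. H ((norm x)\<^sup>2)) x = h * (2 * (x \<bullet> e))"
    using frechet_derivative_compose_real(2)[OF n H, of e] frechet_derivative_DERIV[OF assms]
    by (simp add: frechet_derivative_norm_sq)
  have i: "(\<lambda>x. x \<bullet> e') differentiable (at x)"
    using smooth_on_differentiable[OF smooth_on_inner[of UNIV e']] by simp
  show "partial [e] (\<lambda>x. (x \<bullet> e') * H ((norm x)\<^sup>2)) x = (x \<bullet> e') * (h * (2 * (x \<bullet> e))) + (e \<bullet> e') * H ((norm x)\<^sup>2)"
    using frechet_derivative_mult_at[OF i d, of e] p
    by (simp add: frechet_derivative_inner_left_at)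
qed

lemma radial_test:
  fixes H :: "real \<Rightarrow> real"
  assumes "0 < a" "smooth_on {0<..} H" "\<And>t. t \<notin> {p..q} \<Longrightarrow> H t = 0" "a\<^sup>2 < p" "q < b\<^sup>2" "0 < b"
  shows "(\<lambda>x. H ((norm x)\<^sup>2)) \<in> test_functions (annulus a b)"
    and "(\<lambda>x. (x \<bullet> e) * H ((norm x)\<^sup>2)) \<in> test_functions (annulus a b)"
proof -
  let ?K = "{x::complex. p \<le> (norm x)\<^sup>2 \<and> (norm x)\<^sup>2 \<le> q}"
  have sub: "?K \<subseteq> annulus a b"
  proof
    fix x :: complex assume "x \<in> ?K"
    then have "a\<^sup>2 < (norm x)\<^sup>2" "(norm x)\<^sup>2 < b\<^sup>2" using assms by auto
    then have "a < norm x" "norm x < b" using assms by (auto intro: power2_less_imp_less)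
    then show "x \<in> annulus a b" by (simp add: annulus_iff)
  qed
  have "closed ?K" by (intro closed_Collect_conj closed_Collect_le continuous_intros)
  moreover have "bounded ?K"
    using bounded_subset[OF bounded_ball[of 0 b]] sub by (auto simp: annulus_def)
  ultimately have K: "compact ?K" by (simp add: compact_eq_bounded_closed)
  have K0: "?K \<subseteq> - {0}" using sub annulus_norm_sq(3)[OF assms(1)] by blast
  have s: "smooth_on (- {0}) (\<lambda>x::complex. H ((norm x)\<^sup>2))"
    by (rule smooth_on_compose[OF _ assms(2) smooth_on_norm_sq]) auto
  have s2: "smooth_on (- {0}) (\<lambda>x::complex. (x \<bullet> e) * H ((norm x)\<^sup>2))"
    by (rule smooth_on_mult[OF _ smooth_on_inner s]) auto
  have z: "H ((norm x)\<^sup>2) = 0" if "x \<notin> ?K" for x :: complex using that by (intro assms(3)) auto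
  show "(\<lambda>x. H ((norm x)\<^sup>2)) \<in> test_functions (annulus a b)"
    by (rule test_functionsI[OF _ s K K0 sub z]) auto
  show "(\<lambda>x. (x \<bullet> e) * H ((norm x)\<^sup>2)) \<in> test_functions (annulus a b)"
    by (rule test_functionsI[OF _ s2 K K0 sub]) (use z in auto)
qed

lemma inner_Basis_complex_sum: "(\<Sum>e\<in>Basis. (x \<bullet> e)\<^sup>2) = (norm (x::complex))\<^sup>2"
  by (simp add: Basis_complex_def cmod_def inner_complex_def)

text \<open>Pairing \<open>f\<^sup>2\<close> with the divergence of the radial vector field \<open>H(|x|\<^sup>2) x\<close>.\<close>

lemma radial_divergence_identity:
  fixes f :: "complex \<Rightarrow> real" and F :: "complex \<Rightarrow> complex \<Rightarrow> real"
  assumes ab: "0 < a" "0 < b" and H: "smooth_on {0<..} H" "\<And>t. t \<notin> {p..q} \<Longrightarrow> H t = 0" "a\<^sup>2 < p" "q < b\<^sup>2"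
    and H': "\<And>t. t > 0 \<Longrightarrow> (H has_real_derivative H' t) (at t)"
    and f: "square_integrable (annulus a b) f" "\<And>e. e \<in> Basis \<Longrightarrow> square_integrable (annulus a b) (F e)"
    and F: "\<And>e. e \<in> Basis \<Longrightarrow> has_weak_deriv (annulus a b) [e] f (F e)"
  shows "set_integrable lebesgue (annulus a b)
       (\<lambda>x. - (H ((norm x)\<^sup>2) + (norm x)\<^sup>2 * H' ((norm x)\<^sup>2)) * (f x)\<^sup>2 - H ((norm x)\<^sup>2) * (f x * (\<Sum>e\<in>Basis. (x \<bullet> e) * F e x)))"
    and "(LINT x:annulus a b|lebesgue.
       - (H ((norm x)\<^sup>2) + (norm x)\<^sup>2 * H' ((norm x)\<^sup>2)) * (f x)\<^sup>2 - H ((norm x)\<^sup>2) * (f x * (\<Sum>e\<in>Basis. (x \<bullet> e) * F e x))) = 0"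
proof -
  let ?O = "annulus a b"
  define \<eta> where "\<eta> e x = (x \<bullet> e) * H ((norm x)\<^sup>2)" for e x :: complex
  have \<eta>: "\<eta> e \<in> test_functions ?O" for e
    unfolding \<eta>_def[abs_def] by (rule radial_test(2)[OF ab(1) H(1,2,3,4) ab(2)])
  have d\<eta>: "partial [e] (\<eta> e) \<in> test_functions ?O" if "e \<in> Basis" for e
    by (rule test_functions_partial[OF \<eta>]) (use that in auto)
  define g where "g e x = - partial [e] (\<eta> e) x * (f x * f x) - 2 * \<eta> e x * (f x * F e x)" for e x
  have int: "set_integrable lebesgue ?O (\<lambda>x. \<phi> x * (h1 x * h2 x))"
    if \<phi>: "\<phi> \<in> test_functions ?O" and h: "square_integrable ?O h1" "square_integrable ?O h2" for \<phi> h1 h2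
  proof -
    obtain B where "\<And>x. \<bar>\<phi> x\<bar> \<le> B" using test_functions_bounded[OF \<phi>] by metis
    then show ?thesis using weighted_integrable[OF h test_functions_borel[OF \<phi>]] by blast
  qed
  have g: "set_integrable lebesgue ?O (g e)" "(LINT x:?O|lebesgue. g e x) = 0" if e: "e \<in> Basis" for e
  proof -
    note i1 = int[OF d\<eta>[OF e] f(1) f(1)] and i2 = int[OF \<eta>[of e] f(1) f(2)[OF e]]
    have geq: "g e = (\<lambda>x. - (partial [e] (\<eta> e) x * (f x * f x)) - 2 * (\<eta> e x * (f x * F e x)))"
      by (simp add: g_def fun_eq_iff)
    have i1': "set_integrable lebesgue ?O (\<lambda>x. - (partial [e] (\<eta> e) x * (f x * f x)))"
      and i2': "set_integrable lebesgue ?O (\<lambda>x. 2 * (\<eta> e x * (f x * F e x)))"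
      using i1 set_integrable_mult_right[OF i2, of 2] by (simp_all add: set_integrable_def)
    show "set_integrable lebesgue ?O (g e)"
      unfolding geq by (rule set_integral_diff(1)[OF i1' i2'])
    have "(LINT x:?O|lebesgue. partial [e] (\<eta> e) x * (f x * f x))
        = - (LINT x:?O|lebesgue. \<eta> e x * (f x * F e x + F e x * f x))"
      by (rule weak_deriv_product_rule[OF open_annulus e \<eta> F[OF e] F[OF e] f(1) f(2)[OF e] f(1) f(2)[OF e]])
    also have "(\<lambda>x. \<eta> e x * (f x * F e x + F e x * f x)) = (\<lambda>x. 2 * (\<eta> e x * (f x * F e x)))"
      by (simp add: fun_eq_iff algebra_simps)
    finally have "(LINT x:?O|lebesgue. partial [e] (\<eta> e) x * (f x * f x)) = - (LINT x:?O|lebesgue. 2 * (\<eta> e x * (f x * F e x)))" .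
    then show "(LINT x:?O|lebesgue. g e x) = 0"
      unfolding geq set_integral_diff(2)[OF i1' i2'] by (simp add: set_lebesgue_integral_def del: partial.simps)
  qed
  \<comment> \<open>In two dimensions the divergence of H(|x|^2) x is 2 H + 2 |x|^2 H', and
    differentiating f^2 also gives a factor 2. The common factor is divided out at the end.\<close>
  have sum: "indicator ?O x *\<^sub>R (g 1 x + g \<i> x) = indicator ?O x *\<^sub>R (2 *
    (- (H ((norm x)\<^sup>2) + (norm x)\<^sup>2 * H' ((norm x)\<^sup>2)) * (f x)\<^sup>2 - H ((norm x)\<^sup>2) * (f x * (\<Sum>e\<in>Basis. (x \<bullet> e) * F e x))))" for x
  proof (cases "x \<in> ?O")
    case True
    then have "(norm x)\<^sup>2 > 0" using ab by (auto simp: annulus_iff)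
    then have p: "partial [e] (\<eta> e') x = (x \<bullet> e') * (H' ((norm x)\<^sup>2) * (2 * (x \<bullet> e))) + (e \<bullet> e') * H ((norm x)\<^sup>2)" for e e'
      unfolding \<eta>_def[abs_def] by (intro partial_radial(3) H')
    have n: "(norm x)\<^sup>2 = (x \<bullet> 1) * (x \<bullet> 1) + (x \<bullet> \<i>) * (x \<bullet> \<i>)"
      using inner_Basis_complex_sum[of x] by (simp add: Basis_complex_def power2_eq_square)
    have "g 1 x + g \<i> x = 2 *
      (- (H ((norm x)\<^sup>2) + ((x \<bullet> 1) * (x \<bullet> 1) + (x \<bullet> \<i>) * (x \<bullet> \<i>)) * H' ((norm x)\<^sup>2)) * (f x)\<^sup>2 - H ((norm x)\<^sup>2) * (f x * (\<Sum>e\<in>Basis. (x \<bullet> e) * F e x)))"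
      unfolding g_def p \<eta>_def by (simp add: Basis_complex_def power2_eq_square algebra_simps)
    then show ?thesis unfolding n[symmetric] by simp
  qed simp
  have B: "1 \<in> (Basis :: complex set)" "\<i> \<in> (Basis :: complex set)" by (auto simp: Basis_complex_def)
  have gi: "set_integrable lebesgue ?O (\<lambda>x. g 1 x + g \<i> x)" "(LINT x:?O|lebesgue. g 1 x + g \<i> x) = 0"
    using set_integral_add[OF g(1)[OF B(1)] g(1)[OF B(2)]] g(2)[OF B(1)] g(2)[OF B(2)] by simp_all
  let ?h = "\<lambda>x. - (H ((norm x)\<^sup>2) + (norm x)\<^sup>2 * H' ((norm x)\<^sup>2)) * (f x)\<^sup>2 - H ((norm x)\<^sup>2) * (f x * (\<Sum>e\<in>Basis. (x \<bullet> e) * F e x))"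
  have 1: "set_integrable lebesgue ?O (\<lambda>x. 2 * ?h x)" "(LINT x:?O|lebesgue. 2 * ?h x) = 0"
    using gi unfolding set_integrable_def set_lebesgue_integral_def sum by simp_all
  have "?h = (\<lambda>x. (1/2) * (2 * ?h x))" by (simp add: fun_eq_iff)
  moreover have "set_integrable lebesgue ?O (\<lambda>x. (1/2) * (2 * ?h x))"
    by (rule set_integrable_mult_right) (rule 1(1))
  ultimately show "set_integrable lebesgue ?O ?h" by (simp only:)
  show "(LINT x:?O|lebesgue. ?h x) = 0"
    using 1(2) unfolding set_integral_mult_right by simp
qed

section \<open>The Hardy inequality\<close>

text \<open>In terms of \<open>s = |x|\<^sup>2 / a\<^sup>2\<close>, \<open>hq k\<close> is the factor \<open>q\<close> of the vector field, negative exactly on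
  \<open>1 < s < 3\<close>; \<open>hQ k = k q - s q'\<close> is the resulting density, which has to be positive outside the
  collar \<open>3/2 \<le> s \<le> 5\<close>; and \<open>hcut \<beta> n\<close> makes the field compactly supported in \<open>1 < s < \<beta>\<close>.\<close>

definition hq :: "real \<Rightarrow> real \<Rightarrow> real" where
  "hq k s = 1 - exp (k * (1 - (s - 2)\<^sup>2))"

definition hp :: "real \<Rightarrow> real \<Rightarrow> real" where
  "hp \<beta> s = (s - 1) * (\<beta> - s)"

definition hcut :: "real \<Rightarrow> real \<Rightarrow> real \<Rightarrow> real" where
  "hcut \<beta> n s = flat 0 (n * hp \<beta> s - 1)"

lemma hq_bounds:
  assumes "k \<ge> 0"
  shows "\<bar>hq k s\<bar> \<le> exp k"
proof -
  have "k * (1 - (s - 2)\<^sup>2) \<le> k * 1" using assms by (intro mult_left_mono) auto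
  then have "exp (k * (1 - (s - 2)\<^sup>2)) \<le> exp k" by simp
  moreover have "1 \<le> exp k" using assms by simp
  moreover have "0 < exp (k * (1 - (s - 2)\<^sup>2))" by simp
  ultimately show ?thesis unfolding hq_def by linarith
qed

text \<open>Here u stands for s - 2. With z = u^2 - 1 >= 8, the bound exp z >= (1 + z/4)^4 >= 27 (1
  + z/4) beats the quadratic factor, which is at most 1 + 10/3 (z + 1) because u^2 >= 3u. The case k
  = 1 is the worst.\<close>

lemma exp_tail:
  fixes u :: real
  assumes "u \<ge> 3" "k \<ge> 1"
  shows "exp (k * (1 - u\<^sup>2)) * (1 + 2 * (u + 2) * u) \<le> 1 / 2"
proof -
  define z where "z = u\<^sup>2 - 1"
  have u2: "u\<^sup>2 \<ge> 3 * u" using assms by (simp add: power2_eq_square mult_right_mono)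
  then have z: "z \<ge> 8" using assms by (simp add: z_def)
  define w where "w = 1 + z / 4"
  have w: "w \<ge> 3" using z by (simp add: w_def)
  have "w \<le> exp (z / 4)" unfolding w_def by (rule exp_ge_add_one_self)
  then have "w ^ 4 \<le> exp (z / 4) ^ 4" using w by (intro power_mono) auto
  also have "exp (z / 4) ^ 4 = exp z" by (simp flip: exp_of_nat_mult)
  finally have e: "w ^ 4 \<le> exp z" .
  have "w ^ 3 \<ge> 3 ^ 3" using w by (intro power_mono) auto
  then have "w ^ 3 * w \<ge> 27 * w" using w by (intro mult_right_mono) auto
  then have "27 * w \<le> exp z" using e by (simp add: power_numeral_reduce mult_ac)
  moreover have "1 + 2 * (u + 2) * u \<le> 1 + 10 / 3 * (z + 1)"
    using u2 by (simp add: z_def power2_eq_square algebra_simps)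
  ultimately have "2 * (1 + 2 * (u + 2) * u) \<le> exp z" using z by (simp add: w_def)
  then have 1: "exp (- z) * (1 + 2 * (u + 2) * u) \<le> 1 / 2"
    by (simp add: exp_minus field_simps)
  have "k * (1 - u\<^sup>2) \<le> 1 * (1 - u\<^sup>2)"
    using assms z by (intro mult_right_mono_neg) (auto simp: z_def)
  then have "exp (k * (1 - u\<^sup>2)) \<le> exp (- z)" by (simp add: z_def)
  then have "exp (k * (1 - u\<^sup>2)) * (1 + 2 * (u + 2) * u) \<le> exp (- z) * (1 + 2 * (u + 2) * u)"
    using assms by (intro mult_right_mono) auto
  with 1 show ?thesis by linarith
qed

definition hQ :: "real \<Rightarrow> real \<Rightarrow> real" where
  "hQ k s = k * (1 - exp (k * (1 - (s - 2)\<^sup>2)) * (1 + 2 * s * (s - 2)))"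

text \<open>The ends of the collar are fixed by this estimate. On 1 < s < 3/2 the quadratic 1 + 2 s
  (s - 2) is negative, so the exponential term helps; for s > 5 the exponential is small enough for
  \<open>exp_tail\<close>.\<close>

lemma hQ_outer:
  assumes "k \<ge> 1" "1 < s" "s \<notin> {3/2..5}"
  shows "hQ k s \<ge> k / 2"
proof -
  have "exp (k * (1 - (s - 2)\<^sup>2)) * (1 + 2 * s * (s - 2)) \<le> 1 / 2"
  proof (cases "s < 3/2")
    case True
    then have "(s - 1/2) * (s - 3/2) \<le> 0" using assms by (intro mult_nonneg_nonpos) auto
    moreover have "1 + 2 * s * (s - 2) = 2 * ((s - 1/2) * (s - 3/2)) - 1/2" by (simp add: field_simps)
    ultimately have "1 + 2 * s * (s - 2) \<le> 0" by linarith
    then have "exp (k * (1 - (s - 2)\<^sup>2)) * (1 + 2 * s * (s - 2)) \<le> 0"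
      by (intro mult_nonneg_nonpos) auto
    then show ?thesis by linarith
  next
    case False
    then have "s - 2 \<ge> 3" using assms by auto
    from exp_tail[OF this assms(1)] show ?thesis by simp
  qed
  then have "k * (1 / 2) \<le> hQ k s" unfolding hQ_def using assms by (intro mult_left_mono) auto
  then show ?thesis by simp
qed

lemma hQ_inner:
  assumes "k \<ge> 1" "s \<in> {3/2..5}"
  shows "hQ k s \<ge> - (31 * k * exp k)"
proof -
  have "s * (s - 2) \<le> 5 * 3"
  proof (cases "s \<ge> 2")
    case True
    then show ?thesis using assms by (intro mult_mono) auto
  next
    case False
    then have "s * (s - 2) \<le> 0" using assms by (intro mult_nonneg_nonpos) auto
    then show ?thesis by simp
  qed
  \<comment> \<open>On the collar s (s - 2) is largest at s = 5, with value 15.\<close>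
  then have 1: "1 + 2 * s * (s - 2) \<le> 31" by simp
  have "k * (1 - (s - 2)\<^sup>2) \<le> k * 1" using assms by (intro mult_left_mono) auto
  then have "exp (k * (1 - (s - 2)\<^sup>2)) \<le> exp k" by simp
  then have "exp (k * (1 - (s - 2)\<^sup>2)) * 31 \<le> exp k * 31" by (rule mult_right_mono) simp
  moreover have "exp (k * (1 - (s - 2)\<^sup>2)) * (1 + 2 * s * (s - 2)) \<le> exp (k * (1 - (s - 2)\<^sup>2)) * 31"
    by (intro mult_left_mono 1) simp
  ultimately have "exp (k * (1 - (s - 2)\<^sup>2)) * (1 + 2 * s * (s - 2)) \<le> exp k * 31" by linarith
  then have "- (exp k * 31) \<le> 1 - exp (k * (1 - (s - 2)\<^sup>2)) * (1 + 2 * s * (s - 2))" by linarith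
  then have "k * - (exp k * 31) \<le> hQ k s" unfolding hQ_def using assms by (intro mult_left_mono) auto
  then show ?thesis by simp
qed

text \<open>The cutoff loses only a fraction \<open>O(1/n)\<close>: its derivative has a favourable sign except on
  the left half of the region \<open>3 \<le> s\<close>, where \<open>hp \<beta>\<close> is large.\<close>

lemma hcut_term:
  assumes k: "k \<ge> 1" and s: "1 < s" "s < \<beta>" and \<beta>: "\<beta> \<ge> 16" and n: "n \<ge> 16"
  shows "- (hq k s * flat 2 (n * hp \<beta> s - 1) * (n * s * (\<beta> + 1 - 2 * s)))
      \<ge> (if s \<le> 3/2 then 0 else - (1/4) * hcut \<beta> n s)"
proof -
  define y where "y = n * hp \<beta> s - 1"
  have f: "flat 2 y \<ge> 0" by (rule flat_nonneg)
  have c0: "hcut \<beta> n s \<ge> 0" by (simp add: hcut_def flat_nonneg)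
  consider "s \<le> 3" | "s > 3" "\<beta> + 1 - 2 * s \<le> 0" | "s > 3" "\<beta> + 1 - 2 * s > 0" by linarith
  then have "- (hq k s * flat 2 y * (n * s * (\<beta> + 1 - 2 * s))) \<ge> (if s \<le> 3/2 then 0 else - (1/4) * hcut \<beta> n s)"
  proof cases
    \<comment> \<open>Up to s = 3 the factor \<open>hq\<close> is at most zero and the cutoff is
      still increasing, because s lies left of the midpoint (\<beta> + 1) / 2; the product has the
      favourable sign.\<close>
    case 1
    have "\<bar>s - 2\<bar> \<le> 1" using 1 s by auto
    then have "(s - 2)\<^sup>2 \<le> 1" by (simp add: abs_square_le_1)
    then have "hq k s \<le> 0" using k by (simp add: hq_def)
    then have "hq k s * flat 2 y * (n * s * (\<beta> + 1 - 2 * s)) \<le> 0"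
      using f n s 1 \<beta> by (intro mult_nonpos_nonneg) auto
    then show ?thesis using c0 by auto
  next
    \<comment> \<open>Beyond the midpoint the cutoff decreases while \<open>hq\<close> is
      nonnegative, so the sign is favourable again.\<close>
    case 2
    have "1 \<le> \<bar>s - 2\<bar>" using 2 by auto
    then have "1 \<le> (s - 2)\<^sup>2" by (metis one_le_power power2_abs)
    then have "k * (1 - (s - 2)\<^sup>2) \<le> 0" using k by (intro mult_nonneg_nonpos) auto
    then have "hq k s \<ge> 0" by (simp add: hq_def)
    then have "hq k s * flat 2 y * (n * s * (\<beta> + 1 - 2 * s)) \<le> 0"
      using f n s 2 by (intro mult_nonneg_nonpos mult_nonneg_nonneg) auto
    then show ?thesis using c0 by auto
  next
    \<comment> \<open>The sign is unfavourable, but the cutoff is already nearly flat: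
      \<open>flat 2 y\<close> equals \<open>flat 0 y\<close> divided by y^2, and y^2 is of order n^2
      p^2, against a factor n s (\<beta> + 1 - 2s) of order n p^2. With n >= 16 the quotient is at
      most 1/4.\<close>
    case 3
    have "1 \<le> \<bar>s - 2\<bar>" using 3 by auto
    then have "1 \<le> (s - 2)\<^sup>2" by (metis one_le_power power2_abs)
    then have "k * (1 - (s - 2)\<^sup>2) \<le> 0" using k by (intro mult_nonneg_nonpos) auto
    then have q: "0 \<le> hq k s" "hq k s \<le> 1" by (simp_all add: hq_def)
    define p where "p = hp \<beta> s"
    \<comment> \<open>From s > 3 follows s - 1 >= 2s/3, and from 2s < \<beta> + 1 follows \<beta> -
      s >= (\<beta> - 1)/2.\<close>
    have "p \<ge> (2 * s / 3) * ((\<beta> - 1) / 2)"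
      unfolding p_def hp_def using 3 \<beta> by (intro mult_mono) auto
    then have p: "p \<ge> s * (\<beta> - 1) / 3" by simp
    have "s * (\<beta> - 1) \<ge> 3 * 15" using 3 \<beta> by (intro mult_mono) auto
    then have p15: "p \<ge> 15" using p by simp
    have "n * p \<ge> 16 * 15" using n p15 by (intro mult_mono) auto
    then have y: "y \<ge> n * p / 2" "y > 0" by (auto simp: y_def p_def)
    have "s * (\<beta> + 1 - 2 * s) \<le> s * (\<beta> - 1)" using 3 by (intro mult_left_mono) auto
    also have "\<dots> \<le> 3 * p" using p by simp
    also have "\<dots> \<le> p * p" using p15 by (intro mult_right_mono) auto
    finally have sp: "s * (\<beta> + 1 - 2 * s) \<le> p * p" .
    have "(n * p / 2) * (n * p / 2) \<le> y * y" using y n p15 by (intro mult_mono) auto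
    moreover have "n * 16 * (p * p) \<le> n * n * (p * p)" using n p15 by (intro mult_right_mono mult_left_mono) auto
    ultimately have "4 * (n * (p * p)) \<le> y * y" by (simp add: algebra_simps)
    moreover have "n * (s * (\<beta> + 1 - 2 * s)) \<le> n * (p * p)" using sp n by (intro mult_left_mono) auto
    ultimately have "n * (s * (\<beta> + 1 - 2 * s)) \<le> y * y / 4" by linarith
    then have ny: "n * s * (\<beta> + 1 - 2 * s) \<le> y\<^sup>2 / 4" by (simp only: power2_eq_square mult.assoc)
    have "hq k s * flat 2 y * (n * s * (\<beta> + 1 - 2 * s)) \<le> 1 * flat 2 y * (y\<^sup>2 / 4)"
      using q f n s 3 ny by (intro mult_mono mult_right_mono mult_nonneg_nonneg) auto
    also have "\<dots> = hcut \<beta> n s / 4"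
      using y by (simp add: flat_def hcut_def y_def)
    finally show ?thesis using 3 by simp
  qed
  then show ?thesis by (simp add: y_def)
qed

text \<open>Outside the collar \<open>hQ_outer\<close> supplies k/2, and the cutoff costs at most
  k/4. Inside the collar the surplus 2k in the subtracted constant covers both the k/4 on the right
  and the k/4 lost to the cutoff.\<close>

lemma hardy_weight_lower:
  assumes k: "k \<ge> 1" and s: "1 < s" "s < \<beta>" and \<beta>: "\<beta> \<ge> 16" and n: "n \<ge> 16"
  shows "hQ k s * hcut \<beta> n s - hq k s * flat 2 (n * hp \<beta> s - 1) * (n * s * (\<beta> + 1 - 2 * s))
     \<ge> (k / 4 - (if s \<in> {3/2..5} then 31 * k * exp k + 2 * k else 0)) * hcut \<beta> n s"
proof -
  have c0: "hcut \<beta> n s \<ge> 0" by (simp add: hcut_def flat_nonneg)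
  note t = hcut_term[OF assms]
  have t': "- (hq k s * flat 2 (n * hp \<beta> s - 1) * (n * s * (\<beta> + 1 - 2 * s))) \<ge> - (k/4) * hcut \<beta> n s"
  proof -
    have "- (k/4) * hcut \<beta> n s \<le> - (1/4) * hcut \<beta> n s" using k c0 by (intro mult_right_mono) auto
    moreover have "- (1/4) * hcut \<beta> n s \<le> 0" using c0 by simp
    ultimately show ?thesis using t by (auto split: if_splits)
  qed
  show ?thesis
  proof (cases "s \<in> {3/2..5}")
    case True
    have "- (31 * k * exp k) * hcut \<beta> n s \<le> hQ k s * hcut \<beta> n s"
      using hQ_inner[OF k True] c0 by (intro mult_right_mono)
    moreover have "(k / 4 - (31 * k * exp k + 2 * k)) * hcut \<beta> n s
        \<le> (- (31 * k * exp k) + - (k/4)) * hcut \<beta> n s"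
      using c0 k by (intro mult_right_mono) auto
    moreover have "(- (31 * k * exp k) + - (k/4)) * hcut \<beta> n s
        = - (31 * k * exp k) * hcut \<beta> n s + - (k/4) * hcut \<beta> n s" by (rule distrib_right)
    ultimately show ?thesis using t' unfolding if_P[OF True] by linarith
  next
    case False
    have "k / 2 * hcut \<beta> n s \<le> hQ k s * hcut \<beta> n s"
      using hQ_outer[OF k s(1) False] c0 by (intro mult_right_mono)
    then show ?thesis using t' unfolding if_not_P[OF False] by (simp add: field_simps)
  qed
qed

lemma hcut_support:
  assumes "n > 0" "\<beta> > 1" "s \<notin> {1 + 1 / (n * (\<beta> - 1)) .. \<beta> - 1 / (n * (\<beta> - 1))}"
  shows "hcut \<beta> n s = 0"
proof -
  define \<epsilon> where "\<epsilon> = 1 / (n * (\<beta> - 1))"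
  have \<epsilon>: "\<epsilon> > 0" "n * (\<epsilon> * (\<beta> - 1)) = 1" using assms by (auto simp: \<epsilon>_def field_simps)
  \<comment> \<open>Proved at the left end only: \<open>hp \<beta>\<close> is invariant under the
    reflection s -> \<beta> + 1 - s, which carries the estimate to the right end.\<close>
  have *: "n * ((u - 1) * (\<beta> - u)) \<le> 1" if "u < 1 + \<epsilon>" for u
  proof (cases "1 < u \<and> u < \<beta>")
    case True
    then have "(u - 1) * (\<beta> - u) \<le> \<epsilon> * (\<beta> - 1)" using that assms by (intro mult_mono) auto
    then have "n * ((u - 1) * (\<beta> - u)) \<le> n * (\<epsilon> * (\<beta> - 1))" using assms by (intro mult_left_mono) auto
    then show ?thesis using \<epsilon> by simp
  next
    case False
    then have "(u - 1) * (\<beta> - u) \<le> 0"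
      using assms by (cases "u \<le> 1") (auto intro: mult_nonpos_nonneg mult_nonneg_nonpos)
    then have "n * ((u - 1) * (\<beta> - u)) \<le> 0" using assms mult_nonneg_nonpos[of n "(u - 1) * (\<beta> - u)"] by simp
    then show ?thesis by simp
  qed
  have "n * hp \<beta> s \<le> 1"
  proof (cases "s < 1 + \<epsilon>")
    case True
    then show ?thesis using *[of s] by (simp add: hp_def)
  next
    case False
    then have "\<beta> + 1 - s < 1 + \<epsilon>" using assms(3) by (auto simp: \<epsilon>_def)
    from *[OF this] show ?thesis by (simp add: hp_def mult.commute)
  qed
  then show ?thesis by (simp add: hcut_def flat_eq_0)
qed

lemma hcut_nonneg: "0 \<le> hcut \<beta> n s" and hcut_le_1: "hcut \<beta> n s \<le> 1"
  by (simp_all add: hcut_def flat_nonneg flat_0_le_1)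

lemma flat_0_tendsto_1: "(flat 0 \<longlongrightarrow> 1) at_top"
proof -
  have "((\<lambda>s::real. exp (- 1 / s)) \<longlongrightarrow> exp 0) at_top"
    by (intro tendsto_exp tendsto_divide_0[OF tendsto_const] filterlim_at_top_imp_at_infinity filterlim_ident)
  moreover have "\<forall>\<^sub>F s in at_top. exp (- 1 / s) = flat 0 s"
    using eventually_gt_at_top[of 0] by eventually_elim (simp add: flat_def)
  ultimately show ?thesis using Lim_transform_eventually by fastforce
qed

lemma hcut_tendsto_1:
  assumes "1 < s" "s < \<beta>"
  shows "(\<lambda>n. hcut \<beta> (real n) s) \<longlonglongrightarrow> 1"
proof -
  have "hp \<beta> s > 0" using assms by (simp add: hp_def)
  then have "filterlim (\<lambda>n. - 1 + hp \<beta> s * real n) at_top sequentially"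
    by (intro filterlim_tendsto_add_at_top[OF tendsto_const]
        filterlim_tendsto_pos_mult_at_top[OF tendsto_const] filterlim_real_sequentially)
  from filterlim_compose[OF flat_0_tendsto_1 this] show ?thesis
    by (simp add: hcut_def mult.commute)
qed

lemma hcut_has_derivative:
  "(hcut \<beta> n has_real_derivative flat 2 (n * hp \<beta> s - 1) * (n * (\<beta> + 1 - 2 * s))) (at s)"
proof -
  have "((\<lambda>s. n * hp \<beta> s - 1) has_real_derivative n * (\<beta> + 1 - 2 * s)) (at s)"
    unfolding hp_def by (auto intro!: derivative_eq_intros simp: algebra_simps)
  from DERIV_chain2[OF flat_has_derivative[of 0] this] show ?thesis
    by (simp add: hcut_def[abs_def] numeral_2_eq_2)
qed

lemma hq_has_derivative:
  "(hq k has_real_derivative 2 * k * (s - 2) * exp (k * (1 - (s - 2)\<^sup>2))) (at s)"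
  unfolding hq_def[abs_def] by (auto intro!: derivative_eq_intros simp: algebra_simps)

lemma smooth_on_square:
  fixes f :: "'a::euclidean_space \<Rightarrow> real"
  shows "open U \<Longrightarrow> smooth_on U f \<Longrightarrow> smooth_on U (\<lambda>x. (f x)\<^sup>2)"
  unfolding power2_eq_square by (rule smooth_on_mult)

lemma smooth_on_divide_const: "smooth_on U (\<lambda>t::real. t / c)"
  using smooth_on_inner[of U "1 / c"] by simp

lemma smooth_hq: "smooth_on UNIV (hq k)"
proof -
  have "smooth_on UNIV (\<lambda>s. k * (1 - (s - 2)\<^sup>2))"
    by (intro smooth_on_mult smooth_on_diff smooth_on_square smooth_on_const' smooth_on_ident_real open_UNIV)
  from smooth_on_compose[OF open_UNIV smooth_on_exp[of UNIV] this]
  show ?thesis unfolding hq_def[abs_def] by (intro smooth_on_diff) auto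
qed

lemma smooth_hcut: "smooth_on UNIV (hcut \<beta> n)"
proof -
  have "smooth_on UNIV (\<lambda>s. n * hp \<beta> s - 1)"
    unfolding hp_def by (intro smooth_on_mult smooth_on_diff smooth_on_const' smooth_on_ident_real open_UNIV)
  from smooth_on_compose[OF open_UNIV smooth_on_flat[of UNIV 0] this]
  show ?thesis unfolding hcut_def[abs_def] by simp
qed

lemma sum_Basis_sq_le:
  "(\<Sum>e\<in>Basis. (x \<bullet> e) * G e)\<^sup>2 \<le> (norm (x::complex))\<^sup>2 * (\<Sum>e\<in>Basis. (G e)\<^sup>2)"
proof -
  have "(\<Sum>e\<in>Basis. (x \<bullet> e) * G e)\<^sup>2 \<le> (\<Sum>e\<in>Basis. (x \<bullet> e)\<^sup>2) * (\<Sum>e\<in>Basis. (G e)\<^sup>2)"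
    by (rule Cauchy_Schwarz_ineq_sum)
  then show ?thesis by (simp add: inner_Basis_complex_sum)
qed

text \<open>Of the coefficient k/4 from \<open>hardy_weight_lower\<close>, half is spent on the
  cross term with x . grad f by Young's inequality, and k/8 remains. Values of the profile and its
  derivative enter through equations, so that all the arithmetic takes place at one fixed
  point.\<close>

lemma hardy_pointwise:
  fixes x :: complex and y :: real and G :: "complex \<Rightarrow> real"
  assumes k: "k \<ge> 1" and a: "a > 0" and s: "1 < s" "s < \<beta>" and \<beta>: "\<beta> \<ge> 16" and n: "n \<ge> 16"
    and t: "t = (norm x)\<^sup>2" "s = t / a\<^sup>2"
    and H: "H = t powr (- k - 1) * (hq k s * hcut \<beta> n s)"
    and H': "H' = t powr (- k - 1) * ((2 * k * (s - 2) * exp (k * (1 - (s - 2)\<^sup>2)) / a\<^sup>2) * hcut \<beta> n s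
             + hq k s * (flat 2 (n * hp \<beta> s - 1) * (n * (\<beta> + 1 - 2 * s)) / a\<^sup>2))
          + (- k - 1) * t powr (- k - 2) * (hq k s * hcut \<beta> n s)"
  shows "k / 8 * (t powr (- k - 1) * hcut \<beta> n s * (y * y))
     \<le> (- (H + t * H') * y\<^sup>2 - H * (y * (\<Sum>e\<in>Basis. (x \<bullet> e) * G e)))
       + (31 * k * exp k + 2 * k) * (indicator {3/2..5} s * t powr (- k - 1) * (y * y))
       + 2 * (exp k)\<^sup>2 / k * (\<Sum>e\<in>Basis. t powr (- k) * (G e * G e))"
proof -
  have tpos: "t > 0" using s a unfolding t(2) by (metis divide_pos_pos less_trans zero_less_divide_iff zero_less_one not_square_less_zero power2_eq_square zero_less_power less_asym)
  define T where "T = t powr (- k - 1)"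
  have pow: "t * t powr p = t powr (p + 1)" for p using tpos by (simp add: powr_add)
  have T: "T > 0" "t * t powr (- k - 2) = T" "T * t = t powr (- k)"
    using tpos pow[of "- k - 2"] pow[of "- k - 1"] by (simp_all add: T_def mult.commute minus_diff_commute)
  define \<psi> where "\<psi> = hcut \<beta> n s"
  have \<psi>: "0 \<le> \<psi>" "\<psi> \<le> 1" by (simp_all add: \<psi>_def hcut_nonneg hcut_le_1)
  define E where "E = exp (k * (1 - (s - 2)\<^sup>2))"
  define f2 where "f2 = flat 2 (n * hp \<beta> s - 1)"
  define S where "S = (\<Sum>e\<in>Basis. (x \<bullet> e) * G e)"
  define c :: real where "c = indicator {3/2..5} s"
  define C where "C = 31 * k * exp k + 2 * k"
  have C: "C \<ge> 0" using k by (simp add: C_def)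
  \<comment> \<open>Converts the derivative in t into the Euler derivative in the scaled variable
    s.\<close>
  have ta: "t * (X / a\<^sup>2) = X * s" for X unfolding t(2) by simp
  have "t * H' = T * ((2 * k * (s - 2) * E * s) * \<psi> + hq k s * (f2 * (n * s * (\<beta> + 1 - 2 * s))))
      + (- k - 1) * (t * t powr (- k - 2)) * (hq k s * \<psi>)"
  proof -
    have "t * H' = T * (t * (2 * k * (s - 2) * E / a\<^sup>2) * \<psi> + hq k s * (t * (f2 * (n * (\<beta> + 1 - 2 * s)) / a\<^sup>2)))
        + (- k - 1) * (t * t powr (- k - 2)) * (hq k s * \<psi>)"
      unfolding H' T_def[symmetric] \<psi>_def[symmetric] E_def[symmetric] f2_def[symmetric]
      by (simp only: distrib_left mult_ac)
    then show ?thesis unfolding ta by (simp only: mult_ac)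
  qed
  then have W: "- (H + t * H') = T * (hQ k s * \<psi> - hq k s * f2 * (n * s * (\<beta> + 1 - 2 * s)))"
    unfolding T(2) H T_def[symmetric] \<psi>_def[symmetric] hQ_def hq_def E_def[symmetric]
    by (simp add: algebra_simps)
  have ifc: "(if s \<in> {3/2..5} then 31 * k * exp k + 2 * k else 0) = C * c"
    unfolding C_def c_def by (auto simp: indicator_def)
  have "(k / 4 - C * c) * \<psi> \<le> hQ k s * \<psi> - hq k s * f2 * (n * s * (\<beta> + 1 - 2 * s))"
    using hardy_weight_lower[OF k s \<beta> n] unfolding \<psi>_def f2_def ifc .
  then have W1: "T * ((k / 4 - C * c) * \<psi>) * y\<^sup>2 \<le> - (H + t * H') * y\<^sup>2"
    unfolding W using T by (intro mult_right_mono mult_left_mono) auto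
  \<comment> \<open>In the error term on the collar the cutoff is simply bounded by 1, which makes
    that term independent of \<open>n\<close>.\<close>
  have "T * (C * c * \<psi>) * y\<^sup>2 \<le> T * (C * c * 1) * y\<^sup>2"
    using T \<psi> C by (intro mult_right_mono mult_left_mono) (auto simp: c_def)
  then have W2: "k / 4 * (T * \<psi> * y\<^sup>2) - C * (c * T * y\<^sup>2) \<le> - (H + t * H') * y\<^sup>2"
    using W1 by (simp add: algebra_simps)
  have "\<bar>H * (y * S)\<bar> = T * \<psi> * (\<bar>hq k s\<bar> * \<bar>y * S\<bar>)"
    unfolding H T_def[symmetric] \<psi>_def[symmetric] using T \<psi> by (simp add: abs_mult)
  also have "\<dots> \<le> T * \<psi> * (exp k * \<bar>y * S\<bar>)"
    using T \<psi> hq_bounds[of k s] k by (intro mult_left_mono mult_right_mono) auto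
  also have "exp k * \<bar>y * S\<bar> = \<bar>y * (exp k * S)\<bar>" by (simp add: abs_mult)
  \<comment> \<open>The weight k/4 in Young's inequality yields k/8 in front of y^2 and 2/k in front
    of the other square.\<close>
  also have "T * \<psi> * \<bar>y * (exp k * S)\<bar> \<le> T * \<psi> * (k / 4 / 2 * y\<^sup>2 + 1 / (2 * (k / 4)) * (exp k * S)\<^sup>2)"
    using T \<psi> k by (intro mult_left_mono abs_mult_le_weighted) auto
  also have "\<dots> = k / 8 * (T * \<psi> * y\<^sup>2) + \<psi> * (2 * (exp k)\<^sup>2 / k * (T * S\<^sup>2))"
    using k by (simp add: field_simps power_mult_distrib)
  also have "\<psi> * (2 * (exp k)\<^sup>2 / k * (T * S\<^sup>2)) \<le> 1 * (2 * (exp k)\<^sup>2 / k * (T * S\<^sup>2))"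
    using T \<psi> k by (intro mult_right_mono) auto
  finally have 1: "\<bar>H * (y * S)\<bar> \<le> k / 8 * (T * \<psi> * y\<^sup>2) + 2 * (exp k)\<^sup>2 / k * (T * S\<^sup>2)" by simp
  \<comment> \<open>Cauchy-Schwarz for the radial derivative costs a factor t = |x|^2, which lowers
    the weight from |x|^(-2k-2) to |x|^(-2k).\<close>
  have "T * S\<^sup>2 \<le> T * (t * (\<Sum>e\<in>Basis. (G e)\<^sup>2))"
    using T sum_Basis_sq_le[of x G] unfolding S_def t(1) by (intro mult_left_mono) auto
  also have "\<dots> = (\<Sum>e\<in>Basis. t powr (- k) * (G e * G e))"
    unfolding mult.assoc[symmetric] T(3) by (simp add: sum_distrib_left power2_eq_square mult.assoc)
  finally have "2 * (exp k)\<^sup>2 / k * (T * S\<^sup>2) \<le> 2 * (exp k)\<^sup>2 / k * (\<Sum>e\<in>Basis. t powr (- k) * (G e * G e))"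
    using k by (intro mult_left_mono) auto
  with 1 W2 have "k / 8 * (T * \<psi> * y\<^sup>2) \<le> (- (H + t * H') * y\<^sup>2 - H * (y * S)) + C * (c * T * y\<^sup>2)
       + 2 * (exp k)\<^sup>2 / k * (\<Sum>e\<in>Basis. t powr (- k) * (G e * G e))"
    by linarith
  then show ?thesis unfolding T_def \<psi>_def C_def c_def S_def power2_eq_square by (simp only: mult.assoc)
qed

text \<open>A cutoff around the collar in the scaled variable: bounded below on 3/2 <= s <= 5 and
  supported in 6/5 <= s <= 6, hence away from both circles.\<close>

definition zeta :: "real \<Rightarrow> real" where
  "zeta s = flat 0 ((s - 6/5) * (6 - s))"

lemma zeta_bounds: "0 \<le> zeta s" "zeta s \<le> 1" "s \<notin> {6/5..6} \<Longrightarrow> zeta s = 0"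
  and zeta_lower: "s \<in> {3/2..5} \<Longrightarrow> exp (- 1) \<le> zeta s"
proof -
  show "0 \<le> zeta s" "zeta s \<le> 1" by (simp_all add: zeta_def flat_nonneg flat_0_le_1)
  show "zeta s = 0" if "s \<notin> {6/5..6}"
  proof -
    have "(s - 6/5) * (6 - s) \<le> 0"
      using that by (cases "s < 6/5") (auto intro: mult_nonpos_nonneg mult_nonneg_nonpos)
    then show ?thesis by (simp add: zeta_def flat_eq_0)
  qed
  show "exp (- 1) \<le> zeta s" if "s \<in> {3/2..5}"
  proof -
    \<comment> \<open>The argument of \<open>flat 0\<close> in \<open>zeta\<close> exceeds this
      product by 0.7 s + 0.3, which is more than 1 here.\<close>
    have "(s - 3/2) * (5 - s) \<ge> 0" using that by (intro mult_nonneg_nonneg) auto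
    then have "(s - 6/5) * (6 - s) \<ge> 1" using that by (auto simp: field_simps)
    moreover from less_le_trans[OF zero_less_one this] have "(s - 6/5) * (6 - s) > 0" .
    ultimately show ?thesis by (simp add: zeta_def flat_def)
  qed
qed

lemma zeta_has_derivative:
  "(zeta has_real_derivative flat 2 ((s - 6/5) * (6 - s)) * (36/5 - 2 * s)) (at s)"
proof -
  have "((\<lambda>s. (s - 6/5) * (6 - s)) has_real_derivative 36/5 - 2 * s) (at s)"
    by (auto intro!: derivative_eq_intros simp: algebra_simps)
  from DERIV_chain2[OF flat_has_derivative[of 0] this] show ?thesis
    by (simp add: zeta_def[abs_def] numeral_2_eq_2)
qed

lemma smooth_zeta: "smooth_on UNIV zeta"
proof -
  have "smooth_on UNIV (\<lambda>s::real. (s - 6/5) * (6 - s))"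
    by (intro smooth_on_mult smooth_on_diff smooth_on_const' smooth_on_ident_real open_UNIV)
  from smooth_on_compose[OF open_UNIV smooth_on_flat[of UNIV 0] this]
  show ?thesis unfolding zeta_def[abs_def] by simp
qed

lemma zeta_derivative_bound:
  assumes "s \<in> {6/5..6}"
  shows "\<bar>s * (flat 2 ((s - 6/5) * (6 - s)) * (36/5 - 2 * s))\<bar> \<le> 116"
proof -
  have "\<bar>s * (flat 2 ((s - 6/5) * (6 - s)) * (36/5 - 2 * s))\<bar> = s * (flat 2 ((s - 6/5) * (6 - s)) * \<bar>36/5 - 2 * s\<bar>)"
    using assms by (simp add: abs_mult flat_nonneg)
  \<comment> \<open>|36/5 - 2s| attains 24/5 at both ends of the interval; the product is
    115.2.\<close>
  also have "\<dots> \<le> 6 * (4 * (24/5))"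
    using assms by (intro mult_mono flat_2_le mult_nonneg_nonneg flat_nonneg) (auto simp: abs_if)
  finally show ?thesis by simp
qed

text \<open>Caccioppoli's estimate before integration: \<open>y\<close> is the first and
  \<open>w\<close> the second derivative of \<open>v\<close> in one fixed direction. Squaring
  \<open>zeta\<close> leaves one factor \<open>zeta\<close> in H', which accompanies
  \<open>y\<close> and is absorbed by H y^2.\<close>

lemma collar_pointwise:
  fixes x :: complex
  assumes k: "k \<ge> 1" and a: "a > 0" and t: "t = (norm x)\<^sup>2" "s = t / a\<^sup>2" and tpos: "t > 0"
    and H: "H = t powr (- k - 1) * (zeta s)\<^sup>2"
    and H': "H' = t powr (- k - 1) * (2 * zeta s * (flat 2 ((s - 6/5) * (6 - s)) * (36/5 - 2 * s) / a\<^sup>2))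
          + (- k - 1) * t powr (- k - 2) * (zeta s)\<^sup>2"
    and xi: "xi\<^sup>2 \<le> t"
  shows "1 / 2 * (H * (y * y)) \<le> (H' * (2 * xi) * (v * y) + H * (v * w + y * y))
     + (2 * (k + 233)\<^sup>2 + 1 / 2) * (indicator {..6} s * t powr (- k - 2) * (v * v)) + 1 / 2 * (t powr (- k) * (w * w))"
proof (cases "s \<in> {6/5..6}")
  case False
  then have "H = 0" "H' = 0" using zeta_bounds(3)[of s] by (auto simp: H H')
  moreover have "0 \<le> (2 * (k + 233)\<^sup>2 + 1 / 2) * (indicator {..6} s * t powr (- k - 2) * (v * v))"
    by (intro mult_nonneg_nonneg[OF _ mult_nonneg_nonneg[OF _ zero_le_square]]) auto
  moreover have "0 \<le> t powr (- k) * (w * w)" by simp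
  ultimately show ?thesis by simp
next
  case True
  define T where "T = t powr (- k - 2)"
  have pow: "t * t powr p = t powr (p + 1)" for p using tpos by (simp add: powr_add)
  have T: "T > 0" "t powr (- k - 1) = t * T" "t powr (- k) = t * (t * T)"
    using tpos pow[of "- k - 2"] pow[of "- k - 1"] by (simp_all add: T_def minus_diff_commute)
  define z where "z = zeta s"
  have z: "0 \<le> z" "z \<le> 1" using zeta_bounds by (simp_all add: z_def)
  define z' where "z' = flat 2 ((s - 6/5) * (6 - s)) * (36/5 - 2 * s)"
  \<comment> \<open>The logarithmic part of H', namely H' = T z M. Its bound k + 233 is (k + 1) + 2
    * 116.\<close>
  define M where "M = - (k + 1) * z + 2 * (s * z')"
  have "\<bar>M\<bar> \<le> \<bar>- (k + 1) * z\<bar> + \<bar>2 * (s * z')\<bar>" unfolding M_def by (rule abs_triangle_ineq)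
  also have "\<bar>- (k + 1) * z\<bar> \<le> (k + 1) * 1"
    unfolding abs_mult using k z by (intro mult_mono) auto
  also have "\<bar>2 * (s * z')\<bar> \<le> 2 * 116" using zeta_derivative_bound[OF True] by (simp add: abs_mult z'_def mult_ac)
  finally have M: "\<bar>M\<bar> \<le> k + 233" by simp
  have ta: "t * (X / a\<^sup>2) = X * s" for X unfolding t(2) by simp
  have "H' = T * (2 * z * (t * (z' / a\<^sup>2))) + (- k - 1) * T * z\<^sup>2"
    unfolding H' T(2) z_def[symmetric] z'_def[symmetric] T_def[symmetric] by (simp only: mult_ac)
  then have H'M: "H' = T * z * M"
    unfolding ta M_def by (simp add: algebra_simps power2_eq_square)
  have Hz: "H = t * T * z\<^sup>2" unfolding H T(2) z_def ..
  have "\<bar>xi * (M * v)\<bar>\<^sup>2 \<le> t * ((k + 233)\<^sup>2 * v\<^sup>2)"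
  proof -
    have "\<bar>M\<bar>\<^sup>2 \<le> (k + 233)\<^sup>2" using M by (intro power_mono) auto
    then have M2: "M\<^sup>2 \<le> (k + 233)\<^sup>2" by simp
    have "xi\<^sup>2 * (M\<^sup>2 * v\<^sup>2) \<le> t * ((k + 233)\<^sup>2 * v\<^sup>2)"
      by (rule mult_mono[OF xi mult_right_mono[OF M2 zero_le_power2]]) (use tpos in auto)
    then show ?thesis by (simp add: power_mult_distrib)
  qed
  then have x2: "(xi * (M * v))\<^sup>2 \<le> t * ((k + 233)\<^sup>2 * v\<^sup>2)" by simp
  have "\<bar>H' * (2 * xi) * (v * y)\<bar> = T * (2 * \<bar>(z * y) * (xi * (M * v))\<bar>)"
    unfolding H'M using T(1) z by (simp add: abs_mult mult_ac)
  \<comment> \<open>With the weight t/2 the part containing \<open>y\<close> is exactly half of H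
    y^2; the other half is the left-hand side of the lemma.\<close>
  also have "\<dots> \<le> T * (2 * (t / 2 / 2 * (z * y)\<^sup>2 + 1 / (2 * (t / 2)) * (xi * (M * v))\<^sup>2))"
    using T(1) tpos by (intro mult_left_mono abs_mult_le_weighted) auto
  also have "\<dots> \<le> T * (2 * (t / 2 / 2 * (z * y)\<^sup>2 + 1 / (2 * (t / 2)) * (t * ((k + 233)\<^sup>2 * v\<^sup>2))))"
    using T(1) tpos by (intro mult_left_mono add_mono x2 order_refl) auto
  also have "\<dots> = 1 / 2 * (t * T * z\<^sup>2 * y\<^sup>2) + 2 * (k + 233)\<^sup>2 * (T * v\<^sup>2)"
    using tpos by (simp add: field_simps power_mult_distrib)
  finally have 1: "\<bar>H' * (2 * xi) * (v * y)\<bar> \<le> 1 / 2 * (H * (y * y)) + 2 * (k + 233)\<^sup>2 * (T * v\<^sup>2)"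
    unfolding Hz by (simp add: power2_eq_square mult.assoc)
  have "\<bar>H * (v * w)\<bar> = t * T * z\<^sup>2 * \<bar>v * w\<bar>"
    unfolding Hz using T(1) tpos by (simp add: abs_mult)
  also have "\<dots> \<le> t * T * 1 * \<bar>v * w\<bar>"
    using T(1) tpos z by (intro mult_right_mono mult_left_mono) (auto simp: power_le_one)
  also have "\<dots> \<le> t * T * 1 * (1 / t / 2 * v\<^sup>2 + 1 / (2 * (1 / t)) * w\<^sup>2)"
    using T(1) tpos by (intro mult_left_mono abs_mult_le_weighted) auto
  also have "\<dots> = 1 / 2 * (T * v\<^sup>2) + 1 / 2 * (t * (t * T) * w\<^sup>2)"
    using tpos by (simp add: field_simps)
  finally have 2: "\<bar>H * (v * w)\<bar> \<le> 1 / 2 * (T * v\<^sup>2) + 1 / 2 * (t powr (- k) * w\<^sup>2)" unfolding T(3) .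
  have "(indicator {..6} s :: real) = 1" using True by simp
  then have "(2 * (k + 233)\<^sup>2 + 1 / 2) * (indicator {..6} s * t powr (- k - 2) * (v * v))
      = 2 * (k + 233)\<^sup>2 * (T * v\<^sup>2) + 1 / 2 * (T * v\<^sup>2)"
    by (simp add: T_def[symmetric] distrib_right power2_eq_square)
  moreover have "H * (v * w + y * y) = H * (v * w) + H * (y * y)" by (rule distrib_left)
  moreover have "t powr (- k) * (w * w) = t powr (- k) * w\<^sup>2" by (simp add: power2_eq_square)
  ultimately show ?thesis using 1 2 unfolding abs_le_iff by linarith
qed

section \<open>Integration of the pointwise bounds\<close>

lemma weight_bounded_mult:
  assumes "\<And>x. x \<in> S \<Longrightarrow> \<bar>w x\<bar> \<le> (B::real)" "\<And>x. 0 \<le> c x" "\<And>x. c x \<le> (1::real)" "x \<in> S"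
  shows "\<bar>c x * w x\<bar> \<le> B"
proof -
  have "\<bar>c x * w x\<bar> \<le> 1 * \<bar>w x\<bar>"
    unfolding abs_mult using assms(2,3)[of x] by (intro mult_right_mono) auto
  then show ?thesis using assms(1)[OF assms(4)] by simp
qed

lemma powr_norm_measurable: "(\<lambda>x::complex. (norm x)\<^sup>2 powr p) \<in> borel_measurable borel"
  by measurable

lemma hcut_measurable: "hcut \<beta> n \<in> borel_measurable borel"
  by (intro borel_measurable_continuous_onI smooth_on_imp_continuous_on smooth_hcut)

context
  fixes a b k :: real
  assumes a: "0 < a" and ab: "4 * a \<le> b" and k: "k \<ge> 1"
begin

lemma hardy_weights:
  shows "\<And>f g p. square_integrable (annulus a b) f \<Longrightarrow> square_integrable (annulus a b) g \<Longrightarrow>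
      set_integrable lebesgue (annulus a b) (\<lambda>x. (norm x)\<^sup>2 powr p * (f x * g x))"
    and "\<And>f g p A. square_integrable (annulus a b) f \<Longrightarrow> square_integrable (annulus a b) g \<Longrightarrow> A \<in> sets borel \<Longrightarrow>
      set_integrable lebesgue (annulus a b) (\<lambda>x. indicator A ((norm x)\<^sup>2 / a\<^sup>2) * (norm x)\<^sup>2 powr p * (f x * g x))"
    and "\<And>f g p \<beta> n. square_integrable (annulus a b) f \<Longrightarrow> square_integrable (annulus a b) g \<Longrightarrow>
      set_integrable lebesgue (annulus a b) (\<lambda>x. (norm x)\<^sup>2 powr p * hcut \<beta> n ((norm x)\<^sup>2 / a\<^sup>2) * (f x * g x))"
proof -
  fix f g :: "complex \<Rightarrow> real" and p assume fg: "square_integrable (annulus a b) f" "square_integrable (annulus a b) g"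
  obtain B where B: "\<And>x. x \<in> annulus a b \<Longrightarrow> \<bar>(norm x)\<^sup>2 powr p\<bar> \<le> B" using powr_norm_bounded[OF a] by metis
  show "set_integrable lebesgue (annulus a b) (\<lambda>x. (norm x)\<^sup>2 powr p * (f x * g x))"
    by (rule weighted_integrable[OF fg powr_norm_measurable B])
  show "set_integrable lebesgue (annulus a b) (\<lambda>x. indicator A ((norm x)\<^sup>2 / a\<^sup>2) * (norm x)\<^sup>2 powr p * (f x * g x))"
    if [measurable]: "A \<in> sets borel" for A
  proof (rule weighted_integrable[OF fg])
    show "(\<lambda>x::complex. indicator A ((norm x)\<^sup>2 / a\<^sup>2) * (norm x)\<^sup>2 powr p) \<in> borel_measurable borel"
      by measurable
    show "\<bar>indicator A ((norm x)\<^sup>2 / a\<^sup>2) * (norm x)\<^sup>2 powr p\<bar> \<le> B" if "x \<in> annulus a b" for x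
      by (rule weight_bounded_mult[OF B _ _ that]) (auto simp: indicator_def)
  qed
  show "set_integrable lebesgue (annulus a b) (\<lambda>x. (norm x)\<^sup>2 powr p * hcut \<beta> n ((norm x)\<^sup>2 / a\<^sup>2) * (f x * g x))" for \<beta> n
  proof (rule weighted_integrable[OF fg])
    note [measurable] = hcut_measurable
    show "(\<lambda>x::complex. (norm x)\<^sup>2 powr p * hcut \<beta> n ((norm x)\<^sup>2 / a\<^sup>2)) \<in> borel_measurable borel"
      by measurable
    show "\<bar>(norm x)\<^sup>2 powr p * hcut \<beta> n ((norm x)\<^sup>2 / a\<^sup>2)\<bar> \<le> B" if "x \<in> annulus a b" for x
      using weight_bounded_mult[of "annulus a b" "\<lambda>x. (norm x)\<^sup>2 powr p" B "\<lambda>x. hcut \<beta> n ((norm x)\<^sup>2 / a\<^sup>2)", OF B hcut_nonneg hcut_le_1 that]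
      by (simp add: mult.commute)
  qed
qed

lemma beta_ge_16: "b\<^sup>2 / a\<^sup>2 \<ge> 16"
proof -
  have "(4 * a)\<^sup>2 \<le> b\<^sup>2" using a ab by (intro power_mono) auto
  then show ?thesis using a by (simp add: field_simps power2_eq_square)
qed

lemma annulus_scaled:
  assumes "x \<in> annulus a b"
  shows "1 < (norm x)\<^sup>2 / a\<^sup>2" "(norm x)\<^sup>2 / a\<^sup>2 < b\<^sup>2 / a\<^sup>2" "0 < (norm x)\<^sup>2"
  using annulus_norm_sq[OF a assms] a by (auto simp: divide_strict_right_mono)

text \<open>The cutoff makes the radial field a test field, so the divergence identity integrates to
  zero and \<open>hardy_pointwise\<close> becomes an inequality of integrals. Its right-hand side is
  free of \<open>n\<close>.\<close>

lemma hardy_cutoff: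
  fixes f :: "complex \<Rightarrow> real" and F :: "complex \<Rightarrow> complex \<Rightarrow> real"
  assumes f: "square_integrable (annulus a b) f" "\<And>e. e \<in> Basis \<Longrightarrow> square_integrable (annulus a b) (F e)"
    and F: "\<And>e. e \<in> Basis \<Longrightarrow> has_weak_deriv (annulus a b) [e] f (F e)"
    and n: "n \<ge> 16"
  shows "k / 8 * (LINT x:annulus a b|lebesgue. (norm x)\<^sup>2 powr (- k - 1) * hcut (b\<^sup>2 / a\<^sup>2) n ((norm x)\<^sup>2 / a\<^sup>2) * (f x * f x))
    \<le> (31 * k * exp k + 2 * k) * (LINT x:annulus a b|lebesgue. indicator {3/2..5} ((norm x)\<^sup>2 / a\<^sup>2) * (norm x)\<^sup>2 powr (- k - 1) * (f x * f x))
      + 2 * (exp k)\<^sup>2 / k * (\<Sum>e\<in>Basis. LINT x:annulus a b|lebesgue. (norm x)\<^sup>2 powr (- k) * (F e x * F e x))"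
proof -
  let ?O = "annulus a b"
  define \<beta> where "\<beta> = b\<^sup>2 / a\<^sup>2"
  have \<beta>: "\<beta> \<ge> 16" using beta_ge_16 by (simp add: \<beta>_def)
  define H where "H t = t powr (- k - 1) * (hq k (t / a\<^sup>2) * hcut \<beta> n (t / a\<^sup>2))" for t
  define H' where "H' t = t powr (- k - 1) * ((2 * k * (t / a\<^sup>2 - 2) * exp (k * (1 - (t / a\<^sup>2 - 2)\<^sup>2)) / a\<^sup>2) * hcut \<beta> n (t / a\<^sup>2)
             + hq k (t / a\<^sup>2) * (flat 2 (n * hp \<beta> (t / a\<^sup>2) - 1) * (n * (\<beta> + 1 - 2 * (t / a\<^sup>2))) / a\<^sup>2))
          + (- k - 1) * t powr (- k - 2) * (hq k (t / a\<^sup>2) * hcut \<beta> n (t / a\<^sup>2))" for t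
  define \<epsilon> where "\<epsilon> = 1 / (n * (\<beta> - 1))"
  have \<epsilon>: "\<epsilon> > 0" using n \<beta> by (simp add: \<epsilon>_def)
  have smooth: "smooth_on {0<..} H"
  proof -
    have "smooth_on UNIV (\<lambda>t. hq k (t / a\<^sup>2))" "smooth_on UNIV (\<lambda>t. hcut \<beta> n (t / a\<^sup>2))"
      using smooth_on_compose[OF open_UNIV smooth_hq smooth_on_divide_const]
        smooth_on_compose[OF open_UNIV smooth_hcut smooth_on_divide_const] by simp_all
    then have "smooth_on {0<..} (\<lambda>t. hq k (t / a\<^sup>2))" "smooth_on {0<..} (\<lambda>t. hcut \<beta> n (t / a\<^sup>2))"
      by (auto intro: smooth_on_subset)
    then show ?thesis unfolding H_def[abs_def] by (intro smooth_on_mult smooth_on_powr) auto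
  qed
  have deriv: "(H has_real_derivative H' t) (at t)" if "t > 0" for t
  proof -
    have d: "((\<lambda>t. t / a\<^sup>2) has_real_derivative 1 / a\<^sup>2) (at t)" by (rule DERIV_cdivide[OF DERIV_ident])
    have 1: "((\<lambda>t. t powr (- k - 1)) has_real_derivative (- k - 1) * t powr (- k - 2)) (at t)"
      using that by (auto intro!: derivative_eq_intros simp: minus_diff_commute)
    note D = DERIV_mult[OF 1 DERIV_mult[OF DERIV_chain2[OF hq_has_derivative d] DERIV_chain2[OF hcut_has_derivative d]]]
    have alg: "K * P * (q * c) + (q' * (1 / A) * c + c' * (1 / A) * q) * R = R * (q' / A * c + q * (c' / A)) + K * P * (q * c)"
      for K P q c q' c' A R :: real by (simp add: algebra_simps)
    show ?thesis unfolding H_def[abs_def] H'_def by (rule DERIV_cong[OF D]) (rule alg)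
  qed
  have supp: "H t = 0" if "t \<notin> {a\<^sup>2 * (1 + \<epsilon>)..a\<^sup>2 * (\<beta> - \<epsilon>)}" for t
  proof -
    have "t / a\<^sup>2 \<notin> {1 + \<epsilon>..\<beta> - \<epsilon>}" using that a by (auto simp: field_simps)
    then have "hcut \<beta> n (t / a\<^sup>2) = 0" unfolding \<epsilon>_def using n \<beta> by (intro hcut_support) auto
    then show ?thesis by (simp add: H_def)
  qed
  have pq: "a\<^sup>2 < a\<^sup>2 * (1 + \<epsilon>)" "a\<^sup>2 * (\<beta> - \<epsilon>) < b\<^sup>2"
    using a \<epsilon> by (auto simp: \<beta>_def algebra_simps)
  have b0: "0 < b" using a ab by simp
  let ?G = "\<lambda>x. - (H ((norm x)\<^sup>2) + (norm x)\<^sup>2 * H' ((norm x)\<^sup>2)) * (f x)\<^sup>2 - H ((norm x)\<^sup>2) * (f x * (\<Sum>e\<in>Basis. (x \<bullet> e) * F e x))"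
  have G: "set_integrable lebesgue ?O ?G" "(LINT x:?O|lebesgue. ?G x) = 0"
    by (rule radial_divergence_identity[OF a b0 smooth supp pq deriv f F]; assumption)+
  define C where "C = 31 * k * exp k + 2 * k"
  define D where "D = 2 * (exp k)\<^sup>2 / k"
  let ?L = "\<lambda>x. (norm x)\<^sup>2 powr (- k - 1) * hcut \<beta> n ((norm x)\<^sup>2 / a\<^sup>2) * (f x * f x)"
  let ?c = "\<lambda>x. indicator {3/2..5} ((norm x)\<^sup>2 / a\<^sup>2) * (norm x)\<^sup>2 powr (- k - 1) * (f x * f x)"
  let ?F = "\<lambda>e x. (norm x)\<^sup>2 powr (- k) * (F e x * F e x)"
  have iL: "set_integrable lebesgue ?O ?L" by (rule hardy_weights(3)[OF f(1) f(1)])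
  have ic: "set_integrable lebesgue ?O ?c" by (rule hardy_weights(2)[OF f(1) f(1)]) simp
  have iF: "set_integrable lebesgue ?O (?F e)" if "e \<in> Basis" for e
    by (rule hardy_weights(1)[OF f(2)[OF that] f(2)[OF that]])
  have B: "1 \<in> (Basis :: complex set)" "\<i> \<in> (Basis :: complex set)" by (auto simp: Basis_complex_def)
  have iS: "set_integrable lebesgue ?O (\<lambda>x. ?F 1 x + ?F \<i> x)"
    by (intro set_integral_add(1) iF B)
  have iC: "set_integrable lebesgue ?O (\<lambda>x. C * ?c x)" and iD: "set_integrable lebesgue ?O (\<lambda>x. D * (?F 1 x + ?F \<i> x))"
    using ic iS by (auto intro: set_integrable_mult_right)
  have "k / 8 * (LINT x:?O|lebesgue. ?L x) = (LINT x:?O|lebesgue. k / 8 * ?L x)"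
    by (rule set_integral_mult_right[symmetric])
  also have "\<dots> \<le> (LINT x:?O|lebesgue. ?G x + C * ?c x + D * (?F 1 x + ?F \<i> x))"
  proof (rule set_integral_mono)
    show "set_integrable lebesgue ?O (\<lambda>x. k / 8 * ?L x)" by (rule set_integrable_mult_right) (rule iL)
    show "set_integrable lebesgue ?O (\<lambda>x. ?G x + C * ?c x + D * (?F 1 x + ?F \<i> x))"
      by (intro set_integral_add(1) G(1) iC iD)
    fix x assume x: "x \<in> ?O"
    have "k / 8 * ?L x \<le> ?G x + C * ?c x + D * (\<Sum>e\<in>Basis. ?F e x)"
      unfolding C_def D_def
      by (rule hardy_pointwise[OF k a annulus_scaled(1,2)[OF x, folded \<beta>_def] \<beta> n refl refl H_def H'_def])
    then show "k / 8 * ?L x \<le> ?G x + C * ?c x + D * (?F 1 x + ?F \<i> x)" by (simp add: Basis_complex_def)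
  qed
  also have "\<dots> = (LINT x:?O|lebesgue. ?G x) + C * (LINT x:?O|lebesgue. ?c x)
      + D * ((LINT x:?O|lebesgue. ?F 1 x) + (LINT x:?O|lebesgue. ?F \<i> x))"
    unfolding set_integral_add(2)[OF set_integral_add(1)[OF G(1) iC] iD] set_integral_add(2)[OF G(1) iC]
      set_integral_mult_right set_integral_add(2)[OF iF[OF B(1)] iF[OF B(2)]] ..
  finally show ?thesis unfolding G(2) C_def D_def \<beta>_def by (simp add: Basis_complex_def)
qed

text \<open>The product rule for \<open>v\<close> and f = partial_e v, tested with the squared
  cutoff, expresses the integral of f^2 through v w and v f. Only one direction \<open>e\<close>
  occurs.\<close>

lemma hardy_collar:
  fixes v f w :: "complex \<Rightarrow> real"
  assumes sq: "square_integrable (annulus a b) v" "square_integrable (annulus a b) f" "square_integrable (annulus a b) w"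
    and e: "e \<in> Basis" and d: "has_weak_deriv (annulus a b) [e] v f" "has_weak_deriv (annulus a b) [e] f w"
  shows "(LINT x:annulus a b|lebesgue. indicator {3/2..5} ((norm x)\<^sup>2 / a\<^sup>2) * (norm x)\<^sup>2 powr (- k - 1) * (f x * f x))
    \<le> 2 * exp 2 * ((2 * (k + 233)\<^sup>2 + 1 / 2) * (LINT x:annulus a b|lebesgue. indicator {..6} ((norm x)\<^sup>2 / a\<^sup>2) * (norm x)\<^sup>2 powr (- k - 2) * (v x * v x))
      + 1 / 2 * (LINT x:annulus a b|lebesgue. (norm x)\<^sup>2 powr (- k) * (w x * w x)))"
proof -
  let ?O = "annulus a b"
  define H where "H t = t powr (- k - 1) * (zeta (t / a\<^sup>2))\<^sup>2" for t
  define H' where "H' t = t powr (- k - 1) * (2 * zeta (t / a\<^sup>2) * (flat 2 ((t / a\<^sup>2 - 6/5) * (6 - t / a\<^sup>2)) * (36/5 - 2 * (t / a\<^sup>2)) / a\<^sup>2))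
          + (- k - 1) * t powr (- k - 2) * (zeta (t / a\<^sup>2))\<^sup>2" for t
  have smooth: "smooth_on {0<..} H"
  proof -
    have "smooth_on UNIV (\<lambda>t. zeta (t / a\<^sup>2))"
      using smooth_on_compose[OF open_UNIV smooth_zeta smooth_on_divide_const] by simp
    then have "smooth_on {0<..} (\<lambda>t. zeta (t / a\<^sup>2))" by (auto intro: smooth_on_subset)
    then show ?thesis unfolding H_def[abs_def] by (intro smooth_on_mult smooth_on_powr smooth_on_square) auto
  qed
  have deriv: "(H has_real_derivative H' t) (at t)" if "t > 0" for t
  proof -
    have d: "((\<lambda>t. t / a\<^sup>2) has_real_derivative 1 / a\<^sup>2) (at t)" by (rule DERIV_cdivide[OF DERIV_ident])
    have 1: "((\<lambda>t. t powr (- k - 1)) has_real_derivative (- k - 1) * t powr (- k - 2)) (at t)"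
      using that by (auto intro!: derivative_eq_intros simp: minus_diff_commute)
    have z: "((\<lambda>t. (zeta (t / a\<^sup>2))\<^sup>2) has_real_derivative
        2 * zeta (t / a\<^sup>2) * (flat 2 ((t / a\<^sup>2 - 6/5) * (6 - t / a\<^sup>2)) * (36/5 - 2 * (t / a\<^sup>2)) / a\<^sup>2)) (at t)"
      using DERIV_power[OF DERIV_chain2[OF zeta_has_derivative d], of 2] by (simp add: mult_ac)
    show ?thesis unfolding H_def[abs_def] H'_def
      by (rule DERIV_cong[OF DERIV_mult[OF 1 z]]) (simp only: mult.commute add.commute)
  qed
  have supp: "H t = 0" if "t \<notin> {a\<^sup>2 * (6/5)..a\<^sup>2 * 6}" for t
  proof -
    have "t / a\<^sup>2 \<notin> {6/5..6}" using that a by (auto simp: field_simps)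
    then show ?thesis by (simp add: H_def zeta_bounds(3))
  qed
  have "a\<^sup>2 * 16 \<le> b\<^sup>2" using beta_ge_16 a by (simp add: field_simps)
  then have pq: "a\<^sup>2 < a\<^sup>2 * (6/5)" "a\<^sup>2 * 6 < b\<^sup>2" using a by auto (smt (verit) zero_less_power)
  have b0: "0 < b" using a ab by simp
  define \<eta> where "\<eta> x = H ((norm x)\<^sup>2)" for x :: complex
  have \<eta>: "\<eta> \<in> test_functions ?O"
    unfolding \<eta>_def[abs_def] by (rule radial_test(1)[OF a smooth supp pq b0])
  have d\<eta>: "partial [e] \<eta> \<in> test_functions ?O"
    by (rule test_functions_partial[OF \<eta>]) (use e in auto)
  have int: "set_integrable lebesgue ?O (\<lambda>x. \<phi> x * (h1 x * h2 x))"
    if \<phi>: "\<phi> \<in> test_functions ?O" and h: "square_integrable ?O h1" "square_integrable ?O h2" for \<phi> h1 h2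
  proof -
    obtain B where "\<And>x. \<bar>\<phi> x\<bar> \<le> B" using test_functions_bounded[OF \<phi>] by metis
    then show ?thesis using weighted_integrable[OF h test_functions_borel[OF \<phi>]] by blast
  qed
  let ?G = "\<lambda>x. partial [e] \<eta> x * (v x * f x) + \<eta> x * (v x * w x + f x * f x)"
  note i1 = int[OF d\<eta> sq(1,2)]
  have i2: "set_integrable lebesgue ?O (\<lambda>x. \<eta> x * (v x * w x + f x * f x))"
    unfolding distrib_left by (intro set_integral_add(1) int[OF \<eta>] sq)
  have iG: "set_integrable lebesgue ?O ?G" by (intro set_integral_add(1) i1 i2)
  have G0: "(LINT x:?O|lebesgue. ?G x) = 0"
    unfolding set_integral_add(2)[OF i1 i2]
    using weak_deriv_product_rule[OF open_annulus e \<eta> d(1) d(2) sq(1) sq(2) sq(2) sq(3)] by simp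
  define L where "L = 2 * (k + 233)\<^sup>2 + 1 / 2"
  let ?c = "\<lambda>x. indicator {3/2..5} ((norm x)\<^sup>2 / a\<^sup>2) * (norm x)\<^sup>2 powr (- k - 1) * (f x * f x)"
  let ?v = "\<lambda>x. indicator {..6} ((norm x)\<^sup>2 / a\<^sup>2) * (norm x)\<^sup>2 powr (- k - 2) * (v x * v x)"
  let ?w = "\<lambda>x. (norm x)\<^sup>2 powr (- k) * (w x * w x)"
  have ic: "set_integrable lebesgue ?O ?c" by (rule hardy_weights(2)[OF sq(2) sq(2)]) simp
  have iv: "set_integrable lebesgue ?O (\<lambda>x. L * ?v x)"
    by (rule set_integrable_mult_right) (rule hardy_weights(2)[OF sq(1) sq(1)], simp)
  have iw: "set_integrable lebesgue ?O (\<lambda>x. 1 / 2 * ?w x)"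
    by (rule set_integrable_mult_right) (rule hardy_weights(1)[OF sq(3) sq(3)])
  have "exp (- 2) / 2 * (LINT x:?O|lebesgue. ?c x) = (LINT x:?O|lebesgue. exp (- 2) / 2 * ?c x)"
    by (rule set_integral_mult_right[symmetric])
  also have "\<dots> \<le> (LINT x:?O|lebesgue. ?G x + L * ?v x + 1 / 2 * ?w x)"
  proof (rule set_integral_mono)
    show "set_integrable lebesgue ?O (\<lambda>x. exp (- 2) / 2 * ?c x)" by (rule set_integrable_mult_right) (rule ic)
    show "set_integrable lebesgue ?O (\<lambda>x. ?G x + L * ?v x + 1 / 2 * ?w x)"
      by (intro set_integral_add(1) iG iv iw)
    fix x assume x: "x \<in> ?O"
    define t where "t = (norm x)\<^sup>2"
    have t: "t > 0" using annulus_scaled(3)[OF x] by (simp add: t_def)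
    \<comment> \<open>The lower bound exp(-1) of \<open>zeta\<close> on the collar enters squared;
      the factor 1/2 is what remained after absorption.\<close>
    have "exp (- 2) / 2 * ?c x \<le> 1 / 2 * (\<eta> x * (f x * f x))"
    proof (cases "t / a\<^sup>2 \<in> {3/2..5}")
      case True
      have "(exp (- 1))\<^sup>2 \<le> (zeta (t / a\<^sup>2))\<^sup>2" using zeta_lower[OF True] by (intro power_mono) auto
      moreover have "(exp (- 1))\<^sup>2 = exp (- 2 :: real)" by (simp add: power2_eq_square flip: exp_add)
      ultimately have "exp (- 2) * (t powr (- k - 1) * (f x * f x)) \<le> (zeta (t / a\<^sup>2))\<^sup>2 * (t powr (- k - 1) * (f x * f x))"
        by (intro mult_right_mono) auto
      then show ?thesis using True by (simp add: \<eta>_def H_def t_def[symmetric] mult_ac)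
    next
      case False
      have "0 \<le> \<eta> x * (f x * f x)" by (simp add: \<eta>_def H_def)
      then show ?thesis using False by (simp add: t_def)
    qed
    also have "1 / 2 * (\<eta> x * (f x * f x)) \<le> (H' t * (2 * (x \<bullet> e)) * (v x * f x) + \<eta> x * (v x * w x + f x * f x))
         + L * ?v x + 1 / 2 * ?w x"
      unfolding L_def \<eta>_def t_def[symmetric]
    proof (rule collar_pointwise[OF k a t_def refl t H_def H'_def])
      have "\<bar>x \<bullet> e\<bar>\<^sup>2 \<le> (norm x)\<^sup>2" using Basis_le_norm[OF e, of x] by (intro power_mono) auto
      then show "(x \<bullet> e)\<^sup>2 \<le> t" by (simp add: t_def)
    qed
    also have "H' t * (2 * (x \<bullet> e)) = partial [e] \<eta> x"
      using partial_radial(2)[OF deriv[OF t[unfolded t_def]], of e] unfolding \<eta>_def[abs_def] t_def by simp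
    finally show "exp (- 2) / 2 * ?c x \<le> ?G x + L * ?v x + 1 / 2 * ?w x" .
  qed
  also have "\<dots> = L * (LINT x:?O|lebesgue. ?v x) + 1 / 2 * (LINT x:?O|lebesgue. ?w x)"
    unfolding set_integral_add(2)[OF set_integral_add(1)[OF iG iv] iw] set_integral_add(2)[OF iG iv] G0
      set_integral_mult_right by simp
  finally have "2 * exp 2 * (exp (- 2) / 2 * (LINT x:?O|lebesgue. ?c x))
      \<le> 2 * exp 2 * (L * (LINT x:?O|lebesgue. ?v x) + 1 / 2 * (LINT x:?O|lebesgue. ?w x))"
    by (intro mult_left_mono) auto
  moreover have "2 * exp 2 * (exp (- 2) / 2 * (LINT x:?O|lebesgue. ?c x)) = (LINT x:?O|lebesgue. ?c x)"
    by (simp add: exp_minus)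
  ultimately show ?thesis unfolding L_def by (simp only:)
qed

end

text \<open>8/k undoes the k/8 of \<open>hardy_cutoff\<close>. The first summand is its collar
  constant times the constant of \<open>hardy_collar\<close>, with 1/2 enlarged to 1; the second is
  the constant of the cross term.\<close>

definition hardy_const :: "real \<Rightarrow> real" where
  "hardy_const k = 8 / k * ((31 * k * exp k + 2 * k) * (2 * exp 2 * (2 * (k + 233)\<^sup>2 + 1)) + 2 * (exp k)\<^sup>2 / k)"

lemma set_integral_nonneg_real:
  assumes "\<And>x. x \<in> A \<Longrightarrow> 0 \<le> (f x :: real)"
  shows "0 \<le> (LINT x:A|M. f x)"
  unfolding set_lebesgue_integral_def
  using assms by (intro integral_nonneg_AE AE_I2) (auto simp: indicator_def)

text \<open>\<open>hardy_cutoff\<close> holds for all n >= 16 with a right-hand side independent of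
  \<open>n\<close>, so dominated convergence removes the cutoff on the left;
  \<open>hardy_collar\<close> then replaces the collar integral of f^2.\<close>

lemma hardy_inequality:
  fixes v f :: "complex \<Rightarrow> real" and F :: "complex \<Rightarrow> complex \<Rightarrow> real"
  assumes a: "0 < a" "4 * a \<le> b" and k: "k \<ge> 1"
    and sq: "square_integrable (annulus a b) v" "square_integrable (annulus a b) f"
    "\<And>e. e \<in> Basis \<Longrightarrow> square_integrable (annulus a b) (F e)"
    and e: "e \<in> Basis" and d: "has_weak_deriv (annulus a b) [e] v f"
    and F: "\<And>e. e \<in> Basis \<Longrightarrow> has_weak_deriv (annulus a b) [e] f (F e)"
  shows "(LINT x:annulus a b|lebesgue. (norm x)\<^sup>2 powr (- k - 1) * (f x * f x))
    \<le> hardy_const k * ((LINT x:annulus a b|lebesgue. indicator {..6} ((norm x)\<^sup>2 / a\<^sup>2) * (norm x)\<^sup>2 powr (- k - 2) * (v x * v x))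
      + (\<Sum>e\<in>Basis. LINT x:annulus a b|lebesgue. (norm x)\<^sup>2 powr (- k) * (F e x * F e x)))"
proof -
  let ?O = "annulus a b"
  define J where "J = (LINT x:?O|lebesgue. indicator {3/2..5} ((norm x)\<^sup>2 / a\<^sup>2) * (norm x)\<^sup>2 powr (- k - 1) * (f x * f x))"
  define V where "V = (LINT x:?O|lebesgue. indicator {..6} ((norm x)\<^sup>2 / a\<^sup>2) * (norm x)\<^sup>2 powr (- k - 2) * (v x * v x))"
  define W where "W e = (LINT x:?O|lebesgue. (norm x)\<^sup>2 powr (- k) * (F e x * F e x))" for e
  define C where "C = 31 * k * exp k + 2 * k"
  define D where "D = 2 * (exp k)\<^sup>2 / k"
  define L where "L = 2 * (k + 233)\<^sup>2"
  have W0: "0 \<le> W e" for e unfolding W_def by (intro set_integral_nonneg_real) simp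
  have V0: "0 \<le> V" unfolding V_def by (intro set_integral_nonneg_real) simp
  have We: "W e \<le> sum W Basis" using W0 e by (intro member_le_sum) auto
  have L0: "L \<ge> 0" and C0: "C \<ge> 0" and D0: "D \<ge> 0" using k by (auto simp: L_def C_def D_def)
  have "J \<le> 2 * exp 2 * ((L + 1 / 2) * V + 1 / 2 * W e)"
    unfolding J_def V_def W_def L_def
    by (rule hardy_collar[OF a k sq(1,2) sq(3)[OF e] e d F[OF e]])
  \<comment> \<open>Both coefficients are enlarged to L + 1, and the one direction \<open>e\<close>
    to the sum over all, to reach a single constant.\<close>
  also have "\<dots> \<le> 2 * exp 2 * ((L + 1) * V + (L + 1) * sum W Basis)"
    using V0 We W0[of e] L0 by (intro mult_left_mono add_mono mult_right_mono mult_mono) auto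
  finally have J: "J \<le> 2 * exp 2 * (L + 1) * (V + sum W Basis)" by (simp add: algebra_simps)
  let ?R = "C * J + D * sum W Basis"
  have lim: "(\<lambda>n. LINT x:?O|lebesgue. (norm x)\<^sup>2 powr (- k - 1) * hcut (b\<^sup>2 / a\<^sup>2) (real n) ((norm x)\<^sup>2 / a\<^sup>2) * (f x * f x))
      \<longlonglongrightarrow> (LINT x:?O|lebesgue. (norm x)\<^sup>2 powr (- k - 1) * (f x * f x))"
    unfolding set_lebesgue_integral_def
  proof (rule integral_dominated_convergence[where w="\<lambda>x. indicator ?O x *\<^sub>R ((norm x)\<^sup>2 powr (- k - 1) * (f x * f x))"])
    show i: "integrable lebesgue (\<lambda>x. indicator ?O x *\<^sub>R ((norm x)\<^sup>2 powr (- k - 1) * (f x * f x)))"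
      using hardy_weights(1)[OF a k sq(2) sq(2)] unfolding set_integrable_def .
    then show "(\<lambda>x. indicator ?O x *\<^sub>R ((norm x)\<^sup>2 powr (- k - 1) * (f x * f x))) \<in> borel_measurable lebesgue"
      by (rule borel_measurable_integrable)
    fix n :: nat
    show "(\<lambda>x. indicator ?O x *\<^sub>R ((norm x)\<^sup>2 powr (- k - 1) * hcut (b\<^sup>2 / a\<^sup>2) (real n) ((norm x)\<^sup>2 / a\<^sup>2) * (f x * f x))) \<in> borel_measurable lebesgue"
      using hardy_weights(3)[OF a k sq(2) sq(2)] unfolding set_integrable_def by (rule borel_measurable_integrable)
    show "AE x in lebesgue. norm (indicator ?O x *\<^sub>R ((norm x)\<^sup>2 powr (- k - 1) * hcut (b\<^sup>2 / a\<^sup>2) (real n) ((norm x)\<^sup>2 / a\<^sup>2) * (f x * f x)))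
        \<le> indicator ?O x *\<^sub>R ((norm x)\<^sup>2 powr (- k - 1) * (f x * f x))"
    proof (intro AE_I2)
      fix x
      have "(norm x)\<^sup>2 powr (- k - 1) * hcut (b\<^sup>2 / a\<^sup>2) (real n) ((norm x)\<^sup>2 / a\<^sup>2) * (f x * f x)
          \<le> (norm x)\<^sup>2 powr (- k - 1) * 1 * (f x * f x)"
        by (intro mult_right_mono mult_left_mono hcut_le_1) auto
      moreover have "0 \<le> (norm x)\<^sup>2 powr (- k - 1) * hcut (b\<^sup>2 / a\<^sup>2) (real n) ((norm x)\<^sup>2 / a\<^sup>2) * (f x * f x)"
        by (simp add: hcut_nonneg)
      ultimately show "norm (indicator ?O x *\<^sub>R ((norm x)\<^sup>2 powr (- k - 1) * hcut (b\<^sup>2 / a\<^sup>2) (real n) ((norm x)\<^sup>2 / a\<^sup>2) * (f x * f x)))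
        \<le> indicator ?O x *\<^sub>R ((norm x)\<^sup>2 powr (- k - 1) * (f x * f x))"
        by (cases "x \<in> ?O") auto
    qed
  next
    show "AE x in lebesgue. (\<lambda>n. indicator ?O x *\<^sub>R ((norm x)\<^sup>2 powr (- k - 1) * hcut (b\<^sup>2 / a\<^sup>2) (real n) ((norm x)\<^sup>2 / a\<^sup>2) * (f x * f x)))
        \<longlonglongrightarrow> indicator ?O x *\<^sub>R ((norm x)\<^sup>2 powr (- k - 1) * (f x * f x))"
    proof (intro AE_I2)
      fix x
      show "(\<lambda>n. indicator ?O x *\<^sub>R ((norm x)\<^sup>2 powr (- k - 1) * hcut (b\<^sup>2 / a\<^sup>2) (real n) ((norm x)\<^sup>2 / a\<^sup>2) * (f x * f x)))
        \<longlonglongrightarrow> indicator ?O x *\<^sub>R ((norm x)\<^sup>2 powr (- k - 1) * (f x * f x))"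
      proof (cases "x \<in> ?O")
        case True
        have "(\<lambda>n. (norm x)\<^sup>2 powr (- k - 1) * hcut (b\<^sup>2 / a\<^sup>2) (real n) ((norm x)\<^sup>2 / a\<^sup>2) * (f x * f x))
          \<longlonglongrightarrow> (norm x)\<^sup>2 powr (- k - 1) * 1 * (f x * f x)"
          by (intro tendsto_mult tendsto_const hcut_tendsto_1 annulus_scaled[OF a k True])
        then show ?thesis using True by simp
      qed simp
    qed
  qed
  have "k / 8 * (LINT x:?O|lebesgue. (norm x)\<^sup>2 powr (- k - 1) * (f x * f x)) \<le> ?R"
  proof (rule LIMSEQ_le_const2[OF tendsto_mult_left[OF lim]])
    show "\<exists>N. \<forall>n\<ge>N. k / 8 * (LINT x:?O|lebesgue. (norm x)\<^sup>2 powr (- k - 1) * hcut (b\<^sup>2 / a\<^sup>2) (real n) ((norm x)\<^sup>2 / a\<^sup>2) * (f x * f x)) \<le> ?R"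
    proof (intro exI[of _ 16] allI impI)
      fix n :: nat assume "n \<ge> 16"
      then have n: "real n \<ge> 16" by simp
      show "k / 8 * (LINT x:?O|lebesgue. (norm x)\<^sup>2 powr (- k - 1) * hcut (b\<^sup>2 / a\<^sup>2) (real n) ((norm x)\<^sup>2 / a\<^sup>2) * (f x * f x)) \<le> ?R"
        unfolding C_def D_def J_def W_def by (rule hardy_cutoff[OF a k sq(2,3) F n])
    qed
  qed
  also have "?R \<le> C * (2 * exp 2 * (L + 1) * (V + sum W Basis)) + D * (V + sum W Basis)"
    using J C0 D0 V0 by (intro add_mono mult_left_mono) auto
  also have "\<dots> = (C * (2 * exp 2 * (L + 1)) + D) * (V + sum W Basis)" by (simp add: algebra_simps)
  finally have "8 / k * (k / 8 * (LINT x:?O|lebesgue. (norm x)\<^sup>2 powr (- k - 1) * (f x * f x)))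
      \<le> 8 / k * ((C * (2 * exp 2 * (L + 1)) + D) * (V + sum W Basis))"
    using k by (intro mult_left_mono) auto
  moreover have "8 / k * (k / 8 * X) = X" for X using k by simp
  ultimately show ?thesis
    unfolding hardy_const_def V_def[symmetric] W_def[symmetric] C_def[symmetric] D_def[symmetric] L_def[symmetric]
    by (simp only: mult.assoc)
qed

section \<open>Integrability up to null sets and bounded weights\<close>

lemma set_integral_AE_cong:
  fixes f g :: "'a::euclidean_space \<Rightarrow> real"
  assumes f: "set_integrable lebesgue \<Omega> f" and ae: "AE x in lebesgue. x \<in> \<Omega> \<longrightarrow> f x = g x"
  shows "set_integrable lebesgue \<Omega> g" "(LINT x:\<Omega>|lebesgue. g x) = (LINT x:\<Omega>|lebesgue. f x)"
proof -
  have eq: "AE x in lebesgue. indicator \<Omega> x *\<^sub>R f x = indicator \<Omega> x *\<^sub>R g x"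
    using ae by (rule eventually_mono) (auto simp: indicator_def)
  have fm: "(\<lambda>x. indicator \<Omega> x *\<^sub>R f x) \<in> borel_measurable lebesgue"
    using f unfolding set_integrable_def by (rule borel_measurable_integrable)
  have gm: "(\<lambda>x. indicator \<Omega> x *\<^sub>R g x) \<in> borel_measurable lebesgue"
    by (rule borel_measurable_AE[OF fm eq])
  show "set_integrable lebesgue \<Omega> g" using f integrable_cong_AE[OF fm gm eq] by (simp add: set_integrable_def)
  show "(LINT x:\<Omega>|lebesgue. g x) = (LINT x:\<Omega>|lebesgue. f x)"
    unfolding set_lebesgue_integral_def by (rule integral_cong_AE[OF fm gm eq, symmetric])
qed

lemma square_integrable_AE_cong:
  fixes f g :: "'a::euclidean_space \<Rightarrow> real"
  assumes f: "square_integrable \<Omega> f" and ae: "AE x in lebesgue. x \<in> \<Omega> \<longrightarrow> f x = g x"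
  shows "square_integrable \<Omega> g"
proof -
  have eq: "AE x in lebesgue. indicator \<Omega> x *\<^sub>R f x = indicator \<Omega> x *\<^sub>R g x"
    using ae by (rule eventually_mono) (auto simp: indicator_def)
  have "set_borel_measurable lebesgue \<Omega> g"
    using f borel_measurable_AE[OF _ eq] by (auto simp: square_integrable_def set_borel_measurable_def)
  moreover have "AE x in lebesgue. x \<in> \<Omega> \<longrightarrow> (norm (f x))\<^sup>2 = (norm (g x))\<^sup>2"
    using ae by (rule eventually_mono) auto
  then have "set_integrable lebesgue \<Omega> (\<lambda>x. (norm (g x))\<^sup>2)"
    by (rule set_integral_AE_cong(1)[rotated]) (use f in \<open>simp add: square_integrable_def\<close>)
  ultimately show ?thesis unfolding square_integrable_def by simp
qed

lemma square_integrable_mult: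
  fixes f w :: "'a::euclidean_space \<Rightarrow> real"
  assumes f: "square_integrable \<Omega> f" and w: "w \<in> borel_measurable borel" "\<And>x. x \<in> \<Omega> \<Longrightarrow> \<bar>w x\<bar> \<le> B"
  shows "square_integrable \<Omega> (\<lambda>x. w x * f x)"
proof -
  have wm: "w \<in> borel_measurable lebesgue" using w(1) by (simp add: measurable_completion)
  have "(\<lambda>x. w x * (indicator \<Omega> x *\<^sub>R f x)) \<in> borel_measurable lebesgue"
    by (rule borel_measurable_times[OF wm square_integrable_indicator(1)[OF f]])
  then have 1: "set_borel_measurable lebesgue \<Omega> (\<lambda>x. w x * f x)"
    unfolding set_borel_measurable_def mult_scaleR_right .
  have "(\<lambda>x. (w x)\<^sup>2) \<in> borel_measurable borel" using w(1) by measurable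
  moreover have "\<bar>(w x)\<^sup>2\<bar> \<le> B\<^sup>2" if "x \<in> \<Omega>" for x
    using power_mono[OF w(2)[OF that], of 2] by simp
  ultimately have *: "set_integrable lebesgue \<Omega> (\<lambda>x. (w x)\<^sup>2 * (f x * f x))"
    by (rule weighted_integrable[OF f f])
  have "(w x)\<^sup>2 * (f x * f x) = (norm (w x * f x))\<^sup>2" for x
    by (simp add: power_mult_distrib power2_eq_square)
  with * have "set_integrable lebesgue \<Omega> (\<lambda>x. (norm (w x * f x))\<^sup>2)" by (simp only:)
  with 1 show ?thesis unfolding square_integrable_def by blast
qed

lemma square_integrable_add:
  fixes f g :: "'a::euclidean_space \<Rightarrow> real"
  assumes f: "square_integrable \<Omega> f" and g: "square_integrable \<Omega> g"
  shows "square_integrable \<Omega> (\<lambda>x. f x + g x)"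
proof -
  have "(\<lambda>x. indicator \<Omega> x *\<^sub>R f x + indicator \<Omega> x *\<^sub>R g x) \<in> borel_measurable lebesgue"
    by (rule borel_measurable_add[OF square_integrable_indicator(1)[OF f] square_integrable_indicator(1)[OF g]])
  then have 1: "set_borel_measurable lebesgue \<Omega> (\<lambda>x. f x + g x)"
    unfolding set_borel_measurable_def scaleR_add_right .
  have i: "set_integrable lebesgue \<Omega> (\<lambda>x. c * (h1 x * h2 x))"
    if "square_integrable \<Omega> h1" "square_integrable \<Omega> h2" for c :: real and h1 h2
    using weighted_integrable[OF that, of "\<lambda>x. c" "\<bar>c\<bar>"] by simp
  have *: "set_integrable lebesgue \<Omega> (\<lambda>x. (1 * (f x * f x) + 2 * (f x * g x)) + 1 * (g x * g x))"
    by (intro set_integral_add(1) i f g)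
  have "(1 * (f x * f x) + 2 * (f x * g x)) + 1 * (g x * g x) = (norm (f x + g x))\<^sup>2" for x
    by (simp add: power2_eq_square algebra_simps)
  with * have "set_integrable lebesgue \<Omega> (\<lambda>x. (norm (f x + g x))\<^sup>2)" by (simp only:)
  with 1 show ?thesis unfolding square_integrable_def by blast
qed

section \<open>The conjugated operators\<close>

lemma has_weak_deriv_cong_right:
  fixes f :: "'a::euclidean_space \<Rightarrow> real"
  assumes "has_weak_deriv \<Omega> es f g" "\<And>x. x \<in> \<Omega> \<Longrightarrow> g x = g' x"
  shows "has_weak_deriv \<Omega> es f g'"
proof -
  have 1: "locally_integrable \<Omega> g'"
    unfolding locally_integrable_def set_integrable_def
  proof (intro allI impI)
    fix K assume K: "compact K \<and> K \<subseteq> \<Omega>"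
    then have "(\<lambda>x. indicator K x *\<^sub>R g' x) = (\<lambda>x. indicator K x *\<^sub>R g x)"
      using assms(2) by (auto simp: indicator_def fun_eq_iff)
    then show "integrable lebesgue (\<lambda>x. indicator K x *\<^sub>R g' x)"
      using has_weak_deriv_locally_integrable(2)[OF assms(1)] K
      by (simp add: locally_integrable_def set_integrable_def)
  qed
  have "(\<lambda>x. indicator \<Omega> x *\<^sub>R (\<phi> x *\<^sub>R g' x)) = (\<lambda>x. indicator \<Omega> x *\<^sub>R (\<phi> x *\<^sub>R g x))" for \<phi> :: "'a \<Rightarrow> real"
    using assms(2) by (auto simp: indicator_def fun_eq_iff)
  then have "(LINT x:\<Omega>|lebesgue. \<phi> x *\<^sub>R g' x) = (LINT x:\<Omega>|lebesgue. \<phi> x *\<^sub>R g x)" for \<phi> :: "'a \<Rightarrow> real"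
    by (simp add: set_lebesgue_integral_def)
  then show ?thesis
    using has_weak_derivI[OF has_weak_deriv_locally_integrable(1)[OF assms(1)] 1, of es] has_weak_deriv_eq[OF assms(1)]
    by simp
qed

text \<open>One function \<open>g\<close> of the list of directions collects all weak derivatives.
  The empty list takes care of \<open>u\<close> itself: its weak derivative of order zero is square
  integrable and agrees with \<open>u\<close> almost everywhere.\<close>

lemma sobolev2_derivs:
  fixes u :: "'a::euclidean_space \<Rightarrow> real"
  assumes "open \<Omega>" "u \<in> sobolev2 n \<Omega>"
  obtains g where "\<forall>es. set es \<subseteq> Basis \<and> length es \<le> n
      \<longrightarrow> has_weak_deriv \<Omega> es u (g es) \<and> square_integrable \<Omega> (g es)"
    "square_integrable \<Omega> u"
proof -
  have "\<forall>es. \<exists>g. set es \<subseteq> Basis \<and> length es \<le> n \<longrightarrow> has_weak_deriv \<Omega> es u g \<and> square_integrable \<Omega> g"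
    using assms(2) by (auto simp: sobolev2_def)
  from choice[OF this] obtain g where g: "\<forall>es. set es \<subseteq> Basis \<and> length es \<le> n \<longrightarrow> has_weak_deriv \<Omega> es u (g es) \<and> square_integrable \<Omega> (g es)" by blast
  have g0: "has_weak_deriv \<Omega> [] u (g [])" "square_integrable \<Omega> (g [])" using g by auto
  have "has_weak_deriv \<Omega> [] u u"
    by (rule has_weak_derivI) (simp_all add: has_weak_deriv_locally_integrable(1)[OF g0(1)])
  then have "AE x in lebesgue. x \<in> \<Omega> \<longrightarrow> g [] x = u x"
    using has_weak_deriv_unique[OF assms(1) _ g0(1)] by simp
  then have "square_integrable \<Omega> u" by (rule square_integrable_AE_cong[OF g0(2)])
  then show ?thesis using that[of g] g by blast
qed

text \<open>At the point \<open>z = (X, Y)\<close> with \<open>t = |z|\<^sup>2\<close> and \<open>c = |z|\<^sup>k\<close>, the function \<open>u\<close> has gradient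
  \<open>(p, q)\<close> and Hessian with diagonal \<open>(r, s)\<close> and off-diagonal entries \<open>w1\<close>, \<open>w2\<close>. The right-hand
  sides are \<open>\<Delta>v\<close> and \<open>\<partial>\<^sub>z\<^sup>2 v\<close>.\<close>

lemma conjugated_laplacian:
  fixes X Y t c k u p q r s :: real
  assumes t: "t = X\<^sup>2 + Y\<^sup>2" "t > 0"
  shows "c * (r + s + 2 * k * ((X / t) * p + (Y / t) * q) + k\<^sup>2 / t * u)
    = c * (r + k * X / t * p + k * X / t * p + (k * (k - 2) * (X * X) / t\<^sup>2 + k / t) * u)
    + c * (s + k * Y / t * q + k * Y / t * q + (k * (k - 2) * (Y * Y) / t\<^sup>2 + k / t) * u)"
proof -
  have "k * (k - 2) * (X * X) / t\<^sup>2 + k * (k - 2) * (Y * Y) / t\<^sup>2 = k * (k - 2) * (X * X + Y * Y) / t\<^sup>2"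
    by (simp only: add_divide_distrib distrib_left)
  also have "X * X + Y * Y = t" using t(1) by (simp add: power2_eq_square)
  also have "k * (k - 2) * t / t\<^sup>2 = k * (k - 2) / t" using t(2) by (simp add: power2_eq_square)
  finally have e: "k * (k - 2) * (X * X) / t\<^sup>2 = k * (k - 2) / t - k * (k - 2) * (Y * Y) / t\<^sup>2" by simp
  \<comment> \<open>The zeroth-order coefficients of the two diagonal entries combine to k^2 /
    |x|^2.\<close>
  have f: "k * (k - 2) / t + 2 * (k / t) = k\<^sup>2 / t"
  proof -
    have "k * (k - 2) + 2 * k = k\<^sup>2" by (simp add: power2_eq_square algebra_simps)
    then show ?thesis by (metis add_divide_distrib times_divide_eq_right)
  qed
  show ?thesis unfolding e f[symmetric] by (simp add: algebra_simps)
qed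

lemma conjugated_dz2:
  fixes X Y t c k u p q r s w1 w2 :: real and z :: complex
  assumes t: "t = X\<^sup>2 + Y\<^sup>2" "t > 0" and z: "z = Complex X Y"
  shows "of_real c * ((1/4) * (of_real r - \<i> * of_real w2 - \<i> * of_real w1 - of_real s)
      + of_real k / z * ((1/2) * (of_real p - \<i> * of_real q)) + of_real (k * (k - 2)) / (4 * z\<^sup>2) * of_real u)
    = (1/4) * Complex
     (c * (r + k * X / t * p + k * X / t * p + (k * (k - 2) * (X * X) / t\<^sup>2 + k / t) * u)
    - c * (s + k * Y / t * q + k * Y / t * q + (k * (k - 2) * (Y * Y) / t\<^sup>2 + k / t) * u))
     (- (c * (w1 + k * Y / t * p + k * X / t * q + (k * (k - 2) * (X * Y) / t\<^sup>2) * u)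
    + c * (w2 + k * X / t * q + k * Y / t * p + (k * (k - 2) * (X * Y) / t\<^sup>2) * u)))"
proof -
  have z0: "z \<noteq> 0" using t z by (auto simp: complex_eq_iff)
  have zz: "z * cnj z = of_real t" unfolding z t(1) by (simp add: complex_eq_iff power2_eq_square)
  \<comment> \<open>Dividing by z is multiplying by its conjugate over t; after that the claim is a
    comparison of real and imaginary parts.\<close>
  have i1: "of_real a / z = of_real (a / t) * cnj z" for a
    using z0 t(2) zz by (simp add: field_simps)
  have i2: "of_real a / (4 * z\<^sup>2) = (1/4) * of_real (a / t\<^sup>2) * (cnj z)\<^sup>2" for a
  proof -
    have "z\<^sup>2 * (cnj z)\<^sup>2 = of_real (t\<^sup>2)" using zz by (simp flip: power_mult_distrib)
    then show ?thesis using z0 t(2) by (simp add: field_simps)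
  qed
  show ?thesis unfolding i1 i2
    by (simp add: complex_eq_iff z power2_eq_square diff_divide_distrib add_divide_distrib algebra_simps)
qed

lemma complex_Basis_cases: "e \<in> (Basis :: complex set) \<longleftrightarrow> e = 1 \<or> e = \<i>"
  by (auto simp: Basis_complex_def)

text \<open>The Hardy inequality for both first derivatives of v = |x|^k u, translated back to
  \<open>u\<close>. The factor 24 is 2 for the weights on the left, times 2 for the two directions,
  times the 6 from the weight of u^2 on |x|^2 <= 6 a^2.\<close>

lemma weighted_estimate:
  assumes a: "0 < a" "4 * a \<le> b" and m: "m \<ge> 2" and u: "u \<in> sobolev2 2 (annulus a b)"
    and \<beta>: "0 < \<beta>" "\<beta> < 1/2" and \<gamma>: "0 < \<gamma>"
  shows "(LINT x:annulus a b|lebesgue.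
                1 / (norm x)\<^sup>2 * (norm (weak_grad (annulus a b) u x + ((m - 1) * u x) *\<^sub>R inversion x))\<^sup>2
                * ((norm x / b) powr (2 * \<gamma>) + (a / norm x) powr (2 * \<gamma>)))
    \<le> 24 * hardy_const (m - 1) * ((LINT x:annulus a b|lebesgue.
                      (u x)\<^sup>2 / (norm x) ^ 4
                      * ((norm x / b) powr (4 * \<beta>) + (a / norm x) powr (4 * \<beta>)))
                   + (LINT x:annulus a b|lebesgue. (L_op (annulus a b) m u x)\<^sup>2)
                   + (LINT z:annulus a b|lebesgue. (norm (frakL_op (annulus a b) m u z))\<^sup>2))"
proof -
  let ?O = "annulus a b"
  note O = open_annulus[of a b]
  define k where "k = m - 1"
  have k: "k \<ge> 1" using m by (simp add: k_def)
  have b0: "0 < b" using a by simp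
  obtain g where g: "\<forall>es. set es \<subseteq> Basis \<and> length es \<le> 2
      \<longrightarrow> has_weak_deriv ?O es u (g es) \<and> square_integrable ?O (g es)"
    and su: "square_integrable ?O u"
    using sobolev2_derivs[OF O u] by metis
  have g1: "has_weak_deriv ?O [e] u (g [e])" "square_integrable ?O (g [e])" if "e \<in> Basis" for e
    using that g[THEN spec, of "[e]"] by auto
  have g2: "has_weak_deriv ?O [e, e'] u (g [e, e'])" "square_integrable ?O (g [e, e'])"
    if "e \<in> Basis" "e' \<in> Basis" for e e'
    using that g[THEN spec, of "[e, e']"] by auto

  \<comment> \<open>\<open>T p x\<close> is |x|^(2p): powers of |x|^2 are smooth off the origin and
    multiply by adding exponents. The conjugating factor |x|^k is \<open>T (k/2)\<close>.\<close>
  define T where "T p x = (norm x)\<^sup>2 powr p" for p and x :: complex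
  have Tb: "\<exists>B. \<forall>x\<in>?O. \<bar>T p x\<bar> \<le> B" for p using powr_norm_bounded[OF a(1)] unfolding T_def by metis
  have Tm [measurable]: "T p \<in> borel_measurable borel" for p unfolding T_def[abs_def] by (rule powr_norm_measurable)
  have Ts: "smooth_on ?O (T p)" for p
    unfolding T_def[abs_def] by (rule smooth_on_subset[OF smooth_on_powr_norm]) (use a in \<open>auto simp: annulus_iff\<close>)
  have xs: "smooth_on ?O (\<lambda>x. x \<bullet> e)" for e by simp
  have tpos: "(norm x)\<^sup>2 > 0" if "x \<in> ?O" for x using that a by (auto simp: annulus_iff)
  have Td: "((\<lambda>t. t powr p) has_real_derivative p * t powr (p - 1)) (at t)" if "t > 0" for p t :: real
    using that by (auto intro!: derivative_eq_intros)
  have partT: "partial [e] (T p) x = p * T (p - 1) x * (2 * (x \<bullet> e))" if "x \<in> ?O" for e p x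
    using partial_radial(2)[OF Td[OF tpos[OF that]], of e] unfolding T_def[abs_def] .
  have partT2: "partial [e] (\<lambda>x. (x \<bullet> e') * T p x) x
      = (x \<bullet> e') * (p * T (p - 1) x * (2 * (x \<bullet> e))) + (e \<bullet> e') * T p x" if "x \<in> ?O" for e e' p x
    using partial_radial(3)[OF Td[OF tpos[OF that]], of e e'] unfolding T_def[abs_def] .

  define v where "v x = T (k/2) x * u x" for x
  \<comment> \<open>The first and second weak derivatives of \<open>v\<close>, spelled out by the
    product rule; in \<open>V2 e e'\<close> the direction \<open>e\<close> is differentiated
    first.\<close>
  define V1 where "V1 e x = T (k/2) x * g [e] x + k * ((x \<bullet> e) * T (k/2 - 1) x) * u x" for e x
  define V2 where "V2 e e' x = (T (k/2) x * g [e, e'] x + k * ((x \<bullet> e') * T (k/2 - 1) x) * g [e] x)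
      + k * (((x \<bullet> e) * T (k/2 - 1) x) * g [e'] x
          + ((x \<bullet> e) * ((k/2 - 1) * T (k/2 - 1 - 1) x * (2 * (x \<bullet> e'))) + (e' \<bullet> e) * T (k/2 - 1) x) * u x)" for e e' x
  have V1: "has_weak_deriv ?O [e] v (V1 e)" if e: "e \<in> Basis" for e
    unfolding v_def[abs_def]
    by (rule has_weak_deriv_cong_right[OF has_weak_deriv_smooth_mult[OF O e Ts g1(1)[OF e]]])
       (simp add: V1_def partT del: partial.simps)
  have V2: "has_weak_deriv ?O [e'] (V1 e) (V2 e e')" if e: "e \<in> Basis" "e' \<in> Basis" for e e'
  proof -
    have ge: "has_weak_deriv ?O [e'] (g [e]) (g [e, e'])"
      by (rule has_weak_deriv_iterate[OF g1(1)[OF e(1)] g2(1)[OF e] e(2)])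
    have 1: "has_weak_deriv ?O [e'] (\<lambda>x. T (k/2) x * g [e] x)
        (\<lambda>x. T (k/2) x * g [e, e'] x + partial [e'] (T (k/2)) x * g [e] x)"
      by (rule has_weak_deriv_smooth_mult[OF O e(2) Ts ge])
    have 2: "has_weak_deriv ?O [e'] (\<lambda>x. ((x \<bullet> e) * T (k/2 - 1) x) * u x)
        (\<lambda>x. ((x \<bullet> e) * T (k/2 - 1) x) * g [e'] x + partial [e'] (\<lambda>x. (x \<bullet> e) * T (k/2 - 1) x) x * u x)"
      by (rule has_weak_deriv_smooth_mult[OF O e(2) smooth_on_mult[OF O xs Ts] g1(1)[OF e(2)]])
    have es: "set [e'] \<subseteq> Basis" using e by simp
    have 3: "has_weak_deriv ?O [e'] (\<lambda>x. k * (((x \<bullet> e) * T (k/2 - 1) x) * u x))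
        (\<lambda>x. k * (((x \<bullet> e) * T (k/2 - 1) x) * g [e'] x + partial [e'] (\<lambda>x. (x \<bullet> e) * T (k/2 - 1) x) x * u x))"
      by (rule has_weak_deriv_bounded_linear[OF bounded_linear_mult_right 2 es])
    have V1eq: "V1 e = (\<lambda>x. T (k/2) x * g [e] x + k * (((x \<bullet> e) * T (k/2 - 1) x) * u x))"
      by (simp add: V1_def fun_eq_iff)
    show ?thesis
      unfolding V1eq
      by (rule has_weak_deriv_cong_right[OF has_weak_deriv_add[OF 1 3 es]])
         (simp add: V2_def partT partT2 del: partial.simps)
  qed
  have xb: "\<bar>x \<bullet> e\<bar> \<le> b" if "x \<in> ?O" "e \<in> Basis" for x e
    using Basis_le_norm[OF that(2), of x] that(1) by (auto simp: annulus_iff)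
  have sqm: "square_integrable ?O (\<lambda>x. w x * f x)"
    if f: "square_integrable ?O f" and w: "w \<in> borel_measurable borel" "\<exists>B. \<forall>x\<in>?O. \<bar>w x\<bar> \<le> B" for f w :: "complex \<Rightarrow> real"
    using square_integrable_mult[OF f w(1)] w(2) by blast
  have xm [measurable]: "(\<lambda>x::complex. x \<bullet> e) \<in> borel_measurable borel" for e by measurable
  have bm: "\<exists>B. \<forall>x\<in>?O. \<bar>w1 x * w2 x\<bar> \<le> B" if w: "\<exists>B. \<forall>x\<in>?O. \<bar>w1 x\<bar> \<le> B" "\<exists>B. \<forall>x\<in>?O. \<bar>w2 x\<bar> \<le> B" for w1 w2 :: "complex \<Rightarrow> real"
  proof -
    obtain B1 B2 where B: "\<forall>x\<in>?O. \<bar>w1 x\<bar> \<le> B1" "\<forall>x\<in>?O. \<bar>w2 x\<bar> \<le> B2" using w by blast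
    then have "\<bar>w1 x * w2 x\<bar> \<le> \<bar>B1\<bar> * \<bar>B2\<bar>" if "x \<in> ?O" for x
      unfolding abs_mult using that by (intro mult_mono) (auto intro: order_trans[OF _ abs_ge_self])
    then show ?thesis by blast
  qed
  have bc: "\<exists>B. \<forall>x\<in>?O. \<bar>c\<bar> \<le> (B::real)" for c by blast
  have bx: "\<exists>B. \<forall>x\<in>?O. \<bar>x \<bullet> e\<bar> \<le> B" if "e \<in> Basis" for e using xb[OF _ that] by blast
  have sv: "square_integrable ?O v"
    unfolding v_def[abs_def] by (rule sqm[OF su Tm Tb])
  have sV1: "square_integrable ?O (V1 e)" if e: "e \<in> Basis" for e
    unfolding V1_def[abs_def]
  proof (rule square_integrable_add)
    show "square_integrable ?O (\<lambda>x. T (k/2) x * g [e] x)" by (rule sqm[OF g1(2)[OF e] Tm Tb])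
    show "square_integrable ?O (\<lambda>x. k * ((x \<bullet> e) * T (k/2 - 1) x) * u x)"
      by (rule sqm[OF su]) (measurable, intro bm bc bx[OF e] Tb)
  qed
  have sV2: "square_integrable ?O (V2 e e')" if e: "e \<in> Basis" "e' \<in> Basis" for e e'
  proof -
    \<comment> \<open>Regrouped, with 2 k (k/2 - 1) collected as k (k - 2), into bounded weights
      times \<open>u\<close> or one of its weak derivatives.\<close>
    have V2eq: "V2 e e' = (\<lambda>x. (T (k/2) x * g [e, e'] x + (k * ((x \<bullet> e') * T (k/2 - 1) x)) * g [e] x)
      + ((k * ((x \<bullet> e) * T (k/2 - 1) x)) * g [e'] x
        + (((k * (k - 2)) * (((x \<bullet> e) * (x \<bullet> e')) * T (k/2 - 1 - 1) x)) * u x + ((k * (e' \<bullet> e)) * T (k/2 - 1) x) * u x)))"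
      by (simp add: V2_def fun_eq_iff algebra_simps)
    show ?thesis unfolding V2eq
    proof (intro square_integrable_add)
      show "square_integrable ?O (\<lambda>x. T (k/2) x * g [e, e'] x)" by (rule sqm[OF g2(2)[OF e] Tm Tb])
      show "square_integrable ?O (\<lambda>x. k * ((x \<bullet> e') * T (k/2 - 1) x) * g [e] x)"
        by (rule sqm[OF g1(2)[OF e(1)]]) (measurable, intro bm bc bx[OF e(2)] Tb)
      show "square_integrable ?O (\<lambda>x. k * ((x \<bullet> e) * T (k/2 - 1) x) * g [e'] x)"
        by (rule sqm[OF g1(2)[OF e(2)]]) (measurable, intro bm bc bx[OF e(1)] Tb)
      show "square_integrable ?O (\<lambda>x. (k * (k - 2)) * (((x \<bullet> e) * (x \<bullet> e')) * T (k/2 - 1 - 1) x) * u x)"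
        by (rule sqm[OF su]) (measurable, intro bm bc bx e Tb)
      show "square_integrable ?O (\<lambda>x. (k * (e' \<bullet> e)) * T (k/2 - 1) x * u x)"
        by (rule sqm[OF su]) (measurable, intro bm bc Tb)
    qed
  qed
  note B = complex_Basis_cases
  have B1: "1 \<in> (Basis :: complex set)" "\<i> \<in> (Basis :: complex set)" by (auto simp: B)

  define Jv where "Jv = (LINT x:?O|lebesgue. indicator {..6} ((norm x)\<^sup>2 / a\<^sup>2) * T (- k - 2) x * (v x * v x))"
  define J2 where "J2 e e' = (LINT x:?O|lebesgue. T (- k) x * (V2 e e' x * V2 e e' x))" for e e'
  have hardy: "(LINT x:?O|lebesgue. T (- k - 1) x * (V1 e x * V1 e x)) \<le> hardy_const k * (Jv + (J2 e 1 + J2 e \<i>))"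
    if e: "e \<in> Basis" for e
  proof -
    have "(LINT x:?O|lebesgue. T (- k - 1) x * (V1 e x * V1 e x)) \<le> hardy_const k * (Jv + (\<Sum>e'\<in>Basis. J2 e e'))"
      unfolding Jv_def J2_def T_def
      by (rule hardy_inequality[OF a k sv sV1[OF e] sV2[OF e] e V1[OF e] V2[OF e]])
    then show ?thesis by (simp add: Basis_complex_def)
  qed

  have Tp: "T p x * T q x = T (p + q) x" for p q x by (simp add: T_def powr_add)
  have T0: "T 0 x = 1" if "x \<in> ?O" for x using tpos[OF that] by (simp add: T_def)
  have Tt: "T (p - 1) x = T p x / (norm x)\<^sup>2" if "x \<in> ?O" for p x
    using tpos[OF that] by (simp add: T_def powr_diff)
  have tt: "(norm x)\<^sup>2 = (x \<bullet> 1)\<^sup>2 + (x \<bullet> \<i>)\<^sup>2" for x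
    using inner_Basis_complex_sum[of x] by (simp add: Basis_complex_def)

  \<comment> \<open>Both bases are at most 1 on the annulus, so each power with positive exponent is
    at most 1.\<close>
  have bw: "0 \<le> (norm x / b) powr p + (a / norm x) powr p" "(norm x / b) powr p + (a / norm x) powr p \<le> 2"
    if "x \<in> ?O" "p > 0" for p x
  proof -
    have "norm x / b \<le> 1" "a / norm x \<le> 1" using that a b0 by (auto simp: annulus_iff divide_le_eq_1)
    then have "(norm x / b) powr p \<le> 1 powr p" "(a / norm x) powr p \<le> 1 powr p"
      using that a b0 by (intro powr_mono2; auto)+
    then show "(norm x / b) powr p + (a / norm x) powr p \<le> 2" by simp
  qed simp

  \<comment> \<open>The operators are defined by chosen representatives, so each pointwise identity
    below holds almost everywhere and is used under an integral.\<close>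
  note aeD = weak_deriv_AE_eq[OF O]
  have ae1: "AE x in lebesgue. x \<in> ?O \<longrightarrow> weak_deriv ?O [e] u x = g [e] x" if "e \<in> Basis" for e
    by (rule aeD[OF _ g1(1)[OF that]]) (use that in auto)
  have ae2: "AE x in lebesgue. x \<in> ?O \<longrightarrow> weak_deriv ?O [e, e] u x = g [e, e] x" if "e \<in> Basis" for e
    by (rule aeD[OF _ g2(1)[OF that that]]) (use that in auto)

  have lhs: "(LINT x:?O|lebesgue.
                1 / (norm x)\<^sup>2 * (norm (weak_grad ?O u x + ((m - 1) * u x) *\<^sub>R inversion x))\<^sup>2
                * ((norm x / b) powr (2 * \<gamma>) + (a / norm x) powr (2 * \<gamma>)))
        \<le> 2 * ((LINT x:?O|lebesgue. T (- k - 1) x * (V1 1 x * V1 1 x)) + (LINT x:?O|lebesgue. T (- k - 1) x * (V1 \<i> x * V1 \<i> x)))"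
  proof -
    let ?w = "\<lambda>x::complex. T (- k - 1) x * ((norm x / b) powr (2 * \<gamma>) + (a / norm x) powr (2 * \<gamma>))"
    have wm: "?w \<in> borel_measurable borel" by measurable
    have "\<exists>B. \<forall>x\<in>?O. \<bar>?w x\<bar> \<le> B"
    proof (rule bm[OF Tb])
      show "\<exists>B. \<forall>x\<in>?O. \<bar>(norm x / b) powr (2 * \<gamma>) + (a / norm x) powr (2 * \<gamma>)\<bar> \<le> B"
        using bw \<gamma> by (intro exI[of _ 2] ballI) simp
    qed
    then obtain Bw where Bw: "\<And>x. x \<in> ?O \<Longrightarrow> \<bar>?w x\<bar> \<le> Bw" by blast
    have iw: "set_integrable lebesgue ?O (\<lambda>x. ?w x * (V1 e x * V1 e x))" if "e \<in> Basis" for e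
      by (rule weighted_integrable[OF sV1[OF that] sV1[OF that] wm Bw])
    have iw2: "set_integrable lebesgue ?O (\<lambda>x. ?w x * (V1 1 x * V1 1 x) + ?w x * (V1 \<i> x * V1 \<i> x))"
      by (intro set_integral_add(1) iw B1)
    have iT: "set_integrable lebesgue ?O (\<lambda>x. T (- k - 1) x * (V1 e x * V1 e x))" if "e \<in> Basis" for e
      unfolding T_def by (rule hardy_weights(1)[OF a k sV1[OF that] sV1[OF that]])
    have "AE x in lebesgue. x \<in> ?O \<longrightarrow> ?w x * (V1 1 x * V1 1 x) + ?w x * (V1 \<i> x * V1 \<i> x)
      = 1 / (norm x)\<^sup>2 * (norm (weak_grad ?O u x + ((m - 1) * u x) *\<^sub>R inversion x))\<^sup>2
                * ((norm x / b) powr (2 * \<gamma>) + (a / norm x) powr (2 * \<gamma>))"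
      using ae1[OF B1(1)] ae1[OF B1(2)]
    proof eventually_elim
      case (elim x)
      show ?case
      proof
        assume x: "x \<in> ?O"
        define c where "c = T (k/2) x"
        have c2: "T (- k - 1) x * (c * c) = 1 / (norm x)\<^sup>2"
          using T0[OF x] Tt[OF x, of 0] unfolding c_def Tp by simp
        have V1x: "V1 e x = c * (g [e] x + k * u x * (1 / (norm x)\<^sup>2 * (x \<bullet> e)))" for e
          unfolding V1_def Tt[OF x] c_def by (simp add: algebra_simps)
        have "weak_grad ?O u x + ((m - 1) * u x) *\<^sub>R inversion x
           = Complex (g [1] x + k * u x * (1 / (norm x)\<^sup>2 * (x \<bullet> 1))) (g [\<i>] x + k * u x * (1 / (norm x)\<^sup>2 * (x \<bullet> \<i>)))"
          using elim x by (simp add: weak_grad_def inversion_def Basis_complex_def k_def complex_eq_iff inner_complex_def)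
        then have N: "(norm (weak_grad ?O u x + ((m - 1) * u x) *\<^sub>R inversion x))\<^sup>2
           = (g [1] x + k * u x * (1 / (norm x)\<^sup>2 * (x \<bullet> 1)))\<^sup>2 + (g [\<i>] x + k * u x * (1 / (norm x)\<^sup>2 * (x \<bullet> \<i>)))\<^sup>2"
          by (simp add: cmod_power2)
        have V: "T (- k - 1) x * (V1 e x * V1 e x) = 1 / (norm x)\<^sup>2 * (g [e] x + k * u x * (1 / (norm x)\<^sup>2 * (x \<bullet> e)))\<^sup>2" for e
          unfolding V1x c2[symmetric] by (simp only: power2_eq_square mult_ac)
        have "?w x * (V1 1 x * V1 1 x) + ?w x * (V1 \<i> x * V1 \<i> x)
          = (T (- k - 1) x * (V1 1 x * V1 1 x) + T (- k - 1) x * (V1 \<i> x * V1 \<i> x))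
            * ((norm x / b) powr (2 * \<gamma>) + (a / norm x) powr (2 * \<gamma>))"
          by (simp only: distrib_left distrib_right mult_ac add_ac)
        then show "?w x * (V1 1 x * V1 1 x) + ?w x * (V1 \<i> x * V1 \<i> x)
          = 1 / (norm x)\<^sup>2 * (norm (weak_grad ?O u x + ((m - 1) * u x) *\<^sub>R inversion x))\<^sup>2
                * ((norm x / b) powr (2 * \<gamma>) + (a / norm x) powr (2 * \<gamma>))"
          unfolding V N distrib_left[of "1 / (norm x)\<^sup>2"] .
      qed
    qed
    from set_integral_AE_cong(2)[OF iw2 this]
    have "(LINT x:?O|lebesgue.
                1 / (norm x)\<^sup>2 * (norm (weak_grad ?O u x + ((m - 1) * u x) *\<^sub>R inversion x))\<^sup>2
                * ((norm x / b) powr (2 * \<gamma>) + (a / norm x) powr (2 * \<gamma>)))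
        = (LINT x:?O|lebesgue. ?w x * (V1 1 x * V1 1 x) + ?w x * (V1 \<i> x * V1 \<i> x))" .
    also have "\<dots> \<le> (LINT x:?O|lebesgue. 2 * (T (- k - 1) x * (V1 1 x * V1 1 x) + T (- k - 1) x * (V1 \<i> x * V1 \<i> x)))"
    proof (rule set_integral_mono[OF iw2])
      show "set_integrable lebesgue ?O (\<lambda>x. 2 * (T (- k - 1) x * (V1 1 x * V1 1 x) + T (- k - 1) x * (V1 \<i> x * V1 \<i> x)))"
        by (intro set_integrable_mult_right set_integral_add(1) iT B1)
      fix x assume x: "x \<in> ?O"
      have "?w x \<le> T (- k - 1) x * 2"
        using bw(2)[OF x, of "2 * \<gamma>"] \<gamma> by (intro mult_left_mono) (auto simp: T_def)
      then have "?w x * (V1 e x * V1 e x) \<le> T (- k - 1) x * 2 * (V1 e x * V1 e x)" for e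
        by (intro mult_right_mono) auto
      from add_mono[OF this[of 1] this[of \<i>]]
      show "?w x * (V1 1 x * V1 1 x) + ?w x * (V1 \<i> x * V1 \<i> x)
        \<le> 2 * (T (- k - 1) x * (V1 1 x * V1 1 x) + T (- k - 1) x * (V1 \<i> x * V1 \<i> x))" by (simp add: algebra_simps)
    qed
    also have "\<dots> = 2 * ((LINT x:?O|lebesgue. T (- k - 1) x * (V1 1 x * V1 1 x)) + (LINT x:?O|lebesgue. T (- k - 1) x * (V1 \<i> x * V1 \<i> x)))"
      unfolding set_integral_mult_right set_integral_add(2)[OF iT[OF B1(1)] iT[OF B1(2)]] ..
    finally show ?thesis .
  qed

  define I1 where "I1 = (LINT x:?O|lebesgue. (u x)\<^sup>2 / (norm x) ^ 4
                      * ((norm x / b) powr (4 * \<beta>) + (a / norm x) powr (4 * \<beta>)))"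
  define I2 where "I2 = (LINT x:?O|lebesgue. (L_op ?O m u x)\<^sup>2)"
  define I3 where "I3 = (LINT z:?O|lebesgue. (norm (frakL_op ?O m u z))\<^sup>2)"

  have J1: "Jv \<le> 6 * I1"
  proof -
    let ?w = "\<lambda>x::complex. T (- 2) x * ((norm x / b) powr (4 * \<beta>) + (a / norm x) powr (4 * \<beta>))"
    have wm: "?w \<in> borel_measurable borel" by measurable
    have "\<exists>B. \<forall>x\<in>?O. \<bar>?w x\<bar> \<le> B"
    proof (rule bm[OF Tb])
      show "\<exists>B. \<forall>x\<in>?O. \<bar>(norm x / b) powr (4 * \<beta>) + (a / norm x) powr (4 * \<beta>)\<bar> \<le> B"
        using bw \<beta> by (intro exI[of _ 2] ballI) simp
    qed
    then obtain Bw where Bw: "\<And>x. x \<in> ?O \<Longrightarrow> \<bar>?w x\<bar> \<le> Bw" by blast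
    have iw: "set_integrable lebesgue ?O (\<lambda>x. ?w x * (u x * u x))"
      by (rule weighted_integrable[OF su su wm Bw])
    have T2: "T (- 2) x = 1 / norm x ^ 4" for x
    proof -
      have "T (- 2) x = 1 / ((norm x)\<^sup>2)\<^sup>2"
        unfolding T_def by (cases "x = 0") (simp_all add: powr_minus powr_numeral inverse_eq_divide)
      then show ?thesis by (simp flip: power_mult)
    qed
    have I1eq: "I1 = (LINT x:?O|lebesgue. ?w x * (u x * u x))"
      unfolding I1_def T2 by (simp add: power2_eq_square mult_ac)
    have "Jv \<le> (LINT x:?O|lebesgue. 6 * (?w x * (u x * u x)))"
      unfolding Jv_def
    proof (rule set_integral_mono)
      show "set_integrable lebesgue ?O (\<lambda>x. indicator {..6} ((norm x)\<^sup>2 / a\<^sup>2) * T (- k - 2) x * (v x * v x))"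
        unfolding T_def by (rule hardy_weights(2)[OF a k sv sv]) simp
      show "set_integrable lebesgue ?O (\<lambda>x. 6 * (?w x * (u x * u x)))"
        by (intro set_integrable_mult_right iw)
      fix x assume x: "x \<in> ?O"
      have "T (- k - 2) x * (v x * v x) = (T (- k - 2) x * T (k/2) x * T (k/2) x) * (u x * u x)"
        by (simp add: v_def)
      also have "T (- k - 2) x * T (k/2) x * T (k/2) x = T (- 2) x" unfolding Tp by simp
      finally have vu: "T (- k - 2) x * (v x * v x) = T (- 2) x * (u x * u x)" .
      have "indicator {..6} ((norm x)\<^sup>2 / a\<^sup>2) \<le> 6 * ((norm x / b) powr (4 * \<beta>) + (a / norm x) powr (4 * \<beta>))"
      proof (cases "(norm x)\<^sup>2 / a\<^sup>2 \<le> 6")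
        case True
        have n0: "0 < norm x" using tpos[OF x] by simp
        then have n: "a / norm x > 0" "a / norm x \<le> 1" using x a by (auto simp: annulus_iff divide_le_eq_1)
        \<comment> \<open>Where |x|^2 <= 6 a^2, the weight (a/|x|)^(4\<beta>) is at least (a/|x|)^2
          >= 1/6, because a/|x| <= 1 and 4\<beta> < 2.\<close>
        have "1 / 6 \<le> (a / norm x)\<^sup>2"
          using True a(1) n0 by (simp add: field_simps)
        also have "(a / norm x)\<^sup>2 = (a / norm x) powr 2" using n(1) by (simp add: powr_numeral)
        also have "\<dots> \<le> (a / norm x) powr (4 * \<beta>)" using n \<beta> by (intro powr_mono') auto
        finally have "1 \<le> 6 * (a / norm x) powr (4 * \<beta>)" by simp
        moreover have "0 \<le> (norm x / b) powr (4 * \<beta>)" by simp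
        moreover have "(indicator {..6} ((norm x)\<^sup>2 / a\<^sup>2) :: real) = 1" using True by simp
        ultimately show ?thesis unfolding distrib_left by linarith
      qed (use bw(1)[OF x, of "4 * \<beta>"] \<beta> in simp)
      then have "indicator {..6} ((norm x)\<^sup>2 / a\<^sup>2) * (T (- 2) x * (u x * u x))
          \<le> (6 * ((norm x / b) powr (4 * \<beta>) + (a / norm x) powr (4 * \<beta>))) * (T (- 2) x * (u x * u x))"
        by (intro mult_right_mono) (auto simp: T_def)
      then show "indicator {..6} ((norm x)\<^sup>2 / a\<^sup>2) * T (- k - 2) x * (v x * v x) \<le> 6 * (?w x * (u x * u x))"
        unfolding mult.assoc vu by (simp only: mult_ac)
    qed
    then show ?thesis unfolding I1eq set_integral_mult_right .
  qed

  have J2: "J2 1 1 + J2 1 \<i> + J2 \<i> 1 + J2 \<i> \<i> = 1/2 * I2 + 8 * I3"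
  proof -
    have su2: "square_integrable ?O (\<lambda>x. c1 * V2 e1 e1' x + c2 * V2 e2 e2' x)"
      if "e1 \<in> Basis" "e1' \<in> Basis" "e2 \<in> Basis" "e2' \<in> Basis" for c1 c2 e1 e1' e2 e2'
      by (intro square_integrable_add sqm[OF sV2[OF that(1,2)]] sqm[OF sV2[OF that(3,4)]] bc) auto
    \<comment> \<open>\<open>?S\<close> is the Laplacian of \<open>v\<close>, and \<open>?D\<close>,
      minus \<open>?M\<close> are four times the real and imaginary parts of its second
      z-derivative. The explicit coefficients 1 and -1 fit the pattern of
      \<open>su2\<close>.\<close>
    let ?S = "\<lambda>x. 1 * V2 1 1 x + 1 * V2 \<i> \<i> x"
    let ?D = "\<lambda>x. 1 * V2 1 1 x + (-1) * V2 \<i> \<i> x"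
    let ?M = "\<lambda>x. 1 * V2 1 \<i> x + 1 * V2 \<i> 1 x"
    have iT: "set_integrable lebesgue ?O (\<lambda>x. T (- k) x * (f x * f x))" if "square_integrable ?O f" for f
      unfolding T_def by (rule hardy_weights(1)[OF a k that that])
    note iS = iT[OF su2[OF B1(1,1,2,2), of 1 1]] and iD = iT[OF su2[OF B1(1,1,2,2), of 1 "-1"]]
      and iM = iT[OF su2[OF B1(1,2,2,1), of 1 1]]
    \<comment> \<open>Symmetry of the Hessian makes \<open>?M\<close> twice an off-diagonal entry,
      so half its square accounts for both off-diagonal squares.\<close>
    have gc: "AE x in lebesgue. x \<in> ?O \<longrightarrow> g [1, \<i>] x = g [\<i>, 1] x"
      by (rule has_weak_deriv_commute[OF O g2(1)[OF B1] g2(1)[OF B1(2,1)]])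

    have Vx: "V2 e e' x = T (k/2) x * (g [e, e'] x + k * (x \<bullet> e') / (norm x)\<^sup>2 * g [e] x + k * (x \<bullet> e) / (norm x)\<^sup>2 * g [e'] x
         + (k * (k - 2) * ((x \<bullet> e) * (x \<bullet> e')) / ((norm x)\<^sup>2)\<^sup>2 + k / (norm x)\<^sup>2 * (e' \<bullet> e)) * u x)"
      if x: "x \<in> ?O" for e e' x
      unfolding V2_def Tt[OF x] by (simp add: algebra_simps power2_eq_square add_divide_distrib diff_divide_distrib)
    have TTk: "T (- k) x * (T (k/2) x * T (k/2) x) = 1" if "x \<in> ?O" for x
      using T0[OF that] unfolding Tp by simp
    have I2eq: "I2 = (LINT x:?O|lebesgue. T (- k) x * (?S x * ?S x))"
      unfolding I2_def
    proof (rule set_integral_AE_cong(2)[OF iS])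
      show "AE x in lebesgue. x \<in> ?O \<longrightarrow> T (- k) x * (?S x * ?S x) = (L_op ?O m u x)\<^sup>2"
        using ae1[OF B1(1)] ae1[OF B1(2)] ae2[OF B1(1)] ae2[OF B1(2)]
      proof eventually_elim
        case (elim x)
        show ?case
        proof
          assume x: "x \<in> ?O"
          have L: "L_op ?O m u x = g [1,1] x + g [\<i>,\<i>] x
             + 2 * k * ((x \<bullet> 1) / (norm x)\<^sup>2 * g [1] x + (x \<bullet> \<i>) / (norm x)\<^sup>2 * g [\<i>] x) + k\<^sup>2 / (norm x)\<^sup>2 * u x"
            using elim x by (simp add: L_op_def weak_laplacian_def weak_grad_def inversion_def Basis_complex_def k_def inner_complex_def)
          have "T (k/2) x * L_op ?O m u x = ?S x"
            unfolding L Vx[OF x] conjugated_laplacian[OF tt tpos[OF x]]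
            by (simp add: inner_complex_def mult_ac)
          note S = this
          have "T (- k) x * (?S x * ?S x) = (T (- k) x * (T (k/2) x * T (k/2) x)) * (L_op ?O m u x)\<^sup>2"
            unfolding S[symmetric] by (simp only: power2_eq_square mult_ac)
          then show "T (- k) x * (?S x * ?S x) = (L_op ?O m u x)\<^sup>2" unfolding TTk[OF x] by simp
        qed
      qed
    qed
    have I3eq: "I3 = (LINT x:?O|lebesgue. 1/16 * (T (- k) x * (?D x * ?D x) + T (- k) x * (?M x * ?M x)))"
      unfolding I3_def
    proof (rule set_integral_AE_cong(2))
      show "set_integrable lebesgue ?O (\<lambda>x. 1/16 * (T (- k) x * (?D x * ?D x) + T (- k) x * (?M x * ?M x)))"
        by (intro set_integrable_mult_right set_integral_add(1) iD iM)
      let ?f = "\<lambda>w. complex_of_real (u w)"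
      have bl: "bounded_linear (\<lambda>z::complex. c * z)" for c by (rule bounded_linear_mult_right)
      have f1: "has_weak_deriv ?O [e] ?f (\<lambda>x. complex_of_real (g [e] x))" if "e \<in> Basis" for e
        by (rule has_weak_deriv_bounded_linear[OF bounded_linear_of_real g1(1)[OF that]]) (use that in auto)
      have f2: "has_weak_deriv ?O [e'] (\<lambda>x. complex_of_real (g [e] x)) (\<lambda>x. complex_of_real (g [e, e'] x))"
        if "e \<in> Basis" "e' \<in> Basis" for e e'
        by (rule has_weak_deriv_bounded_linear[OF bounded_linear_of_real
              has_weak_deriv_iterate[OF g1(1)[OF that(1)] g2(1)[OF that] that(2)]]) (use that in auto)
      have ae3: "AE x in lebesgue. x \<in> ?O \<longrightarrow> weak_deriv ?O [e] ?f x = complex_of_real (g [e] x)" if "e \<in> Basis" for e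
        by (rule aeD[OF _ f1[OF that]]) (use that in auto)
      \<comment> \<open>An explicit representative of the inner \<open>dz\<close>, with known weak
        derivatives. They carry over to the chosen representative, once that is known to be locally
        integrable.\<close>
      define h where "h x = (1/2) * complex_of_real (g [1] x) + (- (1/2) * \<i>) * complex_of_real (g [\<i>] x)" for x
      have hd: "has_weak_deriv ?O [e] h (\<lambda>x. (1/2) * complex_of_real (g [1, e] x) + (- (1/2) * \<i>) * complex_of_real (g [\<i>, e] x))"
        if "e \<in> Basis" for e
        unfolding h_def
        by (intro has_weak_deriv_add has_weak_deriv_bounded_linear[OF bl] f2 B1 that) (use that in auto)
      have dzh: "AE x in lebesgue. x \<in> ?O \<longrightarrow> h x = dz ?O ?f x"
        using ae3[OF B1(1)] ae3[OF B1(2)]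
        by eventually_elim (simp add: dz_def h_def algebra_simps)
      have ldz: "locally_integrable ?O (dz ?O ?f)"
      proof -
        have "dz ?O ?f = (\<lambda>x. (1/2) * weak_deriv ?O [1] ?f x + (- (1/2) * \<i>) * weak_deriv ?O [\<i>] ?f x)"
          by (simp add: dz_def fun_eq_iff algebra_simps)
        moreover have "locally_integrable ?O (\<lambda>x. (1/2) * weak_deriv ?O [1] ?f x + (- (1/2) * \<i>) * weak_deriv ?O [\<i>] ?f x)"
          by (intro locally_integrable_add locally_integrable_bounded_linear[OF bl]
              has_weak_deriv_locally_integrable(2)[OF has_weak_deriv_weak_deriv[OF f1]] B1)
        ultimately show ?thesis by (simp only:)
      qed
      have ae4: "AE x in lebesgue. x \<in> ?O \<longrightarrow> weak_deriv ?O [e] (dz ?O ?f) x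
          = (1/2) * complex_of_real (g [1, e] x) + (- (1/2) * \<i>) * complex_of_real (g [\<i>, e] x)"
        if e: "e \<in> Basis" for e
      proof -
        have es: "set [e] \<subseteq> Basis" using e by simp
        show ?thesis by (rule aeD[OF es has_weak_deriv_AE_cong[OF hd[OF e] es dzh ldz]])
      qed
      show "AE x in lebesgue. x \<in> ?O \<longrightarrow> 1/16 * (T (- k) x * (?D x * ?D x) + T (- k) x * (?M x * ?M x)) = (norm (frakL_op ?O m u x))\<^sup>2"
        using dzh ae4[OF B1(1)] ae4[OF B1(2)]
      proof eventually_elim
        case (elim x)
        show ?case
        proof
          assume x: "x \<in> ?O"
          have E1: "dz ?O (dz ?O ?f) x = (1/4) * (of_real (g [1,1] x) - \<i> * of_real (g [\<i>,1] x) - \<i> * of_real (g [1,\<i>] x) - of_real (g [\<i>,\<i>] x))"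
            unfolding dz_def[of ?O "dz ?O ?f"] elim(2)[rule_format, OF x] elim(3)[rule_format, OF x]
            by (simp add: algebra_simps complex_eq_iff)
          have E2: "dz ?O ?f x = (1/2) * (of_real (g [1] x) - \<i> * of_real (g [\<i>] x))"
            using elim(1) x by (simp add: h_def algebra_simps)
          have F: "frakL_op ?O m u x = (1/4) * (of_real (g [1,1] x) - \<i> * of_real (g [\<i>,1] x) - \<i> * of_real (g [1,\<i>] x) - of_real (g [\<i>,\<i>] x))
              + of_real k / x * ((1/2) * (of_real (g [1] x) - \<i> * of_real (g [\<i>] x))) + of_real (k * (k - 2)) / (4 * x\<^sup>2) * of_real (u x)"
            unfolding frakL_op_def Let_def k_def E1 E2 by simp
          have z: "x = Complex (x \<bullet> 1) (x \<bullet> \<i>)" by (simp add: complex_eq_iff inner_complex_def)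
          have "of_real (T (k/2) x) * frakL_op ?O m u x = (1/4) * Complex (?D x) (- ?M x)"
            unfolding F conjugated_dz2[OF tt tpos[OF x] z] Vx[OF x] by (simp add: inner_complex_def mult_ac)
          note F' = this
          have n4: "(norm ((1/4) * Complex A (- M)))\<^sup>2 = 1/16 * (A\<^sup>2 + M\<^sup>2)" for A M :: real
          proof -
            have "(norm ((1/4) * Complex A (- M)))\<^sup>2 = (1/4)\<^sup>2 * (norm (Complex A (- M)))\<^sup>2"
              unfolding norm_mult power_mult_distrib by simp
            also have "(norm (Complex A (- M)))\<^sup>2 = A\<^sup>2 + M\<^sup>2" by (simp only: cmod_power2 complex.sel power2_minus)
            finally show ?thesis by (simp add: power2_eq_square)
          qed
          have "(T (k/2) x)\<^sup>2 * (norm (frakL_op ?O m u x))\<^sup>2 = (norm (of_real (T (k/2) x) * frakL_op ?O m u x))\<^sup>2"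
            by (simp only: norm_mult power_mult_distrib norm_of_real power2_abs)
          then have n: "(T (k/2) x)\<^sup>2 * (norm (frakL_op ?O m u x))\<^sup>2 = 1/16 * ((?D x)\<^sup>2 + (?M x)\<^sup>2)"
            unfolding F' n4 .
          have "1/16 * (T (- k) x * (?D x * ?D x) + T (- k) x * (?M x * ?M x)) = T (- k) x * (1/16 * ((?D x)\<^sup>2 + (?M x)\<^sup>2))"
            by (simp only: power2_eq_square distrib_left mult_ac)
          also have "\<dots> = (T (- k) x * (T (k/2) x * T (k/2) x)) * (norm (frakL_op ?O m u x))\<^sup>2"
            unfolding n[symmetric] by (simp only: power2_eq_square mult_ac)
          finally show "1/16 * (T (- k) x * (?D x * ?D x) + T (- k) x * (?M x * ?M x)) = (norm (frakL_op ?O m u x))\<^sup>2"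
            unfolding TTk[OF x] by simp
        qed
      qed
    qed
    have i2: "set_integrable lebesgue ?O (\<lambda>x. T (- k) x * (V2 e e' x * V2 e e' x))" if "e \<in> Basis" "e' \<in> Basis" for e e'
      by (rule iT[OF sV2[OF that]])
    let ?Q = "\<lambda>e e' x. T (- k) x * (V2 e e' x * V2 e e' x)"
    note s1 = set_integral_add[OF i2[OF B1(1,1)] i2[OF B1(1,2)]]
    note s2 = set_integral_add[OF s1(1) i2[OF B1(2,1)]]
    note s3 = set_integral_add[OF s2(1) i2[OF B1(2,2)]]
    have "J2 1 1 + J2 1 \<i> + J2 \<i> 1 + J2 \<i> \<i> = (LINT x:?O|lebesgue. ?Q 1 1 x + ?Q 1 \<i> x + ?Q \<i> 1 x + ?Q \<i> \<i> x)"
      unfolding J2_def s3(2) s2(2) s1(2) ..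
    also have "\<dots> = (LINT x:?O|lebesgue. 1/2 * (T (- k) x * (?S x * ?S x)) + 1/2 * (T (- k) x * (?D x * ?D x) + T (- k) x * (?M x * ?M x)))"
    proof (rule set_integral_AE_cong(2)[symmetric, OF s3(1)])
      show "AE x in lebesgue. x \<in> ?O \<longrightarrow> ?Q 1 1 x + ?Q 1 \<i> x + ?Q \<i> 1 x + ?Q \<i> \<i> x
          = 1/2 * (T (- k) x * (?S x * ?S x)) + 1/2 * (T (- k) x * (?D x * ?D x) + T (- k) x * (?M x * ?M x))"
        using gc
      proof eventually_elim
        case (elim x)
        show ?case
        proof
          assume x: "x \<in> ?O"
          have "V2 \<i> 1 x = V2 1 \<i> x" unfolding Vx[OF x] using elim x by (simp add: inner_commute mult_ac)
          then show "?Q 1 1 x + ?Q 1 \<i> x + ?Q \<i> 1 x + ?Q \<i> \<i> x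
          = 1/2 * (T (- k) x * (?S x * ?S x)) + 1/2 * (T (- k) x * (?D x * ?D x) + T (- k) x * (?M x * ?M x))"
            by (simp add: algebra_simps)
        qed
      qed
    qed
    also have "\<dots> = 1/2 * (LINT x:?O|lebesgue. T (- k) x * (?S x * ?S x))
        + 1/2 * (LINT x:?O|lebesgue. T (- k) x * (?D x * ?D x) + T (- k) x * (?M x * ?M x))"
      unfolding set_integral_add(2)[OF set_integrable_mult_right[OF iS, of "1/2"]
          set_integrable_mult_right[OF set_integral_add(1)[OF iD iM], of "1/2"]] set_integral_mult_right ..
    also have "\<dots> = 1/2 * I2 + 8 * I3"
      unfolding I2eq I3eq set_integral_mult_right by simp
    finally show ?thesis .
  qed
  have I0: "0 \<le> I1" "0 \<le> I2" "0 \<le> I3"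
    unfolding I1_def I2_def I3_def by (intro set_integral_nonneg_real; simp)+
  have K0: "0 \<le> hardy_const k" using k by (simp add: hardy_const_def)
  have "2 * ((LINT x:?O|lebesgue. T (- k - 1) x * (V1 1 x * V1 1 x)) + (LINT x:?O|lebesgue. T (- k - 1) x * (V1 \<i> x * V1 \<i> x)))
      \<le> 2 * (hardy_const k * (Jv + (J2 1 1 + J2 1 \<i>)) + hardy_const k * (Jv + (J2 \<i> 1 + J2 \<i> \<i>)))"
    using hardy[OF B1(1)] hardy[OF B1(2)] by simp
  also have "\<dots> = 2 * hardy_const k * (2 * Jv + (1/2 * I2 + 8 * I3))"
    unfolding J2[symmetric] by (simp add: algebra_simps)
  \<comment> \<open>12 is needed for 2 * 6 I1; it also dominates the coefficients 1/2 and 8.\<close>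
  also have "\<dots> \<le> 2 * hardy_const k * (12 * (I1 + I2 + I3))"
    using K0 J1 I0 by (intro mult_left_mono) auto
  also have "\<dots> = 24 * hardy_const k * (I1 + I2 + I3)" by simp
  finally show ?thesis
    unfolding I1_def[symmetric] I2_def[symmetric] I3_def[symmetric] k_def[symmetric]
    by (rule order_trans[OF lhs[unfolded k_def[symmetric]]])
qed

section \<open>The threshold\<close>

lemma poly_P: "poly P_poly x = 3 * x ^ 4 - 8 * x ^ 3 + 10 * x ^ 2 - 16 * x + 7"
  by (simp add: P_poly_def algebra_simps power_numeral_reduce)

text \<open>Expanded at 2, all coefficients of the polynomial except the constant one are
  positive.\<close>

lemma P_strict_mono:
  assumes "2 \<le> x" "x < y"
  shows "poly P_poly x < poly P_poly y"
proof -
  define a b where "a = x - 2" and "b = y - 2"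
  have ab: "0 \<le> a" "a < b" "x = a + 2" "y = b + 2" using assms by (auto simp: a_def b_def)
  have e: "poly P_poly (t + 2) = 3 * t ^ 4 + 16 * t ^ 3 + 34 * t ^ 2 + 24 * t - 1" for t
    by (simp add: poly_P algebra_simps power_numeral_reduce)
  have "a ^ 4 < b ^ 4" "a ^ 3 < b ^ 3" "a ^ 2 < b ^ 2"
    using ab by (auto intro!: power_strict_mono)
  then show ?thesis unfolding ab(3,4) e using ab by simp
qed

text \<open>Ferrari's solution read backwards. The inner radical of \<open>m0\<close> is \<alpha>,
  whose square solves the cubic resolvent, and \<delta> is the square root left by one quadratic
  factor. The numerical bounds on \<alpha> make the radicands positive and later give m0 >=
  2.\<close>

lemma m0_facts:
  obtains \<alpha> \<delta> where "m0 = 2/3 + (\<alpha> + \<delta>) / 3" "\<alpha> > 0" "\<delta> \<ge> 0"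
    "\<delta>\<^sup>2 = - 3 - \<alpha>\<^sup>2 + 22 / \<alpha>" "\<alpha> ^ 6 + 3 * \<alpha> ^ 4 + 9 * \<alpha> ^ 2 = 121"
    "1.9 \<le> \<alpha>" "\<alpha> \<le> 1.92"
proof -
  define R where "R = 32 + 3 * sqrt 114"
  have "R > 0" by (simp add: R_def add_pos_nonneg)
  define c where "c = root 3 R"
  have c: "c > 0" "c ^ 3 = R" using \<open>R > 0\<close> by (simp_all add: c_def)
  define d where "d = root 3 (2 * R)"
  have d: "d > 0" "d ^ 3 = 2 * R" using \<open>R > 0\<close> by (simp_all add: d_def)
  define h :: real where "h = 2 powr (1/3)"
  have h: "h > 0" "h ^ 3 = 2" by (simp_all add: h_def flip: powr_realpow powr_powr[of 2 "1/3" 3] add: powr_powr)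
  have h2: "2 powr (2/3) = h\<^sup>2" "2 powr (8/3) = 4 * h\<^sup>2"
  proof -
    show 1: "2 powr (2/3) = h\<^sup>2" by (simp add: h_def powr_powr flip: powr_numeral[of "2 powr (1/3)"])
    have "(2::real) powr (8/3) = 2 powr (2 + 2/3)" by simp
    also have "\<dots> = 2 powr 2 * 2 powr (2/3)" by (rule powr_add)
    finally show "2 powr (8/3) = 4 * h\<^sup>2" using 1 by simp
  qed
  have dh: "d = h * c"
  proof -
    have "(h * c) ^ 3 = d ^ 3" using c d h by (simp add: power_mult_distrib)
    then show ?thesis using c d h by (metis mult_pos_pos less_imp_le power_eq_imp_eq_base zero_less_numeral)
  qed
  \<comment> \<open>Both cube roots in the formula are expressed by the single radical
    \<open>d\<close>.\<close>
  have q: "h\<^sup>2 / c = 2 / d"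
    using c d h unfolding dh by (simp add: field_simps power_numeral_reduce)
  define y where "y = d - 2 / d"
  \<comment> \<open>d^3 = 64 + 6 sqrt 114 is a root of a quadratic; this is Cardano's substitution y
    = d - 2/d for y^3 + 6y = 128, and A = y - 1 solves the resolvent.\<close>
  have "(d ^ 3 - 64)\<^sup>2 = 36 * 114"
    unfolding d by (simp add: R_def power_mult_distrib)
  then have d6: "(d ^ 3)\<^sup>2 - 128 * d ^ 3 = 8"
    by (simp add: power2_eq_square algebra_simps)
  have "y ^ 3 + 6 * y = d ^ 3 - 8 / d ^ 3"
    using d(1) by (simp add: y_def field_simps power_numeral_reduce)
  also have "\<dots> = 128"
    using d6 d(1) by (simp add: field_simps power2_eq_square)
  finally have y: "y ^ 3 + 6 * y = 128" .
  define A where "A = y - 1"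
  have A: "A ^ 3 + 3 * A\<^sup>2 + 9 * A = 121"
    using y by (simp add: A_def algebra_simps power_numeral_reduce)
  \<comment> \<open>The difference quotient of the cubic is a sum of squares plus 6. Monotonicity
    then brackets A between 1.9^2 = 3.61 and 1.92^2 = 3.6864.\<close>
  have mono: "s ^ 3 + 3 * s\<^sup>2 + 9 * s < t ^ 3 + 3 * t\<^sup>2 + 9 * t" if "s < t" for s t :: real
  proof -
    have "t ^ 3 + 3 * t\<^sup>2 + 9 * t - (s ^ 3 + 3 * s\<^sup>2 + 9 * s)
      = (t - s) * ((t + s / 2 + 3/2)\<^sup>2 + 3/4 * (s + 1)\<^sup>2 + 6)"
      by (simp add: power2_eq_square power3_eq_cube field_simps)
    moreover have "(t + s / 2 + 3/2)\<^sup>2 + 3/4 * (s + 1)\<^sup>2 + 6 > 0"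
      by (intro add_nonneg_pos add_nonneg_nonneg) auto
    ultimately show ?thesis using that by (metis diff_gt_0_iff_gt mult_pos_pos)
  qed
  have "\<not> A < 3.61"
  proof
    assume "A < 3.61"
    from mono[OF this] A show False by (simp add: power_numeral_reduce)
  qed
  moreover have "\<not> A > 3.6864"
  proof
    assume "A > 3.6864"
    from mono[OF this] A show False by (simp add: power_numeral_reduce)
  qed
  ultimately have Ab: "3.61 \<le> A" "A \<le> 3.6864" by auto
  define \<alpha> where "\<alpha> = sqrt A"
  have \<alpha>2: "\<alpha>\<^sup>2 = A" using Ab by (simp add: \<alpha>_def)
  have "sqrt (1.9\<^sup>2) \<le> \<alpha>" unfolding \<alpha>_def using Ab by (intro real_sqrt_le_mono) (simp add: power2_eq_square)
  moreover have "\<alpha> \<le> sqrt (1.92\<^sup>2)" unfolding \<alpha>_def using Ab by (intro real_sqrt_le_mono) (simp add: power2_eq_square)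
  ultimately have \<alpha>b: "1.9 \<le> \<alpha>" "\<alpha> \<le> 1.92" by simp_all
  define B where "B = - 3 - \<alpha>\<^sup>2 + 22 / \<alpha>"
  have "22 / \<alpha> \<ge> 22 / 1.92" using \<alpha>b by (intro divide_left_mono) auto
  then have B0: "B \<ge> 0" unfolding B_def \<alpha>2 using Ab by simp
  define \<delta> where "\<delta> = sqrt B"
  have \<delta>: "\<delta> \<ge> 0" "\<delta>\<^sup>2 = B" using B0 by (simp_all add: \<delta>_def)
  have Aeq: "- 1 - 2 powr (2/3) / root 3 (32 + 3 * sqrt 114) + root 3 (2 * (32 + 3 * sqrt 114)) = A"
    unfolding R_def[symmetric] c_def[symmetric] d_def[symmetric] h2 q by (simp add: A_def y_def)
  have eq8: "2 powr (8/3) / (9 * root 3 (32 + 3 * sqrt 114)) = 4 / 9 * (2 / d)"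
    unfolding R_def[symmetric] c_def[symmetric] h2 q[symmetric] by simp
  have "- (8/9) + 4 / 9 * (2 / d) - 4/9 * d + 88 / (9 * \<alpha>) = 4 / 9 * (- 2 - y + 22 / \<alpha>)"
    by (simp add: y_def algebra_simps)
  also have "\<dots> = 4 / 9 * B" unfolding B_def \<alpha>2 A_def by simp
  finally have Beq: "- (8/9) + 4 / 9 * (2 / d) - 4/9 * d + 88 / (9 * \<alpha>) = 4 / 9 * B" .
  have "sqrt (4 / 9 * B) = 2 / 3 * \<delta>" unfolding \<delta>_def real_sqrt_mult by (simp add: real_sqrt_divide)
  then have "m0 = 2/3 + 1/3 * \<alpha> + 1/2 * (2 / 3 * \<delta>)"
    unfolding m0_def Let_def Aeq eq8 unfolding \<alpha>_def[symmetric] R_def[symmetric] d_def[symmetric] Beq by simp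
  then have "m0 = 2/3 + (\<alpha> + \<delta>) / 3" by (simp add: add_divide_distrib)
  moreover have "\<alpha> ^ 6 + 3 * \<alpha> ^ 4 + 9 * \<alpha> ^ 2 = 121"
  proof -
    have "\<alpha> ^ 6 = (\<alpha>\<^sup>2) ^ 3" "\<alpha> ^ 4 = (\<alpha>\<^sup>2) ^ 2" by (simp_all flip: power_mult)
    then show ?thesis using A by (simp add: \<alpha>2)
  qed
  moreover have "\<alpha> > 0" using \<alpha>b by simp
  ultimately show ?thesis using that[of \<alpha> \<delta>] \<delta> \<alpha>b unfolding B_def by blast
qed

text \<open>In the depressed variable w = 3 m0 - 2 the polynomial becomes w^4 + 6 w^2 - 88 w - 27 up
  to the factor 27. It splits into two quadratics with linear terms -2 \<alpha> w and 2 \<alpha> w,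
  the first of which has the root \<alpha> + \<delta>.\<close>

lemma poly_P_m0: "poly P_poly m0 = 0" and m0_ge_2: "2 \<le> m0"
proof -
  obtain \<alpha> \<delta> where m: "m0 = 2/3 + (\<alpha> + \<delta>) / 3" "\<alpha> > 0" "\<delta> \<ge> 0"
    "\<delta>\<^sup>2 = - 3 - \<alpha>\<^sup>2 + 22 / \<alpha>" "\<alpha> ^ 6 + 3 * \<alpha> ^ 4 + 9 * \<alpha> ^ 2 = 121"
    "1.9 \<le> \<alpha>" "\<alpha> \<le> 1.92"
    by (rule m0_facts)
  define w where "w = \<alpha> + \<delta>"
  have "22 / \<alpha> \<ge> 22 / 1.92" using m by (intro divide_left_mono) auto
  moreover have "\<alpha>\<^sup>2 \<le> 1.92\<^sup>2" using m by (intro power_mono) auto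
  ultimately have "\<delta>\<^sup>2 \<ge> 2.1\<^sup>2" unfolding m(4) by (simp add: power2_eq_square)
  then have "\<delta> \<ge> 2.1" using m(3) power2_le_imp_le by blast
  then have "4 \<le> \<alpha> + \<delta>" using m(6) by simp
  then show "2 \<le> m0" unfolding m(1) by (simp add: add_divide_distrib)
  have w1: "w\<^sup>2 - 2 * \<alpha> * w + 2 * \<alpha>\<^sup>2 + 3 - 22 / \<alpha> = 0"
    using m(4) by (simp add: w_def power2_eq_square algebra_simps)
  \<comment> \<open>The product of the constant terms of the two quadratics; matching it with -27 is
    the cubic resolvent equation for \<alpha>^2.\<close>
  have c: "(2 * \<alpha>\<^sup>2 + 3)\<^sup>2 - (22 / \<alpha>)\<^sup>2 = - 27"
  proof -
    have "((2 * \<alpha>\<^sup>2 + 3)\<^sup>2 + 27) * \<alpha>\<^sup>2 = 4 * (\<alpha> ^ 6 + 3 * \<alpha> ^ 4 + 9 * \<alpha> ^ 2)"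
      by (simp add: algebra_simps power_numeral_reduce)
    then have "((2 * \<alpha>\<^sup>2 + 3)\<^sup>2 + 27) * \<alpha>\<^sup>2 = 22\<^sup>2" unfolding m(5) by simp
    then have "(2 * \<alpha>\<^sup>2 + 3)\<^sup>2 + 27 = 22\<^sup>2 / \<alpha>\<^sup>2" using m(2) by (simp add: field_simps)
    then show ?thesis by (simp add: power_divide)
  qed
  define T where "T = 22 / \<alpha>"
  have T: "\<alpha> * T = 22" using m(2) by (simp add: T_def)
  have "w ^ 4 + 6 * w\<^sup>2 - 88 * w - 27
     = (w\<^sup>2 - 2 * \<alpha> * w + 2 * \<alpha>\<^sup>2 + 3 - T) * (w\<^sup>2 + 2 * \<alpha> * w + 2 * \<alpha>\<^sup>2 + 3 + T)"
  proof -
    have "(w\<^sup>2 - 2 * \<alpha> * w + 2 * \<alpha>\<^sup>2 + 3 - T) * (w\<^sup>2 + 2 * \<alpha> * w + 2 * \<alpha>\<^sup>2 + 3 + T)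
      = w ^ 4 + 6 * w\<^sup>2 - 4 * (\<alpha> * T) * w + ((2 * \<alpha>\<^sup>2 + 3)\<^sup>2 - T\<^sup>2)"
      by (simp add: algebra_simps power_numeral_reduce)
    also have "\<dots> = w ^ 4 + 6 * w\<^sup>2 - 88 * w - 27" using c by (simp add: T T_def[symmetric])
    finally show ?thesis by simp
  qed
  also have "\<dots> = 0" using w1 by (simp add: T_def)
  finally have "w ^ 4 + 6 * w\<^sup>2 - 88 * w - 27 = 0" .
  moreover have "27 * poly P_poly m0 = w ^ 4 + 6 * w\<^sup>2 - 88 * w - 27"
    unfolding m(1) poly_P w_def[symmetric] by (simp add: power_numeral_reduce field_simps)
  ultimately show "poly P_poly m0 = 0" by simp
qed

lemma m0_largest_root: "poly P_poly x = 0 \<Longrightarrow> x \<le> m0"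
  using P_strict_mono[OF m0_ge_2, of x] poly_P_m0 by force

text \<open>The polynomial changes sign between the two decimals and is strictly increasing from 2
  on, where its root \<open>m0\<close> lies.\<close>

lemma m0_bounds: "2.039423 \<le> m0" "m0 < 2.039424"
proof -
  have "poly P_poly 2.039423 \<le> 0" "0 < poly P_poly 2.039424"
    by (simp_all add: poly_P power_numeral_reduce)
  note P = this
  show "2.039423 \<le> m0"
  proof (rule ccontr)
    assume "\<not> ?thesis"
    then show False using P_strict_mono[OF m0_ge_2, of "2.039423"] poly_P_m0 P by simp
  qed
  show "m0 < 2.039424"
  proof (rule ccontr)
    assume "\<not> ?thesis"
    then consider "m0 = 2.039424" | "2.039424 < m0" by linarith
    then show False
    proof cases
      case 1
      then show ?thesis using poly_P_m0[unfolded 1] P(2) by linarith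
    next
      case 2
      from P_strict_mono[OF _ this] show ?thesis using P poly_P_m0 by simp
    qed
  qed
qed

section \<open>The estimate\<close>

lemma gt_m0_ge_2: "m0 < m \<Longrightarrow> 2 \<le> m"
  using m0_ge_2 by linarith

text \<open>The value of \<Lambda> is \<open>ln 4\<close>: the ratio 4 is what makes the scaled
  outer radius b^2 / a^2 at least 16 in the Hardy estimates.\<close>

lemma annulus_wide:
  fixes a b :: real
  assumes "0 < a" "a < b" "ln 4 \<le> ln (b / a)"
  shows "4 * a \<le> b"
proof -
  have "4 \<le> b / a" using assms by (subst (asm) ln_le_cancel_iff) auto
  then show ?thesis using assms(1) by (simp add: field_simps)
qed

theorem theorem2p3:
  shows "(poly P_poly m0 = 0 \<and> (\<forall>x. poly P_poly x = 0 \<longrightarrow> x \<le> m0)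
            \<and> 2.039423 \<le> m0 \<and> m0 < 2.039424) \<and>
    (\<exists>\<Lambda> :: real \<Rightarrow> real. \<forall>m>m0. \<forall>\<beta> \<gamma>. 0 < \<beta> \<and> \<beta> < 1/2 \<and> 0 < \<gamma> \<and> \<gamma> < 1 \<longrightarrow>
      (\<exists>C :: real. \<forall>a b. 0 < a \<and> a < b \<and> \<Lambda> \<gamma> \<le> ln (b / a) \<longrightarrow>
        (let \<Omega> = annulus a b in
          \<forall>u\<in>sobolev2 2 \<Omega>. L_adjoint_L_zero \<Omega> m u \<longrightarrow>
            (LINT x:\<Omega>|lebesgue.
                1 / (norm x)\<^sup>2 * (norm (weak_grad \<Omega> u x + ((m - 1) * u x) *\<^sub>R inversion x))\<^sup>2
                * ((norm x / b) powr (2 * \<gamma>) + (a / norm x) powr (2 * \<gamma>)))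
            \<le> C * ((LINT x:\<Omega>|lebesgue.
                      (u x)\<^sup>2 / (norm x) ^ 4
                      * ((norm x / b) powr (4 * \<beta>) + (a / norm x) powr (4 * \<beta>)))
                   + (LINT x:\<Omega>|lebesgue. (L_op \<Omega> m u x)\<^sup>2)
                   + (LINT z:\<Omega>|lebesgue. (norm (frakL_op \<Omega> m u z))\<^sup>2)))))"
proof (intro conjI)
  show "poly P_poly m0 = 0" "\<forall>x. poly P_poly x = 0 \<longrightarrow> x \<le> m0" "2.039423 \<le> m0" "m0 < 2.039424"
    using poly_P_m0 m0_largest_root m0_bounds by blast+
\<comment> \<open>The constant \<open>C\<close> stays schematic until
  \<open>weighted_estimate\<close> sets it to \<open>24 * hardy_const (m - 1)\<close>; it is
  introduced before \<open>a\<close> and \<open>b\<close>, hence cannot depend on them.\<close>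
qed (rule exI[of _ "\<lambda>_. ln 4"], unfold Let_def, intro allI impI exI ballI, elim conjE,
    rule weighted_estimate; (assumption | erule (2) annulus_wide | erule gt_m0_ge_2))

end
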